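(* Let $n\ge 1$, $k=n$, and let $H:\mathbb{R}^{2n}\to\mathbb{R}$, written $H(z)=H(z_I,z_{II})$ with $z=(z_I,z_{II})\in\mathbb{R}^{2n-k}\times\mathbb{R}^k$, satisfy: (i) $H\in C^1(\mathbb{R}^{2n},\mathbb{R})$; (ii) $H(z_I,z_{II}+m)=H(z_I,z_{II})$ for all $z=(z_I,z_{II})\in\mathbb{R}^{2n}$ and all $m\in\mathbb{Z}^k$; (iii) there exist constants $r>0$ and $\mu>1$ such that $0<\mu H(z)\le z_I\cdot H_{z_I}(z)$ for all $z\in\mathbb{R}^{2n}$ with $|z_I|\ge r$. Then for every $T>0$ and every prime rotational vector $v\in\mathbb{Z}^k_1$, the boundary value problem $$\dot z(t)=JH'(z(t)),\qquad z(T)=z(0)+(0,v),$$ where $(0,v)\in\mathbb{R}^{2n-k}\times\mathbb{R}^k$, has at least $k$ distinct solutions, i.e. ${}^{\#}\mathcal{P}_H(T,v)\ge k$.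
   Context: For $1\le k\le 2n-1$ and $z=(z_1,\dots,z_{2n})\in\mathbb{R}^{2n}$ write $z=(z_I,z_{II})$ with $z_I=(z_1,\dots,z_{2n-k})$ and $z_{II}=(z_{2n-k+1},\dots,z_{2n})$, and $H_{z_I}=(H_{z_1},\dots,H_{z_{2n-k}})$ (partial derivatives). $H'$ is the gradient of $H$, and $J=\begin{pmatrix}0&-I_n\\ I_n&0\end{pmatrix}$. $\mathbb{Z}^k_1$ is the set of all prime rotational vectors: $v=(v_1,\dots,v_k)\in\mathbb{Z}^k\setminus\{0\}$ is prime if one of its coordinates equals $1$ while the others are zero, or two of its coordinates are relatively prime. A solution of the boundary value problem is a $C^1$ function $z$ which, extended to $\mathbb{R}$ by $z(t+T)=z(t)+(0,v)$, satisfies $\dot z=JH'(z)$ on $\mathbb{R}$. Two solutions $z^{(1)},z^{(2)}$ are regarded as the same if $z^{(2)}(t)=z^{(1)}(t+\theta)+(0,m)$ for all $t$, for some $\theta\in\mathbb{R}$ and $m\in\mathbb{Z}^k$; otherwise they are distinct. $\mathcal{P}_H(T,v)$ is the set of distinct solutions and ${}^{\#}\mathcal{P}_H(T,v)$ its cardinality. *)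

theory Defs
  imports "HOL-Analysis.Analysis"
begin

text \<open>
  With \<open>k = n\<close> the phase space is the product of two copies of \<open>real ^ 'n\<close>, \<open>n = CARD('n) \<ge> 1\<close>:
  \<open>fst z\<close> is \<open>z\<^sub>I\<close> and \<open>snd z\<close> is \<open>z\<^sub>I\<^sub>I\<close>. The inner product and norm on the product type
  are the Euclidean ones.
\<close>

type_synonym 'n phase = "(real ^ 'n) \<times> (real ^ 'n)"

definition gradient :: "('a::real_inner \<Rightarrow> real) \<Rightarrow> 'a \<Rightarrow> 'a"
  where "gradient H z = (THE g. GDERIV H z :> g)"

text \<open>\<open>THE\<close> returns a junk value where \<open>H\<close> is not differentiable, hence the first conjunct.\<close>

definition C1_function :: "('a::euclidean_space \<Rightarrow> real) \<Rightarrow> bool"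
  where "C1_function H \<longleftrightarrow> (\<forall>z. H differentiable (at z)) \<and> continuous_on UNIV (gradient H)"

text \<open>The action of the block matrix with rows \<open>(0, - I)\<close> and \<open>(I, 0)\<close>.\<close>

definition J :: "'n::finite phase \<Rightarrow> 'n phase"
  where "J z = (- snd z, fst z)"

definition int_vec :: "int ^ 'n \<Rightarrow> real ^ 'n::finite"
  where "int_vec m = (\<chi> i. of_int (m $ i))"

definition prime_rotational :: "int ^ 'n::finite \<Rightarrow> bool"
  where "prime_rotational v \<longleftrightarrow> v \<noteq> 0 \<and>
    ((\<exists>i. v $ i = 1 \<and> (\<forall>j. j \<noteq> i \<longrightarrow> v $ j = 0)) \<or>
     (\<exists>i j. i \<noteq> j \<and> coprime (v $ i) (v $ j)))"

text \<open>Solutions are represented by their extensions to the whole real line.\<close>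

definition bvp_solutions ::
    "('n::finite phase \<Rightarrow> real) \<Rightarrow> real \<Rightarrow> int ^ 'n \<Rightarrow> (real \<Rightarrow> 'n phase) set"
  where "bvp_solutions H T v = {z. z C1_differentiable_on UNIV \<and>
    (\<forall>t. z (t + T) = z t + (0, int_vec v)) \<and>
    (\<forall>t. (z has_vector_derivative J (gradient H (z t))) (at t))}"

definition same_solution :: "(real \<Rightarrow> 'n::finite phase) \<Rightarrow> (real \<Rightarrow> 'n phase) \<Rightarrow> bool"
  where "same_solution z w \<longleftrightarrow> (\<exists>\<theta> m. \<forall>t. w t = z (t + \<theta>) + (0, int_vec m))"

text \<open>A distinct solution is a class of solutions under the identification above.\<close>

definition distinct_solutions ::
    "('n::finite phase \<Rightarrow> real) \<Rightarrow> real \<Rightarrow> int ^ 'n \<Rightarrow> (real \<Rightarrow> 'n phase) set set"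
  where "distinct_solutions H T v = bvp_solutions H T v //
    {(z, w). z \<in> bvp_solutions H T v \<and> w \<in> bvp_solutions H T v \<and> same_solution z w}"

lemma GDERIV_unique:
  assumes "GDERIV f x :> a" and "GDERIV f x :> b"
  shows "a = b"
proof -
  have "(\<lambda>h. inner h a) = (\<lambda>h. inner h b)"
    using assms unfolding gderiv_def by (rule has_derivative_unique)
  then have "inner h a = inner h b" for h
    by (rule fun_cong)
  then have "inner (a - b) (a - b) = 0"
    by (simp add: inner_diff_right)
  then show ?thesis
    by simp
qed

lemma GDERIV_gradient:
  fixes H :: "'a::euclidean_space \<Rightarrow> real"
  assumes "H differentiable (at z)"
  shows "GDERIV H z :> gradient H z"
proof -
  obtain D where D: "(H has_derivative D) (at z)"
    using assms by (auto simp: differentiable_def)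
  then interpret linear D
    by (rule has_derivative_linear)
  have "D h = inner h (\<Sum>b\<in>Basis. D b *\<^sub>R b)" for h
  proof -
    have "D h = D (\<Sum>b\<in>Basis. inner h b *\<^sub>R b)"
      by (simp add: euclidean_representation)
    also have "\<dots> = (\<Sum>b\<in>Basis. inner h b * D b)"
      by (simp add: sum scale)
    also have "\<dots> = inner h (\<Sum>b\<in>Basis. D b *\<^sub>R b)"
      by (simp add: inner_sum_right mult.commute)
    finally show ?thesis .
  qed
  then have "D = (\<lambda>h. inner h (\<Sum>b\<in>Basis. D b *\<^sub>R b))"
    by (rule ext)
  with D have "(H has_derivative (\<lambda>h. inner h (\<Sum>b\<in>Basis. D b *\<^sub>R b))) (at z)"
    by (rule back_subst[where P = "\<lambda>D. (H has_derivative D) (at z)"])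
  then have *: "GDERIV H z :> (\<Sum>b\<in>Basis. D b *\<^sub>R b)"
    by (simp only: gderiv_def)
  show ?thesis
    unfolding gradient_def
    by (rule theI[where a = "\<Sum>b\<in>Basis. D b *\<^sub>R b"]) (use * GDERIV_unique in \<open>blast+\<close>)
qed

lemma equiv_same_solution:
  "equiv S {(z, w). z \<in> S \<and> w \<in> S \<and> same_solution z w}"
proof -
  have int_vec_simps: "int_vec 0 = 0" "int_vec (- m) = - int_vec m"
    "int_vec (m + p) = int_vec m + int_vec p" for m p :: "int ^ 'n::finite"
    by (simp_all add: int_vec_def vec_eq_iff)
  have refl: "same_solution z z" for z :: "real \<Rightarrow> 'n::finite phase"
    unfolding same_solution_def
    by (rule exI[of _ 0], rule exI[of _ 0]) (simp add: int_vec_simps zero_prod_def[symmetric])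
  have sym: "same_solution w z" if zw: "same_solution z w" for z w :: "real \<Rightarrow> 'n::finite phase"
  proof -
    obtain \<theta> m where *: "\<And>t. w t = z (t + \<theta>) + (0, int_vec m)"
      using zw unfolding same_solution_def by blast
    have "z t = w (t + - \<theta>) + (0, int_vec (- m))" for t
      by (simp add: * int_vec_simps add.assoc zero_prod_def[symmetric])
    then show ?thesis
      unfolding same_solution_def by blast
  qed
  have trans: "same_solution z u" if zw: "same_solution z w" and wu: "same_solution w u"
    for z w u :: "real \<Rightarrow> 'n::finite phase"
  proof -
    obtain \<theta> m \<eta> p where *: "\<And>t. w t = z (t + \<theta>) + (0, int_vec m)"
        "\<And>t. u t = w (t + \<eta>) + (0, int_vec p)"
      using zw wu unfolding same_solution_def by blast
    have "u t = z (t + (\<eta> + \<theta>)) + (0, int_vec (m + p))" for t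
      by (simp add: * int_vec_simps add.assoc)
    then show ?thesis
      unfolding same_solution_def by blast
  qed
  show ?thesis
    by (rule equivI) (auto simp: refl_on_def sym_def trans_def intro: refl sym trans)
qed

end

theory Submission
  imports Defs "HOL-Complex_Analysis.Great_Picard"
begin

text \<open>
  After rescaling to \<open>T = 1\<close>, solutions are critical points of the action
  \<open>\<integral> p \<bullet> q' - H\<close>. \<open>H\<close> is replaced by a Hamiltonian \<open>lam / 2 * |p|\<^sup>2 + F\<close> with \<open>F\<close> periodic in \<open>q\<close>
  and compactly supported in \<open>p\<close>; by conservation of energy and superquadraticity its solutions of
  bounded action are solutions for \<open>H\<close>. The action is discretised on \<open>N\<close> points (a symplectic Euler
  scheme, which only needs \<open>H\<close> to be \<open>C\<^sup>1\<close>) and decreased by explicit gradient steps. In the metric used,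
  \<open>H\<^sup>1\<close> for \<open>q\<close> and \<open>L\<^sup>2\<close> for \<open>p\<close>, almost critical points converge to solutions as \<open>N\<close> tends to infinity.

  The linear forms \<open>c\<^sub>m - (v\<^sub>m / v\<^sub>i) c\<^sub>i\<close>, evaluated at the mean of \<open>q (t) - t v\<close>, are invariant under time shifts.
  If there are only finitely many solutions, one can choose values \<open>\<beta>\<^sub>m\<close> that these \<open>n - 1\<close> forms take at no solution.
  The Poincare-Miranda theorem gives a descent trajectory that begins and ends with bounded action and
  whose \<open>m\<close>-th form equals \<open>\<beta>\<^sub>m\<close> at a prescribed time, these times being far apart. In each of
  the \<open>n\<close> time intervals so separated the trajectory comes close to a solution, and between two of these
  it passes through a region without solutions, which costs a definite amount of action. Hence \<open>n\<close>
  solutions have different actions.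
\<close>

section \<open>The Poincare-Miranda theorem\<close>

text \<open>Two obstacles shape the construction. The gradient of \<open>H\<close> is only
  continuous, so a gradient flow of the action need not be unique; explicit steps on a finite grid
  are well defined and depend continuously on the initial state, at the price of an error that must
  stay small along the whole trajectory. Hence the order of choices: grid size, gradient thresholds,
  admissible error, and last the step size, so that only the total elapsed time enters the error.
  Moreover the action is unbounded in both directions; \<open>e = 0\<close> at the start bounds it
  from above and \<open>y = 0\<close> at the end from below, which is why conditions are imposed at
  both ends. The prescribed levels do the work of a cup length argument on the torus of means modulo
  the direction of \<open>v\<close>, of dimension n - 1. Admissible levels exist because a time
  shift moves the mean along \<open>v\<close>, where the forms vanish, while integer translations
  contribute only countably many values. The upper bound for the action at the start does not depend
  on the truncation, so the truncation can be adapted to it.\<close>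

lemma tendsto_fun_coordinatewise:
  fixes X :: "nat \<Rightarrow> 'a \<Rightarrow> 'b::topological_space"
  assumes "\<And>a. (\<lambda>k. X k a) \<longlonglongrightarrow> x a"
  shows "X \<longlonglongrightarrow> x"
proof -
  have "limitin (product_topology (\<lambda>i. euclidean) UNIV) X x sequentially"
    unfolding limitin_componentwise using assms by (auto simp: extensional_def)
  then show ?thesis by (simp add: euclidean_product_topology)
qed

text \<open>Kuhn's combinatorial lemma on the grid of mesh \<open>2 * \<rho> / p\<close> gives a
  cell that for each coordinate has two vertices of opposite label. As p grows, the cells shrink
  along a subsequence to a point at which every component of \<open>f\<close> is both <= 0 and >= 0.
  The unknowns are functions on the whole type, so that continuity is that of the product topology;
  the points constructed have coordinate 0 outside \<open>I\<close>.\<close>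

lemma poincare_miranda:
  fixes f :: "('a \<Rightarrow> real) \<Rightarrow> 'a \<Rightarrow> real" and I :: "'a set"
  assumes fin: "finite I" and rho: "\<rho> > 0"
    and cont: "\<And>i. i \<in> I \<Longrightarrow> continuous_on UNIV (\<lambda>x. f x i)"
    and lo: "\<And>x i. \<lbrakk>i \<in> I; \<And>a. \<bar>x a\<bar> \<le> \<rho>; x i = - \<rho>\<rbrakk> \<Longrightarrow> f x i \<le> 0"
    and hi: "\<And>x i. \<lbrakk>i \<in> I; \<And>a. \<bar>x a\<bar> \<le> \<rho>; x i = \<rho>\<rbrakk> \<Longrightarrow> f x i \<ge> 0"
  obtains x where "\<And>a. \<bar>x a\<bar> \<le> \<rho>" "\<And>i. i \<in> I \<Longrightarrow> f x i = 0"
proof -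
  define n where "n = card I"
  obtain b where b: "bij_betw b {..<n} I"
    using ex_bij_betw_nat_finite[OF fin] by (auto simp: n_def atLeast0LessThan)
  define idx where "idx = the_inv_into {..<n} b"
  have idx: "idx a < n" "b (idx a) = a" if "a \<in> I" for a
    using b that the_inv_into_into[of b "{..<n}" a "{..<n}"] f_the_inv_into_f[of b "{..<n}" a]
    unfolding idx_def bij_betw_def by auto
  have idxb: "idx (b i) = i" "b i \<in> I" if "i < n" for i
    using b that unfolding idx_def bij_betw_def by (auto simp: the_inv_into_f_f)
  define pt where "pt p q a = (if a \<in> I then - \<rho> + 2 * \<rho> * real (q (idx a)) / real p else 0)"
    for p :: nat and q :: "nat \<Rightarrow> nat" and a
  \<comment> \<open>the labels record the sign of the \<open>i\<close>-th component, except that Kuhn's lemma prescribes them on faces\<close>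
  define label where "label p q i =
      (if q i = 0 \<or> (q i \<noteq> p \<and> f (pt p q) (b i) \<le> 0) then 0 else (1::nat))" for p q i
  have pt_bd: "\<bar>pt p q a\<bar> \<le> \<rho>" if "p > 0" "\<forall>i<n. q i \<le> p" for p q a
  proof (cases "a \<in> I")
    case True
    have "real (q (idx a)) / real p \<le> 1" using that idx(1)[OF True] by simp
    then have "2 * \<rho> * (real (q (idx a)) / real p) \<le> 2 * \<rho> * 1"
      using rho by (intro mult_left_mono) auto
    moreover have "0 \<le> 2 * \<rho> * (real (q (idx a)) / real p)" using rho by simp
    ultimately show ?thesis using True by (simp add: pt_def abs_le_iff)
  qed (use rho in \<open>simp add: pt_def\<close>)
  have lab0: "f (pt p q) (b i) \<le> 0" if "p > 0" "\<forall>i<n. q i \<le> p" "i < n" "label p q i = 0" for p q i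
  proof (cases "q i = 0")
    case True
    then have "pt p q (b i) = - \<rho>" using idxb[OF that(3)] by (simp add: pt_def)
    then show ?thesis using lo idxb[OF that(3)] pt_bd[OF that(1,2)] by blast
  qed (use that in \<open>auto simp: label_def split: if_splits\<close>)
  have lab1: "f (pt p q) (b i) \<ge> 0" if "p > 0" "\<forall>i<n. q i \<le> p" "i < n" "label p q i = 1" for p q i
  proof (cases "q i = p")
    case True
    then have "pt p q (b i) = \<rho>" using idxb[OF that(3)] that(1) by (simp add: pt_def)
    then show ?thesis using hi idxb[OF that(3)] pt_bd[OF that(1,2)] by blast
  qed (use that in \<open>auto simp: label_def split: if_splits\<close>)
  \<comment> \<open>\<open>R l i\<close> is a vertex of the cell with lowest corner \<open>q\<close>
    whose i-th label is l.\<close>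
  define good where "good p q R \<longleftrightarrow> (\<forall>i<n. q i < p) \<and> (\<forall>l<2. \<forall>i<n. (\<forall>j<n. q j \<le> R l i j \<and> R l i j \<le> q j + 1)
       \<and> label p (R l i) i = l)" for p :: nat and q :: "nat \<Rightarrow> nat" and R :: "nat \<Rightarrow> nat \<Rightarrow> nat \<Rightarrow> nat"
  have "\<exists>q R. good p q R" if "p > 0" for p
  proof -
    have lab: "\<forall>x. (\<forall>i<n. x i \<le> p) \<longrightarrow> (\<forall>i<n. label p x i = 0 \<or> label p x i = 1)"
      "\<forall>x. (\<forall>i<n. x i \<le> p) \<longrightarrow> (\<forall>i<n. x i = 0 \<longrightarrow> label p x i = 0)"
      "\<forall>x. (\<forall>i<n. x i \<le> p) \<longrightarrow> (\<forall>i<n. x i = p \<longrightarrow> label p x i = 1)"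
      using that by (auto simp: label_def)
    obtain q where q: "\<forall>i<n. q i < p"
      "\<forall>i<n. \<exists>r s. (\<forall>j<n. q j \<le> r j \<and> r j \<le> q j + 1) \<and> (\<forall>j<n. q j \<le> s j \<and> s j \<le> q j + 1) \<and> label p r i \<noteq> label p s i"
      by (rule kuhn_lemma[OF \<open>p > 0\<close> lab(1,2,3)]) (rule that)
    have "\<exists>r. (\<forall>j<n. q j \<le> r j \<and> r j \<le> q j + 1) \<and> label p r i = l" if il: "i < n" "l < 2" for i l
    proof -
      obtain r s where rs: "\<forall>j<n. q j \<le> r j \<and> r j \<le> q j + 1" "\<forall>j<n. q j \<le> s j \<and> s j \<le> q j + 1"
        "label p r i \<noteq> label p s i"
        using q(2)[rule_format, OF il(1)] by blast
      moreover have "label p r i = 0 \<or> label p r i = 1" "label p s i = 0 \<or> label p s i = 1" "l = 0 \<or> l = 1"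
        using that by (auto simp: label_def)
      ultimately have "label p r i = l \<or> label p s i = l" by linarith
      then show ?thesis using rs by blast
    qed
    then have "\<forall>l i. \<exists>r. i < n \<longrightarrow> l < 2 \<longrightarrow> (\<forall>j<n. q j \<le> r j \<and> r j \<le> q j + 1) \<and> label p r i = l"
      by blast
    then have "\<exists>R. \<forall>l i. i < n \<longrightarrow> l < 2 \<longrightarrow> (\<forall>j<n. q j \<le> R l i j \<and> R l i j \<le> q j + 1) \<and> label p (R l i) i = l"
      by (simp only: choice_iff)
    then obtain R where "\<forall>l i. i < n \<longrightarrow> l < 2 \<longrightarrow> (\<forall>j<n. q j \<le> R l i j \<and> R l i j \<le> q j + 1) \<and> label p (R l i) i = l"
      by blast
    with q(1) show ?thesis
      unfolding good_def by blast
  qed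
  then have "\<exists>Q. \<forall>k. \<exists>R. good (Suc k) (Q k) R" by (intro choice) blast
  then obtain Q R where QR: "\<And>k. good (Suc k) (Q k) (R k)" by metis
  have Qlt: "\<forall>i<n. Q k i \<le> Suc k" for k
    using QR[of k] unfolding good_def by (blast intro: less_imp_le)
  have Rb: "Q k j \<le> R k l i j \<and> R k l i j \<le> Q k j + 1" "label (Suc k) (R k l i) i = l"
    if "i < n" "l < 2" "j < n" for k l i j
    using QR[of k] that unfolding good_def by blast+
  have Rle: "\<forall>j<n. R k l i j \<le> Suc k" if "i < n" "l < 2" for k l i
    using Rb(1)[OF that, of _ k] QR[of k] unfolding good_def by fastforce
  obtain \<phi> where \<phi>: "strict_mono (\<phi> :: nat \<Rightarrow> nat)"
    and conv: "\<And>a. a \<in> I \<Longrightarrow> \<exists>l. (\<lambda>k. pt (Suc (\<phi> k)) (Q (\<phi> k)) a) \<longlonglongrightarrow> l"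
    by (rule function_convergent_subsequence[of I "\<lambda>k. pt (Suc k) (Q k)" \<rho>])
      (use countable_finite[OF fin] pt_bd[OF _ Qlt] in auto)
  define x where "x a = (if a \<in> I then lim (\<lambda>k. pt (Suc (\<phi> k)) (Q (\<phi> k)) a) else 0)" for a
  have Qx: "(\<lambda>k. pt (Suc (\<phi> k)) (Q (\<phi> k)) a) \<longlonglongrightarrow> x a" for a
  proof (cases "a \<in> I")
    case True
    then show ?thesis using conv[OF True] by (auto simp: x_def dest: limI)
  qed (simp add: pt_def x_def)
  have inv0: "(\<lambda>k. inverse (real (Suc (\<phi> k)))) \<longlonglongrightarrow> 0"
    using LIMSEQ_subseq_LIMSEQ[OF LIMSEQ_inverse_real_of_nat \<phi>] by (simp add: o_def)
  have Rx: "(\<lambda>k. pt (Suc (\<phi> k)) (R (\<phi> k) l i)) \<longlonglongrightarrow> x" if "i < n" "l < 2" for i l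
  proof (rule tendsto_fun_coordinatewise)
    fix a
    have "(\<lambda>k. pt (Suc (\<phi> k)) (R (\<phi> k) l i) a - pt (Suc (\<phi> k)) (Q (\<phi> k)) a) \<longlonglongrightarrow> 0"
    proof (rule Lim_null_comparison[OF _ tendsto_mult_right_zero[OF inv0, of "2 * \<rho>"]], intro always_eventually allI)
      fix k
      show "norm (pt (Suc (\<phi> k)) (R (\<phi> k) l i) a - pt (Suc (\<phi> k)) (Q (\<phi> k)) a) \<le> 2 * \<rho> * inverse (real (Suc (\<phi> k)))"
      proof (cases "a \<in> I")
        case True
        note b1 = Rb(1)[OF that idx(1)[OF True], of "\<phi> k"]
        have "pt (Suc (\<phi> k)) (R (\<phi> k) l i) a - pt (Suc (\<phi> k)) (Q (\<phi> k)) a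
            = 2 * \<rho> * inverse (real (Suc (\<phi> k))) * (real (R (\<phi> k) l i (idx a)) - real (Q (\<phi> k) (idx a)))"
          using True by (simp add: pt_def divide_inverse algebra_simps del: of_nat_Suc)
        moreover have "\<bar>real (R (\<phi> k) l i (idx a)) - real (Q (\<phi> k) (idx a))\<bar> \<le> 1"
          using b1 by linarith
        ultimately show ?thesis using rho by (simp add: abs_mult mult_left_le)
      qed (use rho in \<open>simp add: pt_def\<close>)
    qed
    from tendsto_add[OF this Qx[of a]] show "(\<lambda>k. pt (Suc (\<phi> k)) (R (\<phi> k) l i) a) \<longlonglongrightarrow> x a"
      by simp
  qed
  have flim: "(\<lambda>k. f (pt (Suc (\<phi> k)) (R (\<phi> k) l i)) (b i)) \<longlonglongrightarrow> f x (b i)" if "i < n" "l < 2" for i l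
    by (rule continuous_on_tendsto_compose[OF cont[OF idxb(2)[OF that(1)]] Rx[OF that]]) auto
  show thesis
  proof (rule that)
    fix a
    show "\<bar>x a\<bar> \<le> \<rho>"
      using tendsto_rabs[OF Qx[of a]] by (rule LIMSEQ_le_const2) (use pt_bd[OF _ Qlt] in auto)
  next
    fix a assume a: "a \<in> I"
    let ?i = "idx a"
    have i: "?i < n" "b ?i = a" using idx[OF a] by auto
    have "f x (b ?i) \<le> 0" by (rule LIMSEQ_le_const2[OF flim[OF i(1), of 0]])
        (use lab0[OF _ Rle[OF i(1)] i(1)] Rb(2)[OF i(1) _ i(1)] in auto)
    moreover have "f x (b ?i) \<ge> 0" by (rule LIMSEQ_le_const[OF flim[OF i(1), of 1]])
        (use lab1[OF _ Rle[OF i(1)] i(1)] Rb(2)[OF i(1) _ i(1)] in auto)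
    ultimately show "f x a = 0" using i by simp
  qed
qed

section \<open>Limits of Euler schemes\<close>

lemma riemann_sum_error:
  fixes f :: "real \<Rightarrow> 'a::euclidean_space"
  assumes cont: "continuous_on {0..1} f" and N: "N > 0"
    and osc: "\<And>s t. \<lbrakk>s \<in> {0..1}; t \<in> {0..1}; \<bar>s - t\<bar> \<le> 1 / real N\<rbrakk> \<Longrightarrow> norm (f s - f t) \<le> e"
  shows "norm ((1 / real N) *\<^sub>R (\<Sum>j<N. f (real j / real N)) - integral {0..1} f) \<le> e"
proof -
  have *: "norm ((1 / real N) *\<^sub>R (\<Sum>j<m. f (real j / real N)) - integral {0..real m / real N} f) \<le> e * (real m / real N)"
    if "m \<le> N" for m
    using that
  proof (induction m)
    case 0
    then show ?case by simp
  next
    case (Suc m)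
    let ?a = "real m / real N" and ?b = "real (Suc m) / real N"
    have ab: "0 \<le> ?a" "?a \<le> ?b" "?b \<le> 1" "?b - ?a = 1 / real N"
      using Suc.prems N by (auto simp: field_simps)
    have int: "f integrable_on {0..?b}"
      by (rule integrable_continuous_real, rule continuous_on_subset[OF cont]) (use ab in auto)
    have split: "integral {0..?b} f = integral {0..?a} f + integral {?a..?b} f"
      using Henstock_Kurzweil_Integration.integral_combine[OF ab(1,2) int] by simp
    have cab: "continuous_on {?a..?b} f"
      by (rule continuous_on_subset[OF cont]) (use ab in \<open>simp add: atLeastatMost_subset_iff del: of_nat_Suc\<close>)
    have "norm (integral {?a..?b} (\<lambda>t. f t - f ?a)) \<le> e * (?b - ?a)"
    proof (rule integral_bound[OF ab(2)])
      show "norm (f t - f ?a) \<le> e" if "t \<in> {?a..?b}" for t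
        by (rule osc) (use that ab order_trans[OF ab(1), of t] order_trans[OF _ ab(3), of t] in \<open>auto simp del: of_nat_Suc\<close>)
    qed (intro continuous_intros cab)
    also have "integral {?a..?b} (\<lambda>t. f t - f ?a) = integral {?a..?b} f - (1 / real N) *\<^sub>R f ?a"
      using Henstock_Kurzweil_Integration.integral_diff[OF integrable_continuous_real[OF cab] integrable_const_ivl[of "f ?a" ?a ?b]] ab
      by simp
    finally have 1: "norm ((1 / real N) *\<^sub>R f ?a - integral {?a..?b} f) \<le> e * (1 / real N)"
      using ab by (simp add: norm_minus_commute)
    have "norm ((1 / real N) *\<^sub>R (\<Sum>j<Suc m. f (real j / real N)) - integral {0..?b} f)
        = norm (((1 / real N) *\<^sub>R (\<Sum>j<m. f (real j / real N)) - integral {0..?a} f)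
           + ((1 / real N) *\<^sub>R f ?a - integral {?a..?b} f))"
      unfolding split by (simp add: algebra_simps)
    also have "\<dots> \<le> e * (real m / real N) + e * (1 / real N)"
      by (rule norm_triangle_mono[OF Suc.IH 1]) (use Suc.prems in simp)
    also have "\<dots> = e * ?b" by (simp add: algebra_simps add_divide_distrib)
    finally show ?case .
  qed
  from *[of N] N show ?thesis by simp
qed

lemma riemann_sum_tendsto:
  fixes f :: "real \<Rightarrow> 'a::euclidean_space"
  assumes cont: "continuous_on {0..1} f" and N: "filterlim N at_top sequentially" "\<And>k. N k > (0::nat)"
  shows "(\<lambda>k. (1 / real (N k)) *\<^sub>R (\<Sum>j<N k. f (real j / real (N k)))) \<longlonglongrightarrow> integral {0..1} f"
proof (rule tendstoI)
  fix e :: real assume e: "e > 0"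
  obtain d where d: "d > 0" "\<And>s t. \<lbrakk>s \<in> {0..1}; t \<in> {0..1}; dist t s < d\<rbrakk> \<Longrightarrow> dist (f t) (f s) < e / 2"
    using compact_uniformly_continuous[OF cont compact_Icc] e
    unfolding uniformly_continuous_on_def by (meson half_gt_zero)
  have "\<forall>\<^sub>F k in sequentially. N k \<ge> nat \<lceil>1 / d\<rceil> + 1"
    using N(1) by (auto simp: filterlim_at_top)
  then show "\<forall>\<^sub>F k in sequentially. dist ((1 / real (N k)) *\<^sub>R (\<Sum>j<N k. f (real j / real (N k)))) (integral {0..1} f) < e"
  proof eventually_elim
    case (elim k)
    have "1 / d < real (N k)" using elim by linarith
    then have "1 / real (N k) < d" using d(1) N(2)[of k] by (simp add: field_simps)
    then have "norm ((1 / real (N k)) *\<^sub>R (\<Sum>j<N k. f (real j / real (N k))) - integral {0..1} f) \<le> e / 2"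
      by (intro riemann_sum_error[OF cont N(2)])
        (use d(2) in \<open>force simp: dist_norm abs_minus_commute norm_minus_commute intro: less_imp_le\<close>)
    then show ?case using e by (simp add: dist_norm)
  qed
qed

text \<open>\<open>ramp (N * t - i)\<close> is the fraction of the grid cell from i/N to (i+1)/N
  that lies to the left of t. Weighting by it turns the sums of an Euler scheme into a piecewise
  linear curve.\<close>

definition ramp :: "real \<Rightarrow> real"
  where "ramp x = max 0 (min 1 x)"

lemma ramp_mono: "x \<le> y \<Longrightarrow> ramp x \<le> ramp y"
  by (auto simp: ramp_def)

lemma sum_ramp: "(\<Sum>i<N. ramp (x - real i)) = max 0 (min (real N) x)"
  by (induction N) (auto simp: ramp_def)

text \<open>Peano's argument: the Euler polygons share a Lipschitz constant, so Arzela-Ascoli gives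
  a uniform limit. Near t all slopes are close to \<open>V (z t)\<close> by continuity alone, which
  identifies the derivative. The residual is assumed in summed form, so the errors of single steps
  may be large as long as their sums are small.\<close>

lemma euler_limit:
  fixes V :: "'a::euclidean_space \<Rightarrow> 'a" and Z :: "nat \<Rightarrow> nat \<Rightarrow> 'a" and N :: "nat \<Rightarrow> nat"
  assumes contV: "continuous_on UNIV V" and N: "filterlim N at_top sequentially" "\<And>k. N k > 0"
    and bd: "\<And>k j. j \<le> N k \<Longrightarrow> norm (Z k j) \<le> R"
    and \<epsilon>: "\<epsilon> \<longlonglongrightarrow> 0"
    and res: "\<And>k j. j \<le> N k \<Longrightarrow> norm (Z k j - Z k 0 - (1 / real (N k)) *\<^sub>R (\<Sum>i<j. V (Z k i))) \<le> \<epsilon> k"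
  obtains z \<phi> where "strict_mono \<phi>"
    "\<And>t. t \<in> {0..1} \<Longrightarrow> (z has_vector_derivative V (z t)) (at t within {0..1})"
    "\<And>e. e > 0 \<Longrightarrow> \<forall>\<^sub>F k in sequentially. \<forall>j\<le>N (\<phi> k). norm (Z (\<phi> k) j - z (real j / real (N (\<phi> k)))) < e"
proof -
  have "compact (V ` cball 0 R)"
    by (rule compact_continuous_image[OF continuous_on_subset[OF contV]]) auto
  then obtain L where L: "L > 0" "\<And>x. norm x \<le> R \<Longrightarrow> norm (V x) \<le> L"
    using bounded_pos[of "V ` cball 0 R"] compact_imp_bounded by (auto simp: dist_norm)
  define f where "f k t = Z k 0 + (1 / real (N k)) *\<^sub>R (\<Sum>i<N k. ramp (real (N k) * t - real i) *\<^sub>R V (Z k i))" for k t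
  have sumramp: "(\<Sum>i<N k. ramp (real (N k) * t - real i)) = real (N k) * t" if "t \<in> {0..1}" for k t
    using that N(2)[of k] unfolding sum_ramp by (auto simp: max_def min_def mult_left_le)
  \<comment> \<open>Between t and y the polygon uses only the velocities of cells that meet this
    interval; all other weights \<open>?c i\<close> are 0. With \<open>V0 = 0\<close> this yields
    the Lipschitz bound, with \<open>V0 = V (z t)\<close> the derivative. Both distances occur in
    the hypothesis so that t and y can be exchanged.\<close>
  have diff1: "norm (f k y - f k t - (y - t) *\<^sub>R V0) \<le> (y - t) * D"
    if ty: "t \<in> {0..1}" "y \<in> {0..1}" "t \<le> y"
      and D: "\<And>i. \<lbrakk>i < N k; \<bar>real i / real (N k) - t\<bar> \<le> \<bar>y - t\<bar> + 1 / real (N k) \<and>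
        \<bar>real i / real (N k) - y\<bar> \<le> \<bar>y - t\<bar> + 1 / real (N k)\<rbrakk> \<Longrightarrow> norm (V (Z k i) - V0) \<le> D"
    for k y t V0 D
  proof -
    let ?n = "real (N k)"
    let ?c = "\<lambda>i. ramp (?n * y - real i) - ramp (?n * t - real i)"
    have n: "?n > 0" using N(2)[of k] by simp
    have c0: "?c i \<ge> 0" for i using ty n by (simp add: ramp_mono)
    have sumc: "(\<Sum>i<N k. ?c i) = ?n * (y - t)"
      using sumramp[OF ty(1), of k] sumramp[OF ty(2), of k] by (simp add: sum_subtractf algebra_simps)
    have "f k y - f k t = (1 / ?n) *\<^sub>R (\<Sum>i<N k. ?c i *\<^sub>R V (Z k i))"
      by (simp add: f_def sum_subtractf scaleR_diff_left scaleR_diff_right)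
    moreover have "(y - t) *\<^sub>R V0 = (1 / ?n) *\<^sub>R (\<Sum>i<N k. ?c i *\<^sub>R V0)"
      unfolding scaleR_sum_left[symmetric] sumc using n by simp
    ultimately have "f k y - f k t - (y - t) *\<^sub>R V0 = (1 / ?n) *\<^sub>R (\<Sum>i<N k. ?c i *\<^sub>R (V (Z k i) - V0))"
      by (simp add: sum_subtractf scaleR_diff_right)
    also have "norm \<dots> \<le> (1 / ?n) * (\<Sum>i<N k. ?c i * D)"
    proof -
      have "norm (?c i *\<^sub>R (V (Z k i) - V0)) \<le> ?c i * D" if i: "i < N k" for i
      proof (cases "real i \<le> ?n * y \<and> ?n * t \<le> real i + 1")
        case True
        then have "real i / ?n \<le> y" "t \<le> real i / ?n + 1 / ?n" "1 / ?n > 0"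
          using n by (simp_all add: field_simps)
        then have "norm (V (Z k i) - V0) \<le> D" using ty by (intro D[OF i]) linarith
        then show ?thesis using c0[of i] by (simp add: mult_left_mono)
      next
        case False
        have "?n * t \<le> ?n * y" using ty n by simp
        then have "?c i = 0" using False by (auto simp: ramp_def)
        then show ?thesis by simp
      qed
      then have "norm (\<Sum>i<N k. ?c i *\<^sub>R (V (Z k i) - V0)) \<le> (\<Sum>i<N k. ?c i * D)"
        by (intro sum_norm_le) auto
      then show ?thesis using n by (simp add: divide_right_mono)
    qed
    also have "\<dots> = (y - t) * D" using n by (simp add: sum_distrib_right[symmetric] sumc)
    finally show ?thesis .
  qed
  have diff: "norm (f k y - f k t - (y - t) *\<^sub>R V0) \<le> \<bar>y - t\<bar> * D"
    if ty: "t \<in> {0..1}" "y \<in> {0..1}"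
      and D: "\<And>i. \<lbrakk>i < N k; \<bar>real i / real (N k) - t\<bar> \<le> \<bar>y - t\<bar> + 1 / real (N k)\<rbrakk> \<Longrightarrow> norm (V (Z k i) - V0) \<le> D"
    for k y t V0 D
  proof (cases "t \<le> y")
    case True
    then show ?thesis using diff1[OF ty, of k V0 D] D by simp
  next
    case False
    then have "norm (f k t - f k y - (t - y) *\<^sub>R V0) \<le> \<bar>y - t\<bar> * D"
      using diff1[OF ty(2,1), of k V0 D] D by simp
    moreover have "f k y - f k t - (y - t) *\<^sub>R V0 = - (f k t - f k y - (t - y) *\<^sub>R V0)"
      by (simp add: algebra_simps)
    ultimately show ?thesis by (simp only: norm_minus_cancel)
  qed
  have flip: "norm (f k y - f k t) \<le> L * \<bar>y - t\<bar>" if "t \<in> {0..1}" "y \<in> {0..1}" for k y t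
    using diff[OF that, of k 0 L] L(2) bd by (simp add: mult.commute)
  have fgrid: "f k (real j / real (N k)) = Z k 0 + (1 / real (N k)) *\<^sub>R (\<Sum>i<j. V (Z k i))" if "j \<le> N k" for k j
  proof -
    have "(\<Sum>i<N k. ramp (real j - real i) *\<^sub>R V (Z k i)) = (\<Sum>i<j. V (Z k i))"
      by (rule sum.mono_neutral_cong_right) (use that in \<open>auto simp: ramp_def\<close>)
    then show ?thesis using N(2)[of k] by (simp add: f_def)
  qed
  have fbd: "norm (f k t) \<le> R + L" if "t \<in> {0..1}" for k t
  proof -
    have "f k 0 = Z k 0" using fgrid[of 0 k] by simp
    then have "norm (f k t) \<le> norm (Z k 0) + norm (f k t - f k 0)"
      by (metis add.commute diff_add_cancel norm_triangle_ineq)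
    also have "\<dots> \<le> R + L * 1"
      using bd[of 0 k] flip[of 0 t k] that L(1) by (intro add_mono) (auto intro: order_trans mult_left_le)
    finally show ?thesis by simp
  qed
  obtain z \<phi> where z: "continuous_on {0..1} z" "strict_mono (\<phi> :: nat \<Rightarrow> nat)"
    and unif: "\<And>e. 0 < e \<Longrightarrow> \<exists>m. \<forall>k x. k \<ge> m \<and> x \<in> {0..1} \<longrightarrow> norm (f (\<phi> k) x - z x) < e"
  proof (rule Arzela_Ascoli[of "{0..1::real}" f "R + L"])
    show "\<exists>d>0. \<forall>n y. y \<in> {0..1} \<and> norm (x - y) < d \<longrightarrow> norm (f n x - f n y) < e"
      if "x \<in> {0..1}" "0 < e" for x e :: real
    proof (intro exI[of _ "e / L"] conjI allI impI)
      fix n y assume y: "y \<in> {0..1} \<and> norm (x - y) < e / L"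
      have "norm (f n x - f n y) \<le> L * \<bar>x - y\<bar>" using flip that y by blast
      also have "\<dots> < e" using y L(1) by (simp add: field_simps)
      finally show "norm (f n x - f n y) < e" .
    qed (use that L in simp)
  qed (use fbd in auto)
  have zlim: "(\<lambda>k. f (\<phi> k) t) \<longlonglongrightarrow> z t" if "t \<in> {0..1}" for t
    unfolding LIMSEQ_iff using unif that by blast
  have zlip: "norm (z y - z t) \<le> L * \<bar>y - t\<bar>" if "t \<in> {0..1}" "y \<in> {0..1}" for y t
    by (rule LIMSEQ_le_const2[OF tendsto_norm[OF tendsto_diff[OF zlim[OF that(2)] zlim[OF that(1)]]]])
      (use flip that in auto)
  have \<epsilon>': "(\<lambda>k. \<epsilon> (\<phi> k)) \<longlonglongrightarrow> 0"
    using LIMSEQ_subseq_LIMSEQ[OF \<epsilon> z(2)] by (simp add: o_def)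
  have grid: "\<forall>\<^sub>F k in sequentially. \<forall>j\<le>N (\<phi> k). norm (Z (\<phi> k) j - z (real j / real (N (\<phi> k)))) < e" if e: "e > 0" for e
  proof -
    obtain m where m: "\<And>k x. k \<ge> m \<Longrightarrow> x \<in> {0..1} \<Longrightarrow> norm (f (\<phi> k) x - z x) < e / 2"
      using unif[of "e / 2"] e by auto
    have "\<forall>\<^sub>F k in sequentially. \<epsilon> (\<phi> k) < e / 2"
      using order_tendstoD(2)[OF \<epsilon>', of "e / 2"] e by simp
    then show ?thesis using eventually_ge_at_top[of m]
    proof eventually_elim
      case (elim k)
      show ?case
      proof (intro allI impI)
        fix j assume j: "j \<le> N (\<phi> k)"
        let ?t = "real j / real (N (\<phi> k))"
        have t: "?t \<in> {0..1}" using j N(2)[of "\<phi> k"] by auto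
        have "Z (\<phi> k) j - z ?t = (Z (\<phi> k) j - f (\<phi> k) ?t) + (f (\<phi> k) ?t - z ?t)"
          by simp
        also have "norm \<dots> \<le> norm (Z (\<phi> k) j - f (\<phi> k) ?t) + norm (f (\<phi> k) ?t - z ?t)"
          by (rule norm_triangle_ineq)
        also have "norm (Z (\<phi> k) j - f (\<phi> k) ?t) \<le> \<epsilon> (\<phi> k)"
          using res[OF j] by (simp add: fgrid[OF j] diff_diff_eq)
        finally show "norm (Z (\<phi> k) j - z ?t) < e" using m[OF elim(2) t] elim(1) by linarith
      qed
    qed
  qed
  have deriv: "(z has_vector_derivative V (z t)) (at t within {0..1})" if t: "t \<in> {0..1}" for t
    unfolding has_vector_derivative_def has_derivative_within_alt
  proof (intro conjI allI impI bounded_linear_scaleR_left)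
    fix e :: real assume e: "e > 0"
    have "isCont V (z t)" using contV by (simp add: continuous_on_eq_continuous_at)
    then obtain d0 where d0: "d0 > 0" "\<And>x. dist x (z t) < d0 \<Longrightarrow> dist (V x) (V (z t)) < e"
      using e unfolding continuous_at_eps_delta by blast
    \<comment> \<open>The radius \<open>d0 / (4 * L)\<close> and a mesh below it keep
      \<open>z\<close> at the relevant grid points within \<open>d0 / 2\<close> of
      \<open>z t\<close>; the other \<open>d0 / 2\<close> is left for the distance between the
      scheme and \<open>z\<close>.\<close>
    show "\<exists>d>0. \<forall>y\<in>{0..1}. norm (y - t) < d \<longrightarrow> norm (z y - z t - (y - t) *\<^sub>R V (z t)) \<le> e * norm (y - t)"
    proof (intro exI[of _ "d0 / (4 * L)"] conjI ballI impI)
      fix y :: real assume y: "y \<in> {0..1}" "norm (y - t) < d0 / (4 * L)"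
      have "\<forall>\<^sub>F k in sequentially. N (\<phi> k) \<ge> nat \<lceil>4 * L / d0\<rceil> + 1"
        using filterlim_compose[OF N(1) filterlim_subseq[OF z(2)]] by (auto simp: filterlim_at_top)
      then have "\<forall>\<^sub>F k in sequentially. norm (f (\<phi> k) y - f (\<phi> k) t - (y - t) *\<^sub>R V (z t)) \<le> \<bar>y - t\<bar> * e"
        using grid[of "d0 / 2", OF half_gt_zero[OF d0(1)]]
      proof eventually_elim
        case (elim k)
        let ?n = "real (N (\<phi> k))"
        have "4 * L / d0 < ?n" using elim(1) by linarith
        then have n: "L * (1 / ?n) < d0 / 4"
          using d0(1) N(2)[of "\<phi> k"] by (simp add: field_simps)
        show ?case
        proof (rule diff[OF t y(1)])
          fix i assume i: "i < N (\<phi> k)" "\<bar>real i / ?n - t\<bar> \<le> \<bar>y - t\<bar> + 1 / ?n"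
          have "norm (z (real i / ?n) - z t) \<le> L * \<bar>real i / ?n - t\<bar>"
            by (rule zlip[OF t]) (use i in auto)
          also have "\<dots> \<le> L * (\<bar>y - t\<bar> + 1 / ?n)"
            using i L(1) by (intro mult_left_mono) auto
          also have "\<dots> < d0 / 2"
          proof -
            have "L * \<bar>y - t\<bar> < d0 / 4" using y(2) L(1) by (simp add: field_simps)
            then show ?thesis using n by (simp only: distrib_left)
          qed
          finally have "norm (Z (\<phi> k) i - z t) < d0"
            using elim(2)[rule_format, OF less_imp_le[OF i(1)]]
              norm_triangle_ineq[of "Z (\<phi> k) i - z (real i / ?n)" "z (real i / ?n) - z t"]
            by simp
          then show "norm (V (Z (\<phi> k) i) - V (z t)) \<le> e"
            using d0(2) by (force simp: dist_norm intro: less_imp_le)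
        qed
      qed
      then have "norm (z y - z t - (y - t) *\<^sub>R V (z t)) \<le> \<bar>y - t\<bar> * e"
        by (intro tendsto_upperbound[OF tendsto_norm[OF tendsto_diff[OF tendsto_diff[OF zlim[OF y(1)] zlim[OF t]] tendsto_const]]]) auto
      then show "norm (z y - z t - (y - t) *\<^sub>R V (z t)) \<le> e * norm (y - t)"
        by (simp add: mult.commute)
    qed (use d0 L in simp)
  qed
  show thesis by (rule that[OF z(2) deriv grid])
qed

lemma periodic_int_multiple:
  fixes w :: "'a::real_vector"
  assumes per: "\<And>x. f (x + w) = f x"
  shows "f (x + of_int m *\<^sub>R w) = f x"
proof -
  have 1: "f (x + of_nat n *\<^sub>R w) = f x" for x n
  proof (induction n)
    case (Suc n)
    have "x + of_nat (Suc n) *\<^sub>R w = (x + of_nat n *\<^sub>R w) + w"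
      by (simp add: scaleR_left_distrib)
    then show ?case by (simp only: per Suc)
  qed simp
  show ?thesis
  proof (cases m)
    case (neg n)
    have "of_int m *\<^sub>R w + real (Suc n) *\<^sub>R w = 0"
      unfolding scaleR_left_distrib[symmetric] using neg by simp
    then have eq: "x + of_int m *\<^sub>R w + real (Suc n) *\<^sub>R w = x"
      by (simp only: add.assoc add_0_right)
    show ?thesis using 1[of "x + of_int m *\<^sub>R w" "Suc n", unfolded eq] by simp
  qed (use 1 in simp)
qed

text \<open>On each unit interval the extension is a translate of \<open>z\<close> in time and
  space, again a solution because \<open>V\<close> has period \<open>w\<close>. At integers both
  one-sided derivatives equal \<open>V (u t)\<close>.\<close>

lemma quasi_periodic_extension:
  fixes z :: "real \<Rightarrow> 'a::real_normed_vector" and V :: "'a \<Rightarrow> 'a"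
  assumes deriv: "\<And>t. t \<in> {0..1} \<Longrightarrow> (z has_vector_derivative V (z t)) (at t within {0..1})"
    and z1: "z 1 = z 0 + w" and V: "\<And>x. V (x + w) = V x"
  obtains u where "\<And>t. t \<in> {0..1} \<Longrightarrow> u t = z t" "\<And>t. u (t + 1) = u t + w"
    "\<And>t. (u has_vector_derivative V (u t)) (at t)"
proof -
  define u where "u t = z (frac t) + of_int \<lfloor>t\<rfloor> *\<^sub>R w" for t
  have V': "V (x + of_int m *\<^sub>R w) = V x" for x m
    by (rule periodic_int_multiple[of V w, OF V])
  have upiece: "u t = z (t - of_int m) + of_int m *\<^sub>R w" if "t \<in> {of_int m..of_int m + 1}" for t and m :: int
  proof (cases "t = of_int m + 1")
    case True
    then show ?thesis by (simp add: u_def frac_def z1 algebra_simps)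
  next
    case False
    then have "\<lfloor>t\<rfloor> = m" using that by (intro floor_unique) auto
    then show ?thesis by (simp add: u_def frac_def)
  qed
  have piece: "(u has_vector_derivative V (u t)) (at t within {of_int m..of_int m + 1})"
    if t: "t \<in> {of_int m..of_int m + 1}" for t and m :: int
  proof -
    have a: "((\<lambda>s. s - of_int m) has_vector_derivative 1) (at t within {of_int m..of_int m + 1})"
      by (auto intro!: derivative_eq_intros)
    have im: "(\<lambda>s. s - of_int m) ` {of_int m..of_int m + 1} = {0..1::real}"
    proof -
      have "s \<in> (\<lambda>s. s - of_int m) ` {of_int m..of_int m + 1}" if "s \<in> {0..1}" for s :: real
        by (rule image_eqI[of _ _ "s + of_int m"]) (use that in auto)
      then show ?thesis by auto
    qed
    have b: "(z has_vector_derivative V (z (t - of_int m))) (at (t - of_int m) within (\<lambda>s. s - of_int m) ` {of_int m..of_int m + 1})"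
      unfolding im by (rule deriv) (use t in auto)
    have "((\<lambda>s. z (s - of_int m)) has_vector_derivative V (z (t - of_int m))) (at t within {of_int m..of_int m + 1})"
      using vector_diff_chain_within[OF a b] by (simp add: o_def)
    then have "((\<lambda>s. z (s - of_int m) + of_int m *\<^sub>R w) has_vector_derivative V (u t)) (at t within {of_int m..of_int m + 1})"
      using V'[of "z (t - of_int m)" m] upiece[OF t] by (auto intro!: derivative_eq_intros)
    then show ?thesis
      by (rule has_vector_derivative_transform[OF t _, rotated]) (use upiece in auto)
  qed
  have dU: "(u has_vector_derivative V (u t)) (at t)" for t
  proof (cases "t = of_int \<lfloor>t\<rfloor>")
    case True
    define m where "m = \<lfloor>t\<rfloor>"
    have t: "t = of_int m" using True m_def by simp
    have 1: "(u has_vector_derivative V (u t)) (at t within {of_int m..of_int m + 1})"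
      by (rule piece) (simp add: t)
    have 2: "(u has_vector_derivative V (u t)) (at t within {of_int (m - 1)..of_int (m - 1) + 1})"
      by (rule piece) (simp add: t)
    have "(u has_vector_derivative V (u t)) (at t within ({of_int m..of_int m + 1} \<union> {of_int (m - 1)..of_int (m - 1) + 1}))"
      using 1 2 unfolding has_vector_derivative_def has_derivative_within
      by (simp add: at_within_union filterlim_sup)
    moreover have "at t within ({of_int m..of_int m + 1} \<union> {of_int (m - 1)..of_int (m - 1) + 1}) = at t"
    proof (rule at_within_interior)
      have "{t - 1<..<t + 1} \<subseteq> interior ({of_int m..of_int m + 1} \<union> {of_int (m - 1)..of_int (m - 1) + 1})"
        by (rule interior_maximal) (auto simp: t)
      then show "t \<in> interior ({of_int m..of_int m + 1} \<union> {of_int (m - 1)..of_int (m - 1) + 1})"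
        by auto
    qed
    ultimately show ?thesis by simp
  next
    case False
    have lt: "of_int \<lfloor>t\<rfloor> < t" "t < of_int \<lfloor>t\<rfloor> + 1"
      using False by (metis of_int_floor_le order_le_less) linarith
    then have "(u has_vector_derivative V (u t)) (at t within {of_int \<lfloor>t\<rfloor>..of_int \<lfloor>t\<rfloor> + 1})"
      by (intro piece) auto
    moreover have "at t within {of_int \<lfloor>t\<rfloor>..of_int \<lfloor>t\<rfloor> + 1} = at t"
      by (rule at_within_Icc_at) (use lt in auto)
    ultimately show ?thesis by simp
  qed
  show thesis
  proof (rule that[of u])
    show "u t = z t" if "t \<in> {0..1}" for t using upiece[of t 0] that by simp
    show "u (t + 1) = u t + w" for t by (simp add: u_def frac_def algebra_simps)
  qed (rule dU)
qed

section \<open>Averages over a finite grid\<close>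

text \<open>Normalised so that grid sums approximate integrals over the unit interval and estimates
  come out uniform in \<open>N\<close>; for \<open>N = 0\<close> the value is 0.\<close>

definition avg :: "nat \<Rightarrow> (nat \<Rightarrow> 'a::real_vector) \<Rightarrow> 'a"
  where "avg N f = (1 / real N) *\<^sub>R (\<Sum>j<N. f j)"

abbreviation (input) avg_norm :: "nat \<Rightarrow> (nat \<Rightarrow> 'a::real_normed_vector) \<Rightarrow> real"
  where "avg_norm N f \<equiv> avg N (\<lambda>j. norm (f j))"

abbreviation (input) avg_sq :: "nat \<Rightarrow> (nat \<Rightarrow> 'a::real_normed_vector) \<Rightarrow> real"
  where "avg_sq N f \<equiv> avg N (\<lambda>j. (norm (f j))\<^sup>2)"

abbreviation (input) avg_ip :: "nat \<Rightarrow> (nat \<Rightarrow> 'a::real_inner) \<Rightarrow> (nat \<Rightarrow> 'a) \<Rightarrow> real"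
  where "avg_ip N f g \<equiv> avg N (\<lambda>j. f j \<bullet> g j)"

lemma avg_add: "avg N (\<lambda>j. f j + g j) = avg N f + avg N g"
  by (simp add: avg_def sum.distrib scaleR_add_right)

lemma avg_diff: "avg N (\<lambda>j. f j - g j) = avg N f - avg N g"
  by (simp add: avg_def sum_subtractf scaleR_diff_right)

lemma avg_minus: "avg N (\<lambda>j. - f j) = - avg N f"
  by (simp add: avg_def sum_negf)

lemma avg_scaleR: "avg N (\<lambda>j. c *\<^sub>R f j) = c *\<^sub>R avg N f"
  by (simp add: avg_def scaleR_sum_right mult.commute)

lemma avg_mult: "avg N (\<lambda>j. c * f j) = c * avg N f" for c :: real
  using avg_scaleR[of N c f] by simp

lemma avg_const: "N > 0 \<Longrightarrow> avg N (\<lambda>j. c) = c"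
  by (simp add: avg_def sum_constant_scaleR)

lemma avg_cong: "(\<And>j. j < N \<Longrightarrow> f j = g j) \<Longrightarrow> avg N f = avg N g"
  by (simp add: avg_def)

lemma avg_inner_left: "avg N (\<lambda>j. f j \<bullet> c) = avg N f \<bullet> c"
  by (simp add: avg_def inner_sum_left)

lemma avg_inner_right: "avg N (\<lambda>j. c \<bullet> f j) = c \<bullet> avg N f"
  by (simp add: avg_def inner_sum_right)

lemma avg_swap: "avg N (\<lambda>j. avg M (\<lambda>i. f j i)) = avg M (\<lambda>i. avg N (\<lambda>j. f j i))"
  by (simp add: avg_def scaleR_sum_right[symmetric] sum.swap[of _ "{..<N}"] mult.commute)

lemma avg_mono: "(\<And>j. j < N \<Longrightarrow> f j \<le> g j) \<Longrightarrow> avg N f \<le> avg N g" for f :: "nat \<Rightarrow> real"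
  unfolding avg_def by (intro scaleR_left_mono sum_mono) auto

lemma avg_nonneg: "(\<And>j. j < N \<Longrightarrow> 0 \<le> f j) \<Longrightarrow> 0 \<le> avg N f" for f :: "nat \<Rightarrow> real"
  using avg_mono[of N "\<lambda>_. 0" f] by (simp add: avg_def)

lemma norm_avg_le: "norm (avg N f) \<le> avg_norm N f"
  for f :: "nat \<Rightarrow> 'a::real_normed_vector"
  by (simp add: avg_def divide_right_mono norm_sum)

lemma avg_le_const: "\<lbrakk>\<And>j. j < N \<Longrightarrow> f j \<le> c; 0 \<le> c\<rbrakk> \<Longrightarrow> avg N f \<le> c" for f :: "nat \<Rightarrow> real"
  using avg_mono[of N f "\<lambda>_. c"] avg_const[of N c] by (cases "N = 0") (auto simp: avg_def)

lemma norm_avg_le_const: "\<lbrakk>\<And>j. j < N \<Longrightarrow> norm (f j) \<le> c; 0 \<le> c\<rbrakk> \<Longrightarrow> norm (avg N f) \<le> c"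
  for f :: "nat \<Rightarrow> 'a::real_normed_vector"
  using norm_avg_le avg_le_const by (metis (no_types, lifting) order_trans)

text \<open>Nonnegativity of the variance of \<open>f\<close> over the grid.\<close>

lemma norm_avg_sq_le: "(norm (avg N f))\<^sup>2 \<le> avg_sq N f"
  for f :: "nat \<Rightarrow> 'a::real_inner"
proof (cases "N = 0")
  case False
  have "0 \<le> avg N (\<lambda>j. (norm (f j - avg N f))\<^sup>2)" by (rule avg_nonneg) simp
  also have "\<dots> = avg N (\<lambda>j. (norm (f j))\<^sup>2 - 2 * (f j \<bullet> avg N f) + avg N f \<bullet> avg N f)"
    by (simp add: power2_norm_eq_inner inner_diff_left inner_diff_right inner_commute algebra_simps)
  also have "\<dots> = avg_sq N f - 2 * (avg N f \<bullet> avg N f) + avg N f \<bullet> avg N f"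
    using False by (simp only: avg_add avg_diff avg_mult avg_inner_left avg_const)
  finally show ?thesis by (simp add: power2_norm_eq_inner)
qed (simp add: avg_def)

lemma norm_add_sq_le: "(norm (a + b))\<^sup>2 \<le> 2 * (norm a)\<^sup>2 + 2 * (norm b)\<^sup>2" for a b :: "'a::real_inner"
  using zero_le_power2[of "norm (a - b)"] unfolding power2_norm_eq_inner
  by (simp add: inner_add_left inner_add_right inner_diff_left inner_diff_right inner_commute)

lemma avg_norm_sq_diff: "avg N (\<lambda>j. (norm (f j - s *\<^sub>R g j))\<^sup>2) = avg_sq N f
    - 2 * s * avg N (\<lambda>j. f j \<bullet> g j) + s\<^sup>2 * avg_sq N g"
  for f :: "nat \<Rightarrow> 'a::real_inner"
proof -
  have "(norm (f j - s *\<^sub>R g j))\<^sup>2 = (norm (f j))\<^sup>2 - 2 * s * (f j \<bullet> g j) + s\<^sup>2 * (norm (g j))\<^sup>2" for j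
    unfolding power2_norm_eq_inner
    by (simp add: inner_diff_left inner_diff_right inner_commute power2_eq_square algebra_simps)
  then show ?thesis by (simp add: avg_add avg_diff avg_mult)
qed

section \<open>Integer translations and functions periodic in the configuration\<close>

lemma int_vec_nth [simp]: "int_vec m $ i = of_int (m $ i)"
  by (simp add: int_vec_def)

lemma ex_int_translate:
  fixes c :: "real ^ 'n::finite"
  shows "\<exists>m :: int ^ 'n. norm (c - int_vec m) \<le> real CARD('n)"
proof -
  let ?m = "\<chi> i. \<lfloor>c $ i\<rfloor>"
  have "norm (c - int_vec ?m) \<le> (\<Sum>i\<in>UNIV. \<bar>(c - int_vec ?m) $ i\<bar>)"
    by (rule norm_le_l1_cart)
  also have "\<dots> \<le> (\<Sum>i\<in>(UNIV::'n set). 1)"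
    by (intro sum_mono) (simp add: abs_le_iff, linarith)
  finally show ?thesis by auto
qed

lemma norm_fst_le': "norm (fst z) \<le> norm z" and norm_snd_le': "norm (snd z) \<le> norm z"
  using norm_fst_le[of "fst z" "snd z"] norm_snd_le[of "snd z" "fst z"] by simp_all

text \<open>Integer translations move any point with bounded momentum into the compact set
  \<open>?K\<close>. For the modulus of continuity both points must be moved by the same vector; the
  extra 1 in the radii leaves room for the second one.\<close>

lemma periodic_compact_support_uniform:
  fixes \<Gamma> :: "'n::finite phase \<Rightarrow> 'b::real_normed_vector"
  assumes cont: "continuous_on UNIV \<Gamma>"
    and per: "\<And>x y m. \<Gamma> (x, y + int_vec m) = \<Gamma> (x, y)"
    and supp: "\<And>x y. norm x \<ge> R \<Longrightarrow> \<Gamma> (x, y) = 0"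
  shows "\<exists>B. \<forall>z. norm (\<Gamma> z) \<le> B"
    and "e > 0 \<Longrightarrow> \<exists>d>0. \<forall>z z'. norm (z - z') < d \<longrightarrow> norm (\<Gamma> z - \<Gamma> z') < e"
proof -
  let ?K = "cball 0 (\<bar>R\<bar> + 1) \<times> cball 0 (real CARD('n) + 1) :: 'n phase set"
  have K: "compact ?K" by (intro compact_Times compact_cball)
  have cK: "continuous_on ?K \<Gamma>" by (rule continuous_on_subset[OF cont]) auto
  have tr: "\<exists>m. norm (snd z - int_vec m) \<le> real CARD('n)" for z :: "'n phase"
    by (rule ex_int_translate)
  have eq: "\<Gamma> (fst z, snd z - int_vec m) = \<Gamma> z" for z m
    using per[of "fst z" "snd z - int_vec m" m] by simp
  have "compact (\<Gamma> ` ?K)" by (rule compact_continuous_image[OF cK K])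
  then obtain B where B: "\<And>z. z \<in> ?K \<Longrightarrow> norm (\<Gamma> z) \<le> B" "B > 0"
    using bounded_pos[of "\<Gamma> ` ?K"] compact_imp_bounded by auto
  have "norm (\<Gamma> z) \<le> B" for z
  proof (cases "norm (fst z) \<ge> R")
    case True
    then show ?thesis using supp[of "fst z" "snd z"] B(2) by simp
  next
    case False
    obtain m where "norm (snd z - int_vec m) \<le> real CARD('n)"
      using tr by blast
    then have "(fst z, snd z - int_vec m) \<in> ?K" using False by auto
    then show ?thesis using B(1) eq by metis
  qed
  then show "\<exists>B. \<forall>z. norm (\<Gamma> z) \<le> B" by blast
  assume e: "e > 0"
  obtain d where d: "d > 0" "\<And>z z'. \<lbrakk>z \<in> ?K; z' \<in> ?K; norm (z' - z) < d\<rbrakk> \<Longrightarrow> norm (\<Gamma> z' - \<Gamma> z) < e"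
    using compact_uniformly_continuous[OF cK K] e unfolding uniformly_continuous_on_def dist_norm by metis
  show "\<exists>d>0. \<forall>z z'. norm (z - z') < d \<longrightarrow> norm (\<Gamma> z - \<Gamma> z') < e"
  proof (intro exI[of _ "min d (1 / 2)"] conjI allI impI)
    fix z z' :: "'n phase" assume zz: "norm (z - z') < min d (1 / 2)"
    have n1: "norm (fst z - fst z') < 1 / 2" "norm (snd z - snd z') < 1 / 2"
      using zz norm_fst_le'[of "z - z'"] norm_snd_le'[of "z - z'"] by auto
    show "norm (\<Gamma> z - \<Gamma> z') < e"
    proof (cases "norm (fst z') \<ge> R \<and> norm (fst z) \<ge> R")
      case True
      then show ?thesis using supp[of "fst z" "snd z"] supp[of "fst z'" "snd z'"] e by simp
    next
      case False
      obtain m where m: "norm (snd z - int_vec m) \<le> real CARD('n)"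
        using tr by blast
      have "norm (fst z) \<le> norm (fst z') + 1 / 2" "norm (fst z') \<le> norm (fst z) + 1 / 2"
        using n1(1) norm_triangle_ineq2[of "fst z" "fst z'"] norm_triangle_ineq2[of "fst z'" "fst z"]
        by (auto simp: norm_minus_commute)
      then have "norm (fst z) \<le> \<bar>R\<bar> + 1" "norm (fst z') \<le> \<bar>R\<bar> + 1"
        using False by auto
      moreover have "norm (snd z' - int_vec m) \<le> norm (snd z - int_vec m) + norm (snd z - snd z')"
        using norm_triangle_ineq4[of "snd z - int_vec m" "snd z - snd z'"] by simp
      ultimately have "(fst z, snd z - int_vec m) \<in> ?K" "(fst z', snd z' - int_vec m) \<in> ?K"
        using m n1(2) by auto
      moreover have "(fst z, snd z - int_vec m) - (fst z', snd z' - int_vec m) = z - z'"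
        by (simp add: prod_eq_iff)
      ultimately show ?thesis
        using d(2)[of "(fst z', snd z' - int_vec m)" "(fst z, snd z - int_vec m)"] zz eq by simp
    qed
  qed (use d in simp)
qed

section \<open>The discrete action\<close>

text \<open>
  A state \<open>(c, y, e)\<close> with \<open>e\<close> of mean \<open>0\<close> stands for the discrete loop with velocity \<open>q' = w + lam e\<close>, with \<open>c\<close>
  the mean of \<open>q (t) - t w\<close>, and with momentum \<open>p = y + q' / lam\<close>. Completing the square in \<open>p\<close> makes
  the quadratic part of the action diagonal: \<open>e\<close> spans the positive and \<open>y\<close> the negative directions.
\<close>

type_synonym 'n state = "(real ^ 'n) \<times> (nat \<Rightarrow> real ^ 'n) \<times> (nat \<Rightarrow> real ^ 'n)"

locale discretisation =
  fixes F :: "'n::finite phase \<Rightarrow> real" and G :: "'n phase \<Rightarrow> 'n phase"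
    and lam R :: real and v :: "int ^ 'n"
  assumes F_deriv: "\<And>z. GDERIV F z :> G z"
    and G_cont: "continuous_on UNIV G"
    and F_per: "\<And>x y m. F (x, y + int_vec m) = F (x, y)"
    and G_per: "\<And>x y m. G (x, y + int_vec m) = G (x, y)"
    and F_supp: "\<And>x y. norm x \<ge> R \<Longrightarrow> F (x, y) = 0"
    and G_supp: "\<And>x y. norm x \<ge> R \<Longrightarrow> G (x, y) = 0"
    and lam: "lam > 0"
begin

abbreviation "w \<equiv> int_vec v :: real ^ 'n"

section \<open>Uniform bounds and moduli of continuity for \<open>F\<close> and
  \<open>G\<close>\<close>

lemma F_cont: "continuous_on UNIV F"
  using F_deriv by (auto simp: gderiv_def continuous_on_eq_continuous_at intro!: has_derivative_continuous)

lemma ex_bound: "\<exists>B>0. \<forall>z. norm (G z) \<le> B \<and> \<bar>F z\<bar> \<le> B"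
proof -
  obtain B1 where B1: "\<And>z. norm (G z) \<le> B1"
    using periodic_compact_support_uniform(1)[of G R] G_cont G_per G_supp by auto
  obtain B2 where B2: "\<And>z. norm (F z) \<le> B2"
    using periodic_compact_support_uniform(1)[of F R] F_cont F_per F_supp by auto
  have "norm (G z) \<le> \<bar>B1\<bar> + \<bar>B2\<bar> + 1" "\<bar>F z\<bar> \<le> \<bar>B1\<bar> + \<bar>B2\<bar> + 1" for z
    using B1[of z] B2[of z] by auto
  then show ?thesis by (intro exI[of _ "\<bar>B1\<bar> + \<bar>B2\<bar> + 1"]) auto
qed

definition "B = (SOME B. B > 0 \<and> (\<forall>z. norm (G z) \<le> B \<and> \<bar>F z\<bar> \<le> B))"

lemma B_pos: "B > 0" and norm_G_le: "norm (G z) \<le> B" and abs_F_le: "\<bar>F z\<bar> \<le> B"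
  using someI_ex[OF ex_bound] unfolding B_def[symmetric] by blast+

lemma norm_fst_G_le: "norm (fst (G z)) \<le> B" and norm_snd_G_le: "norm (snd (G z)) \<le> B"
  using norm_G_le[of z] norm_fst_le'[of "G z"] norm_snd_le'[of "G z"] by linarith+

text \<open>Substitute for a Lipschitz constant of \<open>G\<close>: uniform continuity handles
  distances below d, and beyond d the trivial bound 2B is at most \<open>2 * B / d\<close> times the
  distance.\<close>

lemma G_modulus:
  assumes "e > 0"
  shows "\<exists>C\<ge>0. \<forall>z z'. norm (G z - G z') \<le> e + C * norm (z - z')"
proof -
  obtain d where d: "d > 0" "\<And>z z'. norm (z - z') < d \<Longrightarrow> norm (G z - G z') < e"
    using periodic_compact_support_uniform(2)[OF G_cont G_per G_supp assms] by blast
  have "norm (G z - G z') \<le> e + 2 * B / d * norm (z - z')" for z z'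
  proof (cases "norm (z - z') < d")
    case True
    then show ?thesis
      using d B_pos by (smt (verit) divide_nonneg_pos mult_nonneg_nonneg norm_ge_zero)
  next
    case False
    have "norm (G z - G z') \<le> 2 * B"
      using norm_triangle_ineq4[of "G z" "G z'"] norm_G_le[of z] norm_G_le[of z'] by simp
    also have "\<dots> = 2 * B / d * d" using d by simp
    also have "\<dots> \<le> 2 * B / d * norm (z - z')"
      using False d B_pos by (intro mult_left_mono) auto
    finally show ?thesis using assms by simp
  qed
  then show ?thesis using d B_pos by (intro exI[of _ "2 * B / d"]) auto
qed

text \<open>Young's inequality applied to \<open>G_modulus\<close>. The quadratic form is the one
  that can be averaged, since the gradient controls momenta in the mean square only.\<close>

lemma G_modulus_sq:
  assumes "e > 0"
  shows "\<exists>C\<ge>0. \<forall>z z'. norm (G z - G z') \<le> e + C * (norm (z - z'))\<^sup>2"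
proof -
  obtain C where C: "C \<ge> 0" "\<And>z z'. norm (G z - G z') \<le> e / 2 + C * norm (z - z')"
    using G_modulus[of "e / 2"] assms by auto
  have "C * t \<le> e / 2 + C\<^sup>2 / (2 * e) * t\<^sup>2" for t :: real
  proof -
    have "0 \<le> (e - C * t)\<^sup>2 / (2 * e)" using assms by simp
    also have "\<dots> = e / 2 + C\<^sup>2 / (2 * e) * t\<^sup>2 - C * t"
      using assms by (simp add: power2_eq_square field_simps)
    finally show ?thesis by simp
  qed
  then have "norm (G z - G z') \<le> e + C\<^sup>2 / (2 * e) * (norm (z - z'))\<^sup>2" for z z'
    using C(2)[of z z'] by (smt (verit) field_sum_of_halves)
  then show ?thesis using assms by (intro exI[of _ "C\<^sup>2 / (2 * e)"]) auto
qed

lemma F_mvt: "\<exists>\<theta>. 0 < \<theta> \<and> \<theta> < 1 \<and> F (z + \<zeta>) - F z = G (z + \<theta> *\<^sub>R \<zeta>) \<bullet> \<zeta>"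
proof -
  have "((\<lambda>t. F (z + t *\<^sub>R \<zeta>)) has_real_derivative G (z + t *\<^sub>R \<zeta>) \<bullet> \<zeta>) (at t)" for t
  proof -
    have 1: "((\<lambda>t. z + t *\<^sub>R \<zeta>) has_derivative (\<lambda>h. h *\<^sub>R \<zeta>)) (at t)"
      by (auto intro!: derivative_eq_intros)
    have 2: "(F has_derivative (\<lambda>h. h \<bullet> G (z + t *\<^sub>R \<zeta>))) (at (z + t *\<^sub>R \<zeta>))"
      using F_deriv unfolding gderiv_def by blast
    show ?thesis using has_derivative_compose[OF 1 2]
      by (simp add: has_field_derivative_def inner_commute mult_commute_abs)
  qed
  from MVT2[OF zero_less_one this] show ?thesis by auto
qed

lemma F_lipschitz: "\<bar>F (z + \<zeta>) - F z\<bar> \<le> B * norm \<zeta>"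
proof -
  obtain \<theta> where "F (z + \<zeta>) - F z = G (z + \<theta> *\<^sub>R \<zeta>) \<bullet> \<zeta>"
    using F_mvt by blast
  then show ?thesis
    using order_trans[OF Cauchy_Schwarz_ineq2 mult_right_mono[OF norm_G_le norm_ge_zero]] by simp
qed

text \<open>Taylor's formula with the mean value theorem. The linear term with small coefficient
  \<open>e\<close> replaces a bound on second derivatives, and only the side needed to bound
  \<open>- F\<close> from above after a step is stated.\<close>

lemma F_remainder:
  assumes "e > 0"
  shows "\<exists>C\<ge>0. \<forall>z \<zeta>. F z + G z \<bullet> \<zeta> - F (z + \<zeta>) \<le> e * norm \<zeta> + C * (norm \<zeta>)\<^sup>2"
proof -
  obtain C where C: "C \<ge> 0" "\<And>z z'. norm (G z - G z') \<le> e + C * norm (z - z')"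
    using G_modulus[OF assms] by auto
  have "F z + G z \<bullet> \<zeta> - F (z + \<zeta>) \<le> e * norm \<zeta> + C * (norm \<zeta>)\<^sup>2" for z \<zeta>
  proof -
    obtain \<theta> where \<theta>: "0 < \<theta>" "\<theta> < 1" "F (z + \<zeta>) - F z = G (z + \<theta> *\<^sub>R \<zeta>) \<bullet> \<zeta>"
      using F_mvt by blast
    have "F z + G z \<bullet> \<zeta> - F (z + \<zeta>) = (G z - G (z + \<theta> *\<^sub>R \<zeta>)) \<bullet> \<zeta>"
      using \<theta>(3) by (simp add: inner_diff_left)
    also have "\<dots> \<le> norm (G z - G (z + \<theta> *\<^sub>R \<zeta>)) * norm \<zeta>"
      by (rule norm_cauchy_schwarz)
    also have "norm (G z - G (z + \<theta> *\<^sub>R \<zeta>)) \<le> e + C * norm \<zeta>"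
    proof -
      have "norm (z - (z + \<theta> *\<^sub>R \<zeta>)) \<le> norm \<zeta>"
        using \<theta> by (simp add: mult_left_le_one_le)
      then show ?thesis
        using C(2)[of z "z + \<theta> *\<^sub>R \<zeta>"] mult_left_mono[OF _ C(1)] by (smt (verit))
    qed
    finally show ?thesis by (simp add: mult_right_mono power2_eq_square algebra_simps)
  qed
  then show ?thesis using C(1) by blast
qed

text \<open>
  \<open>ker\<close> integrates a periodic velocity of mean \<open>0\<close>; the second summand makes the mean of the primitive vanish.
\<close>

definition ker :: "nat \<Rightarrow> nat \<Rightarrow> nat \<Rightarrow> real"
  where "ker N j i = (if i < j then 1 else 0) - (real N - 1 - real i) / real N"

abbreviation (input) wavg :: "nat \<Rightarrow> nat \<Rightarrow> (nat \<Rightarrow> real ^ 'n) \<Rightarrow> real ^ 'n"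
  where "wavg N j f \<equiv> avg N (\<lambda>i. ker N j i *\<^sub>R f i)"

lemma abs_ker_le: "N > 0 \<Longrightarrow> i \<le> N \<Longrightarrow> j \<le> N \<Longrightarrow> \<bar>ker N j i\<bar> \<le> 1"
  by (auto simp: ker_def field_simps)

lemma avg_ker: "i < N \<Longrightarrow> avg N (\<lambda>j. ker N j i) = 0"
proof -
  assume i: "i < N"
  have "(\<Sum>j<N. if i < j then 1 else 0 :: real) = real (card ({..<N} \<inter> {j. i < j}))"
    by (subst sum.inter_filter[symmetric]) (auto simp: Int_def)
  also have "{..<N} \<inter> {j. i < j} = {i<..<N}" by auto
  finally show ?thesis using i by (simp add: avg_def ker_def sum_subtractf of_nat_diff)
qed

fun mom :: "'n state \<Rightarrow> nat \<Rightarrow> real ^ 'n"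
  where "mom (c, y, e) j = y j + (1 / lam) *\<^sub>R w + e j"

fun conf :: "nat \<Rightarrow> 'n state \<Rightarrow> nat \<Rightarrow> real ^ 'n"
  where "conf N (c, y, e) j = c + (real j / real N) *\<^sub>R w + lam *\<^sub>R wavg N j e"

definition node :: "nat \<Rightarrow> 'n state \<Rightarrow> nat \<Rightarrow> 'n phase"
  where "node N x j = (mom x j, conf N x j)"

fun act :: "nat \<Rightarrow> 'n state \<Rightarrow> real"
  where "act N (c, y, e) = lam / 2 * avg_sq N e + (norm w)\<^sup>2 / (2 * lam)
     - lam / 2 * avg_sq N y - avg N (\<lambda>j. F (node N (c, y, e) j))"

text \<open>
  The components of the gradient of \<open>act\<close> in the metric \<open>|c|\<^sup>2 + avg |y|\<^sup>2 + avg |e|\<^sup>2\<close>;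
  subtracting the mean in \<open>gr_e\<close> projects onto the states with \<open>e\<close> of mean \<open>0\<close>.
\<close>

definition "gr_c N x = - avg N (\<lambda>j. snd (G (node N x j)))"

definition "gr_y N x j = - (lam *\<^sub>R fst (snd x) j) - fst (G (node N x j))"

text \<open>\<open>e\<close> enters \<open>F\<close> through the momentum and, via
  \<open>ker\<close>, through all positions; the chain rule gives the second summand with the
  transposed kernel.\<close>

definition "raw N x j = fst (G (node N x j)) + lam *\<^sub>R avg N (\<lambda>i. ker N i j *\<^sub>R snd (G (node N x i)))"

definition "gr_e N x j = lam *\<^sub>R snd (snd x) j - (raw N x j - avg N (raw N x))"

definition "gsq N x = (norm (gr_c N x))\<^sup>2 + avg_sq N (gr_y N x) + avg_sq N (gr_e N x)"

definition "step N s x = (fst x - s *\<^sub>R gr_c N x, \<lambda>j. fst (snd x) j - s *\<^sub>R gr_y N x j,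
     \<lambda>j. snd (snd x) j - s *\<^sub>R gr_e N x j)"

lemma gsq_nonneg: "gsq N x \<ge> 0"
  unfolding gsq_def by (intro add_nonneg_nonneg avg_nonneg) auto

lemma avg_gr_e: "N > 0 \<Longrightarrow> avg N (snd (snd x)) = 0 \<Longrightarrow> avg N (gr_e N x) = 0"
  unfolding gr_e_def by (simp add: avg_diff avg_scaleR avg_const)

lemma avg_step: "N > 0 \<Longrightarrow> avg N (snd (snd x)) = 0 \<Longrightarrow> avg N (snd (snd (step N s x))) = 0"
  using avg_gr_e[of N x] by (simp add: step_def avg_diff avg_scaleR)

lemma node_step:
  "node N (step N s x) j = node N x j + (- s) *\<^sub>R (gr_y N x j + gr_e N x j, gr_c N x + lam *\<^sub>R wavg N j (gr_e N x))"
proof -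
  obtain c y e where x: "x = (c, y, e)" by (cases x) auto
  have "avg N (\<lambda>i. ker N j i *\<^sub>R (e i - s *\<^sub>R gr_e N (c, y, e) i))
      = wavg N j e - s *\<^sub>R avg N (\<lambda>i. ker N j i *\<^sub>R gr_e N (c, y, e) i)"
    by (simp add: scaleR_diff_right avg_diff avg_scaleR[symmetric] mult.commute)
  then show ?thesis by (simp add: node_def step_def x) (simp add: algebra_simps)
qed

text \<open>The displacement of the nodes is linear in the gradient, and since the kernel is bounded
  by 1 its mean square is bounded with a constant independent of \<open>N\<close>. This is what
  allows one step size for all grids.\<close>

lemma direction_sq_le:
  assumes "N > 0"
  shows "avg N (\<lambda>j. (norm (gr_y N x j + gr_e N x j, gr_c N x + lam *\<^sub>R wavg N j (gr_e N x)))\<^sup>2)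
      \<le> (2 + 2 * lam\<^sup>2) * gsq N x"
proof -
  have k: "(norm (wavg N j (gr_e N x)))\<^sup>2 \<le> avg_sq N (gr_e N x)" if j: "j < N" for j
  proof -
    have "(norm (wavg N j (gr_e N x)))\<^sup>2 \<le> avg N (\<lambda>i. (norm (ker N j i *\<^sub>R gr_e N x i))\<^sup>2)"
      by (rule norm_avg_sq_le)
    also have "\<dots> \<le> avg_sq N (gr_e N x)"
    proof (rule avg_mono)
      fix i assume "i < N"
      then have "\<bar>ker N j i\<bar> * norm (gr_e N x i) \<le> 1 * norm (gr_e N x i)"
        using j by (intro mult_right_mono abs_ker_le) auto
      then show "(norm (ker N j i *\<^sub>R gr_e N x i))\<^sup>2 \<le> (norm (gr_e N x i))\<^sup>2"
        by (intro power_mono) auto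
    qed
    finally show ?thesis .
  qed
  have "avg N (\<lambda>j. (norm (gr_y N x j + gr_e N x j, gr_c N x + lam *\<^sub>R wavg N j (gr_e N x)))\<^sup>2)
      \<le> avg N (\<lambda>j. 2 * (norm (gr_y N x j))\<^sup>2 + 2 * (norm (gr_e N x j))\<^sup>2
          + (2 * (norm (gr_c N x))\<^sup>2 + 2 * lam\<^sup>2 * avg_sq N (gr_e N x)))"
  proof (rule avg_mono)
    fix j assume j: "j < N"
    have "(norm (gr_c N x + lam *\<^sub>R wavg N j (gr_e N x)))\<^sup>2
        \<le> 2 * (norm (gr_c N x))\<^sup>2 + 2 * (norm (lam *\<^sub>R wavg N j (gr_e N x)))\<^sup>2"
      by (rule norm_add_sq_le)
    also have "(norm (lam *\<^sub>R wavg N j (gr_e N x)))\<^sup>2 \<le> lam\<^sup>2 * avg_sq N (gr_e N x)"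
      using mult_left_mono[OF k[OF j], of "lam\<^sup>2"] by (simp add: power_mult_distrib)
    finally show "(norm (gr_y N x j + gr_e N x j, gr_c N x + lam *\<^sub>R wavg N j (gr_e N x)))\<^sup>2
      \<le> 2 * (norm (gr_y N x j))\<^sup>2 + 2 * (norm (gr_e N x j))\<^sup>2
          + (2 * (norm (gr_c N x))\<^sup>2 + 2 * lam\<^sup>2 * avg_sq N (gr_e N x))"
      using norm_add_sq_le[of "gr_y N x j" "gr_e N x j"] by (simp add: norm_Pair)
  qed
  also have "\<dots> = 2 * avg_sq N (gr_y N x) + (2 + 2 * lam\<^sup>2) * avg_sq N (gr_e N x)
     + 2 * (norm (gr_c N x))\<^sup>2"
    by (simp add: avg_add avg_mult avg_const[OF assms] algebra_simps)
  also have "\<dots> \<le> (2 + 2 * lam\<^sup>2) * gsq N x"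
  proof -
    have "0 \<le> avg_sq N (gr_y N x)" by (rule avg_nonneg) simp
    then have "0 \<le> 2 * lam\<^sup>2 * avg_sq N (gr_y N x) + 2 * lam\<^sup>2 * (norm (gr_c N x))\<^sup>2"
      by (intro add_nonneg_nonneg mult_nonneg_nonneg) auto
    then show ?thesis by (simp add: gsq_def algebra_simps)
  qed
  finally show ?thesis .
qed

text \<open>\<open>s0\<close> does not depend on \<open>N\<close>. Since \<open>F\<close> is merely \<open>C\<^sup>1\<close>, the error \<open>s * eps\<close> cannot be avoided.\<close>

lemma descent:
  assumes eps: "eps > 0"
  shows "\<exists>s0>0. \<forall>N s x. N > 0 \<longrightarrow> 0 < s \<longrightarrow> s \<le> s0 \<longrightarrow> avg N (snd (snd x)) = 0 \<longrightarrow>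
     act N (step N s x) \<le> act N x - s / 2 * gsq N x + s * eps"
proof -
  define K where "K = 2 + 2 * lam\<^sup>2"
  have K: "K > 0" by (simp add: K_def add_pos_nonneg)
  obtain C where C: "C \<ge> 0"
    "\<And>z \<zeta>. F z + G z \<bullet> \<zeta> - F (z + \<zeta>) \<le> sqrt (eps / K) * norm \<zeta> + C * (norm \<zeta>)\<^sup>2"
    using F_remainder[of "sqrt (eps / K)"] eps K by auto
  \<comment> \<open>Half of the decrease \<open>s * gsq\<close> is given away: one quarter to the
    linear remainder, by Young's inequality with coefficient \<open>sqrt (eps / K)\<close>, and one
    quarter to all terms of order s squared, which determines \<open>s0\<close>.\<close>
  define s0 where "s0 = 1 / (4 * (lam / 2 + C * K))"
  have den: "lam / 2 + C * K > 0" using lam C(1) K by (simp add: add_pos_nonneg)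
  have s0: "s0 > 0" using den by (simp add: s0_def)
  have "act N (step N s x) \<le> act N x - s / 2 * gsq N x + s * eps"
    if N: "N > 0" and s: "0 < s" "s \<le> s0" and x0: "avg N (snd (snd x)) = 0" for N s x
  proof -
    obtain c y e where x: "x = (c, y, e)" by (cases x) auto
    have e0: "avg N e = 0" using x0 x by simp
    define \<omega> where "\<omega> j = (gr_y N x j + gr_e N x j, gr_c N x + lam *\<^sub>R wavg N j (gr_e N x))" for j
    define f where "f j = fst (G (node N x j))" for j
    define b where "b j = snd (G (node N x j))" for j
    have om: "avg N (\<lambda>j. (norm (\<omega> j))\<^sup>2) \<le> K * gsq N x"
      unfolding \<omega>_def K_def by (rule direction_sq_le[OF N])
    have Fj: "- F (node N (step N s x) j) \<le> - F (node N x j) + s * (G (node N x j) \<bullet> \<omega> j) + s * eps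
       + (s / (4 * K) + C * s\<^sup>2) * (norm (\<omega> j))\<^sup>2" for j
    proof -
      have "F (node N x j) + G (node N x j) \<bullet> ((- s) *\<^sub>R \<omega> j) - F (node N (step N s x) j)
         \<le> sqrt (eps / K) * norm ((- s) *\<^sub>R \<omega> j) + C * (norm ((- s) *\<^sub>R \<omega> j))\<^sup>2"
        using C(2)[of "node N x j" "(- s) *\<^sub>R \<omega> j"] by (simp add: node_step \<omega>_def)
      moreover have "sqrt (eps / K) * norm (\<omega> j) \<le> eps + (norm (\<omega> j))\<^sup>2 / (4 * K)"
      proof -
        have "0 \<le> (sqrt eps - norm (\<omega> j) / (2 * sqrt K))\<^sup>2" by simp
        also have "\<dots> = eps + (norm (\<omega> j))\<^sup>2 / (4 * K) - sqrt eps / sqrt K * norm (\<omega> j)"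
          using eps K by (simp add: power2_diff power_divide power_mult_distrib)
        finally show ?thesis by (simp add: real_sqrt_divide)
      qed
      then have "s * (sqrt (eps / K) * norm (\<omega> j)) \<le> s * (eps + (norm (\<omega> j))\<^sup>2 / (4 * K))"
        using s by (intro mult_left_mono) auto
      ultimately show ?thesis using s by (simp add: power_mult_distrib algebra_simps)
    qed
    have "avg N (\<lambda>j. - F (node N (step N s x) j)) \<le> avg N (\<lambda>j. - F (node N x j) + s * (G (node N x j) \<bullet> \<omega> j) + s * eps
       + (s / (4 * K) + C * s\<^sup>2) * (norm (\<omega> j))\<^sup>2)" by (intro avg_mono Fj)
    also have "\<dots> = - avg N (\<lambda>j. F (node N x j)) + s * avg N (\<lambda>j. G (node N x j) \<bullet> \<omega> j) + s * eps
       + (s / (4 * K) + C * s\<^sup>2) * avg N (\<lambda>j. (norm (\<omega> j))\<^sup>2)"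
      by (simp add: avg_add avg_diff avg_mult avg_const[OF N] avg_minus)
    also have "(s / (4 * K) + C * s\<^sup>2) * avg N (\<lambda>j. (norm (\<omega> j))\<^sup>2) \<le> (s / (4 * K) + C * s\<^sup>2) * (K * gsq N x)"
      using s K C(1) by (intro mult_left_mono[OF om]) auto
    finally have Favg: "- avg N (\<lambda>j. F (node N (step N s x) j)) \<le> - avg N (\<lambda>j. F (node N x j))
       + s * avg N (\<lambda>j. G (node N x j) \<bullet> \<omega> j) + s * eps + (s / 4 + C * K * s\<^sup>2) * gsq N x"
      using K by (simp add: avg_minus algebra_simps)
    \<comment> \<open>Exchanging the two averages transposes the kernel and produces the second
      summand of \<open>raw\<close>.\<close>
    have *: "avg N (\<lambda>j. b j \<bullet> wavg N j (gr_e N x)) = avg N (\<lambda>i. avg N (\<lambda>j. ker N j i *\<^sub>R b j) \<bullet> gr_e N x i)"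
    proof -
      have "avg N (\<lambda>j. b j \<bullet> wavg N j (gr_e N x)) = avg N (\<lambda>j. avg N (\<lambda>i. ker N j i * (b j \<bullet> gr_e N x i)))"
        unfolding avg_inner_right[symmetric] by simp
      also have "\<dots> = avg N (\<lambda>i. avg N (\<lambda>j. ker N j i * (b j \<bullet> gr_e N x i)))"
        by (rule avg_swap)
      finally show ?thesis
        unfolding avg_inner_left[symmetric] by simp
    qed
    have GO: "avg N (\<lambda>j. G (node N x j) \<bullet> \<omega> j) = avg_ip N f (gr_y N x) + avg_ip N (raw N x) (gr_e N x)
       - (norm (gr_c N x))\<^sup>2"
    proof -
      have "G (node N x j) \<bullet> \<omega> j = f j \<bullet> gr_y N x j + f j \<bullet> gr_e N x j + b j \<bullet> gr_c N x
          + lam * (b j \<bullet> wavg N j (gr_e N x))" for j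
        by (simp add: \<omega>_def f_def b_def inner_prod_def inner_add_right)
      then have "avg N (\<lambda>j. G (node N x j) \<bullet> \<omega> j) = avg_ip N f (gr_y N x) + avg_ip N f (gr_e N x)
          + avg N b \<bullet> gr_c N x + lam * avg N (\<lambda>i. avg N (\<lambda>j. ker N j i *\<^sub>R b j) \<bullet> gr_e N x i)"
        by (simp add: avg_add avg_mult avg_inner_left *)
      moreover have "avg N b = - gr_c N x"
        unfolding gr_c_def b_def by simp
      moreover have "avg_ip N (raw N x) (gr_e N x) = avg_ip N f (gr_e N x)
          + lam * avg N (\<lambda>i. avg N (\<lambda>j. ker N j i *\<^sub>R b j) \<bullet> gr_e N x i)"
        by (simp add: raw_def f_def b_def inner_add_left avg_add avg_mult)
      ultimately show ?thesis by (simp add: power2_norm_eq_inner)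
    qed
    have GY: "avg_sq N (gr_y N x) = - lam * avg_ip N y (gr_y N x) - avg_ip N f (gr_y N x)"
    proof -
      have "(norm (gr_y N x j))\<^sup>2 = - lam * (y j \<bullet> gr_y N x j) - f j \<bullet> gr_y N x j" for j
      proof -
        have "gr_y N x j = - (lam *\<^sub>R y j) - f j" by (simp add: gr_y_def f_def x)
        then have "gr_y N x j \<bullet> gr_y N x j = (- (lam *\<^sub>R y j) - f j) \<bullet> gr_y N x j"
          by simp
        then show ?thesis by (simp add: power2_norm_eq_inner inner_diff_left)
      qed
      then show ?thesis by (simp only: avg_diff avg_mult)
    qed
    \<comment> \<open>The projection subtracts the mean of \<open>raw\<close>, which is paired with
      the mean of \<open>gr_e\<close>, that is with 0.\<close>
    have GE: "avg_sq N (gr_e N x) = lam * avg_ip N e (gr_e N x) - avg_ip N (raw N x) (gr_e N x)"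
    proof -
      have "(norm (gr_e N x j))\<^sup>2 = lam * (e j \<bullet> gr_e N x j) - raw N x j \<bullet> gr_e N x j + avg N (raw N x) \<bullet> gr_e N x j" for j
      proof -
        have "gr_e N x j = lam *\<^sub>R e j - (raw N x j - avg N (raw N x))"
          by (simp add: gr_e_def x)
        then have "gr_e N x j \<bullet> gr_e N x j = (lam *\<^sub>R e j - (raw N x j - avg N (raw N x))) \<bullet> gr_e N x j"
          by simp
        then show ?thesis by (simp add: power2_norm_eq_inner inner_diff_left)
      qed
      then have "avg_sq N (gr_e N x) = lam * avg_ip N e (gr_e N x)
          - avg_ip N (raw N x) (gr_e N x) + avg N (raw N x) \<bullet> avg N (gr_e N x)"
        by (simp only: avg_add avg_diff avg_mult avg_inner_right)
      then show ?thesis using avg_gr_e[OF N x0] by simp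
    qed
    have step_x: "step N s x = (c - s *\<^sub>R gr_c N x, \<lambda>j. y j - s *\<^sub>R gr_y N x j, \<lambda>j. e j - s *\<^sub>R gr_e N x j)"
      by (simp add: step_def x)
    have a0: "act N x = lam / 2 * avg_sq N e + (norm w)\<^sup>2 / (2 * lam)
        - lam / 2 * avg_sq N y - avg N (\<lambda>j. F (node N x j))" by (simp add: x)
    have a1: "act N (step N s x) = lam / 2 * avg N (\<lambda>j. (norm (e j - s *\<^sub>R gr_e N x j))\<^sup>2) + (norm w)\<^sup>2 / (2 * lam)
        - lam / 2 * avg N (\<lambda>j. (norm (y j - s *\<^sub>R gr_y N x j))\<^sup>2) - avg N (\<lambda>j. F (node N (step N s x) j))"
      by (simp add: step_x)
    define a where "a = avg_sq N (gr_y N x)"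
    define d where "d = avg_sq N (gr_e N x)"
    have ad: "a \<ge> 0" "d \<ge> 0" "d \<le> gsq N x"
      unfolding a_def d_def gsq_def by (auto intro!: avg_nonneg add_nonneg_nonneg)
    have gsq: "gsq N x = (norm (gr_c N x))\<^sup>2 + a + d" by (simp add: gsq_def a_def d_def)
    have "act N (step N s x) - act N x \<le> - s * lam * avg_ip N e (gr_e N x) + lam / 2 * s\<^sup>2 * d
       + s * lam * avg_ip N y (gr_y N x) - lam / 2 * s\<^sup>2 * a
       + s * avg N (\<lambda>j. G (node N x j) \<bullet> \<omega> j) + s * eps + (s / 4 + C * K * s\<^sup>2) * gsq N x"
      unfolding a0 a1 avg_norm_sq_diff a_def d_def using Favg by (simp add: algebra_simps)
    also have "\<dots> = - s * gsq N x + lam / 2 * s\<^sup>2 * d - lam / 2 * s\<^sup>2 * a + s * eps + (s / 4 + C * K * s\<^sup>2) * gsq N x"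
    proof -
      have "s * avg N (\<lambda>j. G (node N x j) \<bullet> \<omega> j) = s * lam * avg_ip N e (gr_e N x) - s * lam * avg_ip N y (gr_y N x)
          - s * gsq N x"
      proof -
        have 1: "avg_ip N f (gr_y N x) = - lam * avg_ip N y (gr_y N x) - a"
          using GY by (simp add: a_def)
        have 2: "avg_ip N (raw N x) (gr_e N x) = lam * avg_ip N e (gr_e N x) - d"
          using GE by (simp add: d_def)
        show ?thesis
          unfolding GO gsq 1 2 by (simp add: algebra_simps)
      qed
      then show ?thesis by simp
    qed
    also have "\<dots> \<le> - s * gsq N x + lam / 2 * s\<^sup>2 * gsq N x + s * eps + (s / 4 + C * K * s\<^sup>2) * gsq N x"
    proof -
      have "lam / 2 * s\<^sup>2 * d \<le> lam / 2 * s\<^sup>2 * gsq N x" "0 \<le> lam / 2 * s\<^sup>2 * a"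
        using ad lam by (auto intro!: mult_left_mono)
      then show ?thesis by linarith
    qed
    also have "\<dots> = - (3 / 4) * s * gsq N x + s * eps + (s * (lam / 2 + C * K)) * (s * gsq N x)"
      by (simp add: algebra_simps power2_eq_square)
    also have "(s * (lam / 2 + C * K)) * (s * gsq N x) \<le> 1 / 4 * (s * gsq N x)"
    proof (rule mult_right_mono)
      have "s * (lam / 2 + C * K) \<le> s0 * (lam / 2 + C * K)"
        using s den by (intro mult_right_mono) auto
      also have "\<dots> = 1 / 4" using den by (simp add: s0_def)
      finally show "s * (lam / 2 + C * K) \<le> 1 / 4" .
    qed (use s gsq_nonneg in auto)
    finally show ?thesis by (simp add: algebra_simps)
  qed
  then show ?thesis using s0 by blast
qed

end

section \<open>Compactness of almost critical points\<close>

lemma avg_le_sqrt: "avg N f \<le> sqrt (avg N (\<lambda>j. (f j)\<^sup>2))" for f :: "nat \<Rightarrow> real"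
  using norm_avg_sq_le[of N f] by (simp add: real_le_rsqrt)

lemma sum_initial_eq_avg: "j \<le> N \<Longrightarrow> (1 / real N) *\<^sub>R (\<Sum>i<j. f i) = avg N (\<lambda>i. if i < j then f i else 0)"
  for f :: "nat \<Rightarrow> 'a::real_vector"
  unfolding avg_def by (subst sum.inter_filter[symmetric]) (auto intro!: sum.cong arg_cong[where f = "\<lambda>x. (1 / real N) *\<^sub>R x"])

lemma avg_scaleR_left: "avg N (\<lambda>j. f j *\<^sub>R c) = avg N f *\<^sub>R c"
  for c :: "'a::real_vector" by (simp add: avg_def scaleR_sum_left[symmetric])

lemma avg_single: "k < N \<Longrightarrow> avg N (\<lambda>i. if i = k then f i else 0) = (1 / real N) *\<^sub>R f k"
  for f :: "nat \<Rightarrow> 'a::real_vector" by (simp add: avg_def)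

lemma norm_sum_initial_le:
  fixes f :: "nat \<Rightarrow> 'a::real_normed_vector"
  assumes "j \<le> N"
  shows "norm ((1 / real N) *\<^sub>R (\<Sum>i<j. f i)) \<le> avg_norm N f"
proof -
  have "norm (avg N (\<lambda>i. if i < j then f i else 0)) \<le> avg N (\<lambda>i. norm (if i < j then f i else 0))"
    by (rule norm_avg_le)
  also have "\<dots> \<le> avg_norm N f" by (rule avg_mono) auto
  finally show ?thesis using assms by (simp add: sum_initial_eq_avg)
qed

definition mean_conf :: "int ^ 'n::finite \<Rightarrow> (real \<Rightarrow> 'n phase) \<Rightarrow> real ^ 'n"
  where "mean_conf v z = integral {0..1} (\<lambda>t. snd (z t) - t *\<^sub>R int_vec v)"

context discretisation
begin

definition V :: "'n phase \<Rightarrow> 'n phase"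
  where "V z = (- snd (G z), lam *\<^sub>R fst z + fst (G z))"

text \<open>The integrand \<open>p \<bullet> q' - H\<close> with q' already replaced by the velocity
  that \<open>V\<close> prescribes, so that it is a function on phase space.\<close>

definition lagr :: "'n phase \<Rightarrow> real"
  where "lagr z = fst z \<bullet> (lam *\<^sub>R fst z + fst (G z)) - lam / 2 * (norm (fst z))\<^sup>2 - F z"

definition solution :: "(real \<Rightarrow> 'n phase) \<Rightarrow> bool"
  where "solution z \<longleftrightarrow> (\<forall>t. (z has_vector_derivative V (z t)) (at t)) \<and> (\<forall>t. z (t + 1) = z t + (0, w))"

definition action :: "(real \<Rightarrow> 'n phase) \<Rightarrow> real"
  where "action z = integral {0..1} (\<lambda>t. lagr (z t))"

abbreviation "qbar \<equiv> mean_conf v"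

lemma V_cont: "continuous_on UNIV V"
  unfolding V_def by (intro continuous_intros G_cont)

lemma lagr_cont: "continuous_on UNIV lagr"
  unfolding lagr_def by (intro continuous_intros G_cont F_cont)

lemma V_per: "V (z + (0, int_vec m)) = V z"
  using G_per[of "fst z" "snd z" m] by (cases z) (simp add: V_def)

lemma lagr_per: "lagr (z + (0, int_vec m)) = lagr z"
  using G_per[of "fst z" "snd z" m] F_per[of "fst z" "snd z" m] by (cases z) (simp add: lagr_def)

text \<open>
  Where the gradient is small, the momentum is close in \<open>L\<^sup>2\<close> to \<open>smom\<close>, which varies slowly because it
  is a primitive of a bounded function. This is the source of compactness.
\<close>

definition "adj N x j = avg N (\<lambda>i. ker N i j *\<^sub>R snd (G (node N x i)))"

definition "smom N x j = (1 / lam) *\<^sub>R w - (1 / lam) *\<^sub>R avg N (raw N x) + adj N x j"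

definition "defect N x j = G (node N x j) - G (smom N x j, conf N x j)"

lemma raw_eq: "raw N x j = fst (G (node N x j)) + lam *\<^sub>R adj N x j"
  by (simp add: raw_def adj_def)

text \<open>The values of \<open>fst G\<close> at the node occur in both \<open>gr_e\<close> and
  \<open>gr_y\<close> and cancel in the difference. Thus the distance from \<open>mom\<close> to
  \<open>smom\<close> involves the gradient alone.\<close>

lemma mom_diff_smom: "lam *\<^sub>R (mom x j - smom N x j) = gr_e N x j - gr_y N x j"
  using lam by (cases x) (simp add: gr_e_def gr_y_def raw_eq smom_def algebra_simps)

lemma velocity: "w + lam *\<^sub>R snd (snd x) j = lam *\<^sub>R smom N x j + fst (G (node N x j)) + gr_e N x j"
  using lam by (cases x) (simp add: gr_e_def raw_eq smom_def algebra_simps)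

lemma conf_diff:
  assumes "j \<le> N" "N > 0"
  shows "conf N x j - conf N x 0 = (1 / real N) *\<^sub>R (\<Sum>i<j. w + lam *\<^sub>R snd (snd x) i)"
proof -
  obtain c y e where x: "x = (c, y, e)" by (cases x) auto
  have 1: "wavg N j e - wavg N 0 e = avg N (\<lambda>i. if i < j then e i else 0)"
    unfolding avg_diff[symmetric] by (intro avg_cong) (simp add: ker_def algebra_simps)
  have *: "wavg N j e = wavg N 0 e + (1 / real N) *\<^sub>R (\<Sum>i<j. e i)"
    unfolding sum_initial_eq_avg[OF assms(1)] 1[symmetric] by simp
  show ?thesis
    by (simp add: x * sum.distrib scaleR_add_right scaleR_sum_right[symmetric] sum_constant_scaleR mult.commute del: sum_constant)
qed

lemma conf_end:
  assumes "N > 0" "avg N (snd (snd x)) = 0"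
  shows "conf N x N - conf N x 0 = w"
proof -
  have "conf N x N - conf N x 0 = avg N (\<lambda>i. w + lam *\<^sub>R snd (snd x) i)"
    using conf_diff[OF order_refl assms(1)] by (simp add: avg_def)
  then show ?thesis using assms by (simp add: avg_add avg_scaleR avg_const)
qed

text \<open>The transposed kernel sums over indices above j, while an Euler scheme for the momentum
  sums \<open>- snd G\<close> over those below. The two differ by the diagonal terms i = 0 and i =
  j, of size B/N each, and by a multiple of the mean, which is \<open>- gr_c\<close>. For j = N the
  second diagonal term is absent.\<close>

lemma smom_diff:
  assumes "j \<le> N" "N > 0"
  shows "norm (smom N x j - smom N x 0 + (1 / real N) *\<^sub>R (\<Sum>i<j. snd (G (node N x i)))) \<le> 2 * B / real N + norm (gr_c N x)"
proof -
  define b where "b i = snd (G (node N x i))" for i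
  have bB: "norm (b i) \<le> B" for i by (simp add: b_def norm_snd_G_le)
  let ?r = "avg N (\<lambda>i. if i = 0 then b i else 0) - avg N (\<lambda>i. if i = j then b i else 0) + (real j / real N) *\<^sub>R avg N b"
  have "smom N x j - smom N x 0 = avg N (\<lambda>i. ker N i j *\<^sub>R b i) - avg N (\<lambda>i. ker N i 0 *\<^sub>R b i)"
    by (simp add: smom_def adj_def b_def)
  also have "\<dots> = avg N (\<lambda>i. (if i = 0 then b i else 0) - (if i = j then b i else 0) + (real j / real N) *\<^sub>R b i
      - (if i < j then b i else 0))"
    unfolding avg_diff[symmetric]
    by (intro avg_cong) (auto simp: ker_def algebra_simps diff_divide_distrib add_divide_distrib)
  also have "\<dots> = ?r - (1 / real N) *\<^sub>R (\<Sum>i<j. b i)"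
    by (simp only: avg_diff avg_add avg_scaleR sum_initial_eq_avg[OF assms(1)])
  finally have "smom N x j - smom N x 0 + (1 / real N) *\<^sub>R (\<Sum>i<j. b i) = ?r" by simp
  moreover have "norm ?r \<le> (B / real N + B / real N) + norm (gr_c N x)"
  proof (intro order_trans[OF norm_triangle_ineq] add_mono order_trans[OF norm_triangle_ineq4])
    show "norm (avg N (\<lambda>i. if i = 0 then b i else 0)) \<le> B / real N"
      using bB[of 0] assms by (simp add: avg_single divide_right_mono)
    show "norm (avg N (\<lambda>i. if i = j then b i else 0)) \<le> B / real N"
    proof (cases "j < N")
      case True
      then show ?thesis
        using bB[of j] unfolding avg_single[OF True] by (simp add: divide_right_mono)
    next
      case False
      then have eq: "avg N (\<lambda>i. if i = j then b i else 0) = avg N (\<lambda>i. 0)"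
        by (intro avg_cong) auto
      show ?thesis
        unfolding eq using B_pos by (simp add: avg_def)
    qed
    have nb: "norm (avg N b) = norm (gr_c N x)"
      unfolding gr_c_def b_def[abs_def] by simp
    show "norm ((real j / real N) *\<^sub>R avg N b) \<le> norm (gr_c N x)"
      unfolding norm_scaleR nb by (rule mult_left_le_one_le) (use assms in auto)
  qed
  ultimately show ?thesis by (simp add: b_def)
qed

text \<open>The three summands of \<open>smom\<close> estimated separately; no smallness of the
  gradient is required.\<close>

definition "mom_bound = (norm w + (B + lam * B)) / lam + B"

lemma mom_bound_nonneg: "mom_bound \<ge> 0"
  using lam B_pos by (simp add: mom_bound_def)

lemma norm_adj_le:
  assumes "j \<le> N" "N > 0"
  shows "norm (adj N x j) \<le> B"
  unfolding adj_def
proof (rule norm_avg_le_const)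
  fix i assume "i < N"
  then have "\<bar>ker N i j\<bar> * norm (snd (G (node N x i))) \<le> 1 * B"
    using assms by (intro mult_mono abs_ker_le norm_snd_G_le) auto
  then show "norm (ker N i j *\<^sub>R snd (G (node N x i))) \<le> B" by simp
qed (use B_pos in simp)

lemma norm_avg_raw_le: "norm (avg N (raw N x)) \<le> B + lam * B"
proof (rule norm_avg_le_const)
  fix j assume "j < N"
  then have "lam * norm (adj N x j) \<le> lam * B" using norm_adj_le lam by simp
  then show "norm (raw N x j) \<le> B + lam * B"
    unfolding raw_eq using lam
    by (intro order_trans[OF norm_triangle_ineq] add_mono norm_fst_G_le) simp
qed (use B_pos lam in simp)

lemma norm_smom_le:
  assumes "j \<le> N" "N > 0"
  shows "norm (smom N x j) \<le> mom_bound"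
proof -
  have "norm (smom N x j) \<le> norm ((1 / lam) *\<^sub>R w) + norm ((1 / lam) *\<^sub>R avg N (raw N x)) + norm (adj N x j)"
    unfolding smom_def by (meson add_mono norm_triangle_ineq norm_triangle_ineq4 order_refl order_trans)
  also have "\<dots> \<le> norm w / lam + (B + lam * B) / lam + B"
    using lam norm_adj_le[OF assms] norm_avg_raw_le[of N x]
    by (intro add_mono) (auto simp: divide_right_mono)
  finally show ?thesis by (simp add: mom_bound_def add_divide_distrib)
qed

lemma grad_parts_sq_le:
  shows "avg_sq N (gr_y N x) \<le> gsq N x" "avg_sq N (gr_e N x) \<le> gsq N x"
    "(norm (gr_c N x))\<^sup>2 \<le> gsq N x"
  using avg_nonneg[of N "\<lambda>j. (norm (gr_y N x j))\<^sup>2"] avg_nonneg[of N "\<lambda>j. (norm (gr_e N x j))\<^sup>2"]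
  by (auto simp: gsq_def)

lemma avg_norm_gr_e: "avg_norm N (gr_e N x) \<le> sqrt (gsq N x)"
  using avg_le_sqrt[of N "\<lambda>j. norm (gr_e N x j)"] real_sqrt_le_mono[OF grad_parts_sq_le(2)[of N x]] by linarith

lemma norm_gr_c_le: "norm (gr_c N x) \<le> sqrt (gsq N x)"
  using grad_parts_sq_le(3)[of N x] by (rule real_le_rsqrt)

lemma avg_mom_defect_sq: "avg N (\<lambda>j. (norm (mom x j - smom N x j))\<^sup>2) \<le> 4 / lam\<^sup>2 * gsq N x"
proof -
  have "(norm (mom x j - smom N x j))\<^sup>2 \<le> 2 / lam\<^sup>2 * (norm (gr_y N x j))\<^sup>2 + 2 / lam\<^sup>2 * (norm (gr_e N x j))\<^sup>2" for j
  proof -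
    have "lam\<^sup>2 * (norm (mom x j - smom N x j))\<^sup>2 = (norm (gr_e N x j - gr_y N x j))\<^sup>2"
      unfolding mom_diff_smom[symmetric] by (simp add: power_mult_distrib)
    also have "\<dots> \<le> 2 * (norm (gr_y N x j))\<^sup>2 + 2 * (norm (gr_e N x j))\<^sup>2"
      using norm_add_sq_le[of "gr_e N x j" "- gr_y N x j"] by simp
    finally show ?thesis using lam by (simp add: field_simps)
  qed
  then have "avg N (\<lambda>j. (norm (mom x j - smom N x j))\<^sup>2)
      \<le> avg N (\<lambda>j. 2 / lam\<^sup>2 * (norm (gr_y N x j))\<^sup>2 + 2 / lam\<^sup>2 * (norm (gr_e N x j))\<^sup>2)"
    by (intro avg_mono)
  also have "\<dots> = 2 / lam\<^sup>2 * avg_sq N (gr_y N x) + 2 / lam\<^sup>2 * avg_sq N (gr_e N x)"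
    by (simp only: avg_add avg_mult)
  also have "\<dots> \<le> 2 / lam\<^sup>2 * gsq N x + 2 / lam\<^sup>2 * gsq N x"
    by (intro add_mono mult_left_mono grad_parts_sq_le) auto
  finally show ?thesis by simp
qed

text \<open>\<open>G_modulus_sq\<close> averaged over the grid. The summand \<open>e\<close> is due
  to \<open>G\<close> being merely continuous and is removed only in the limit of vanishing
  gradients.\<close>

lemma avg_defect_le:
  assumes "e > 0"
  shows "\<exists>C\<ge>0. \<forall>N x. avg_norm N (defect N x) \<le> e + C * gsq N x"
proof -
  obtain C where C: "C \<ge> 0" "\<And>z z'. norm (G z - G z') \<le> e + C * (norm (z - z'))\<^sup>2"
    using G_modulus_sq[OF assms] by auto
  have "avg_norm N (defect N x) \<le> e + C * (4 / lam\<^sup>2) * gsq N x" for N x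
  proof (cases "N = 0")
    case True
    then show ?thesis using assms C(1) gsq_nonneg[of N x] by (simp add: avg_def)
  next
    case False
    have "avg_norm N (defect N x) \<le> avg N (\<lambda>j. e + C * (norm (mom x j - smom N x j))\<^sup>2)"
    proof (rule avg_mono)
      fix j
      have "norm (node N x j - (smom N x j, conf N x j)) = norm (mom x j - smom N x j)"
        by (simp add: node_def norm_Pair)
      then show "norm (defect N x j) \<le> e + C * (norm (mom x j - smom N x j))\<^sup>2"
        using C(2)[of "node N x j" "(smom N x j, conf N x j)"] by (simp add: defect_def)
    qed
    also have "\<dots> = e + C * avg N (\<lambda>j. (norm (mom x j - smom N x j))\<^sup>2)"
      using False by (simp add: avg_add avg_mult avg_const)
    also have "\<dots> \<le> e + C * (4 / lam\<^sup>2 * gsq N x)"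
      using C(1) avg_mom_defect_sq by (intro add_left_mono mult_left_mono) auto
    finally show ?thesis by (simp add: mult.assoc)
  qed
  then show ?thesis using C(1) by (intro exI[of _ "C * (4 / lam\<^sup>2)"]) auto
qed

lemma avg_defect_tendsto:
  assumes "(\<lambda>k. gsq (N k) (x k)) \<longlonglongrightarrow> 0"
  shows "(\<lambda>k. avg_norm (N k) (defect (N k) (x k))) \<longlonglongrightarrow> 0"
proof (rule tendstoI)
  fix e :: real assume e: "e > 0"
  obtain C where C: "C \<ge> 0" "\<And>N x. avg_norm N (defect N x) \<le> e / 2 + C * gsq N x"
    using avg_defect_le[of "e / 2"] e by auto
  have "(\<lambda>k. e / 2 + C * gsq (N k) (x k)) \<longlonglongrightarrow> e / 2 + C * 0"
    by (intro tendsto_intros assms)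
  then have "\<forall>\<^sub>F k in sequentially. e / 2 + C * gsq (N k) (x k) < e"
    by (rule order_tendstoD) (use e in simp)
  then show "\<forall>\<^sub>F k in sequentially. dist (avg_norm (N k) (defect (N k) (x k))) 0 < e"
  proof eventually_elim
    case (elim k)
    have "0 \<le> avg_norm (N k) (defect (N k) (x k))" by (rule avg_nonneg) simp
    then show ?case using elim C(2)[of "N k" "x k"] by simp
  qed
qed

lemma avg_conf:
  assumes "N > 0"
  shows "avg N (\<lambda>j. conf N x j - (real j / real N) *\<^sub>R w) = fst x"
proof -
  obtain c y e where x: "x = (c, y, e)" by (cases x) auto
  have "avg N (\<lambda>j. wavg N j e) = avg N (\<lambda>i. avg N (\<lambda>j. ker N j i) *\<^sub>R e i)"
    by (subst avg_swap) (simp only: avg_scaleR_left)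
  also have "\<dots> = avg N (\<lambda>i. 0)" by (intro avg_cong) (simp add: avg_ker)
  finally have "avg N (\<lambda>j. wavg N j e) = 0" by (simp add: avg_def)
  then show ?thesis using assms by (simp add: x avg_add avg_scaleR avg_const)
qed

lemma norm_conf_le:
  assumes "j \<le> N" "N > 0" "gsq N x \<le> 1"
  shows "norm (conf N x j - fst x) \<le> norm w + (1 + lam * mom_bound + B + norm w)"
proof -
  obtain c y e where x: "x = (c, y, e)" by (cases x) auto
  have k: "\<bar>ker N j i\<bar> \<le> 1" if "i < N" for i
    by (rule abs_ker_le) (use that assms in auto)
  have "norm (lam *\<^sub>R wavg N j e) = norm (avg N (\<lambda>i. ker N j i *\<^sub>R (lam *\<^sub>R e i)))"
    by (simp add: avg_scaleR[symmetric] mult.commute)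
  also have "\<dots> \<le> avg N (\<lambda>i. norm (ker N j i *\<^sub>R (lam *\<^sub>R e i)))"
    by (rule norm_avg_le)
  also have "\<dots> \<le> avg N (\<lambda>i. norm (gr_e N x i) + (lam * mom_bound + B + norm w))"
  proof (rule avg_mono)
    fix i assume i: "i < N"
    have "lam *\<^sub>R e i = gr_e N x i + lam *\<^sub>R smom N x i + fst (G (node N x i)) - w"
      using velocity[of x i N] by (simp add: x algebra_simps)
    also have "norm \<dots> \<le> norm (gr_e N x i) + norm (lam *\<^sub>R smom N x i) + norm (fst (G (node N x i))) + norm w"
      by (meson add_mono norm_triangle_ineq norm_triangle_ineq4 order_refl order_trans)
    also have "\<dots> \<le> norm (gr_e N x i) + lam * mom_bound + B + norm w"
      using norm_smom_le[of i N x] i lam norm_fst_G_le[of "node N x i"] by (intro add_mono) auto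
    finally have "norm (lam *\<^sub>R e i) \<le> norm (gr_e N x i) + (lam * mom_bound + B + norm w)"
      by simp
    moreover have "\<bar>ker N j i\<bar> * norm (lam *\<^sub>R e i) \<le> 1 * norm (lam *\<^sub>R e i)"
      by (intro mult_right_mono k i) auto
    ultimately show "norm (ker N j i *\<^sub>R (lam *\<^sub>R e i)) \<le> norm (gr_e N x i) + (lam * mom_bound + B + norm w)"
      unfolding norm_scaleR[of "ker N j i"] by linarith
  qed
  also have "\<dots> = avg_norm N (gr_e N x) + (lam * mom_bound + B + norm w)"
    using assms by (simp add: avg_add avg_const)
  also have "avg_norm N (gr_e N x) \<le> 1"
    using order_trans[OF avg_norm_gr_e real_sqrt_le_mono[OF assms(3)]] by simp
  finally have "norm (lam *\<^sub>R wavg N j e) \<le> 1 + (lam * mom_bound + B + norm w)" by simp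
  moreover have "norm ((real j / real N) *\<^sub>R w) \<le> norm w"
    unfolding norm_scaleR by (rule mult_left_le_one_le) (use assms in auto)
  moreover have "conf N x j - fst x = (real j / real N) *\<^sub>R w + lam *\<^sub>R wavg N j e"
    by (simp add: x)
  ultimately show ?thesis
    using norm_triangle_ineq[of "(real j / real N) *\<^sub>R w" "lam *\<^sub>R wavg N j e"] by simp
qed

text \<open>The momentum part is \<open>smom_diff\<close>, the position part sums the identity
  \<open>velocity\<close>. In both, evaluating \<open>G\<close> at \<open>(smom, conf)\<close>
  instead of at the node costs the average of \<open>defect\<close>.\<close>

lemma euler_residual:
  fixes x :: "'n state"
  assumes "j \<le> N" "N > 0"
  defines "Z \<equiv> \<lambda>i. (smom N x i, conf N x i)"
  shows "norm (Z j - Z 0 - (1 / real N) *\<^sub>R (\<Sum>i<j. V (Z i)))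
     \<le> 2 * B / real N + 2 * sqrt (gsq N x) + 2 * avg_norm N (defect N x)"
proof -
  let ?r = "Z j - Z 0 - (1 / real N) *\<^sub>R (\<Sum>i<j. V (Z i))"
  have "fst ?r = (smom N x j - smom N x 0 + (1 / real N) *\<^sub>R (\<Sum>i<j. snd (G (node N x i))))
      - (1 / real N) *\<^sub>R (\<Sum>i<j. snd (defect N x i))"
    by (simp add: fst_sum Z_def V_def defect_def sum_subtractf sum_negf scaleR_diff_right)
  also have "norm \<dots> \<le> (2 * B / real N + norm (gr_c N x)) + avg N (\<lambda>i. norm (snd (defect N x i)))"
    by (intro order_trans[OF norm_triangle_ineq4] add_mono smom_diff norm_sum_initial_le assms)
  also have "\<dots> \<le> (2 * B / real N + sqrt (gsq N x)) + avg_norm N (defect N x)"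
    by (intro add_mono norm_gr_c_le order_refl avg_mono norm_snd_le')
  finally have 1: "norm (fst ?r) \<le> (2 * B / real N + sqrt (gsq N x)) + avg_norm N (defect N x)" .
  have "snd ?r = (conf N x j - conf N x 0) - (1 / real N) *\<^sub>R (\<Sum>i<j. lam *\<^sub>R smom N x i + fst (G (smom N x i, conf N x i)))"
    by (simp add: snd_sum Z_def V_def)
  also have "\<dots> = (1 / real N) *\<^sub>R (\<Sum>i<j. gr_e N x i + fst (defect N x i))"
    unfolding conf_diff[OF assms(1,2)] velocity[of x _ N] defect_def scaleR_diff_right[symmetric] sum_subtractf[symmetric]
    by (simp add: algebra_simps)
  also have "norm \<dots> \<le> avg N (\<lambda>i. norm (gr_e N x i + fst (defect N x i)))"
    by (intro norm_sum_initial_le assms)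
  also have "\<dots> \<le> avg N (\<lambda>i. norm (gr_e N x i) + norm (defect N x i))"
    by (intro avg_mono order_trans[OF norm_triangle_ineq] add_mono order_refl norm_fst_le')
  also have "\<dots> \<le> sqrt (gsq N x) + avg_norm N (defect N x)"
    unfolding avg_add by (intro add_mono avg_norm_gr_e order_refl)
  finally have 2: "norm (snd ?r) \<le> sqrt (gsq N x) + avg_norm N (defect N x)" .
  have "norm ?r \<le> norm (fst ?r) + norm (snd ?r)"
    using norm_Pair_le[of "fst ?r" "snd ?r"] unfolding prod.collapse .
  with 1 2 show ?thesis by linarith
qed

text \<open>Undoes the completion of the square and recovers the discrete
  \<open>p \<bullet> q' - H\<close>. The cross term with \<open>w\<close> disappears because
  \<open>e\<close> has mean 0.\<close>

lemma act_eq_avg: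
  assumes "N > 0" "avg N (snd (snd x)) = 0"
  shows "act N x = avg N (\<lambda>j. mom x j \<bullet> (w + lam *\<^sub>R snd (snd x) j) - lam / 2 * (norm (mom x j))\<^sup>2 - F (node N x j))"
proof -
  obtain c y e where x: "x = (c, y, e)" by (cases x) auto
  have "mom x j \<bullet> (w + lam *\<^sub>R e j) - lam / 2 * (norm (mom x j))\<^sup>2 - F (node N x j)
     = lam / 2 * (norm (e j))\<^sup>2 + (norm w)\<^sup>2 / (2 * lam) + w \<bullet> e j - lam / 2 * (norm (y j))\<^sup>2 - F (node N x j)" for j
    using lam unfolding power2_norm_eq_inner
    by (simp add: x inner_add_left inner_add_right inner_commute field_simps)
  then have "avg N (\<lambda>j. mom x j \<bullet> (w + lam *\<^sub>R e j) - lam / 2 * (norm (mom x j))\<^sup>2 - F (node N x j))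
     = lam / 2 * avg_sq N e + (norm w)\<^sup>2 / (2 * lam) + w \<bullet> avg N e
       - lam / 2 * avg_sq N y - avg N (\<lambda>j. F (node N x j))"
    using assms(1) by (simp only: avg_add avg_diff avg_mult avg_inner_right avg_const)
  then show ?thesis using assms(2) by (simp add: x)
qed

definition "act_const = mom_bound + (lam * mom_bound + B) + 1 + lam * mom_bound + lam + B"

definition "act_err N x = act_const * (sqrt (gsq N x) + avg_norm N (defect N x) + 2 / lam * sqrt (gsq N x)
         + 2 * gsq N x + 4 * B * avg_norm N (defect N x) + 4 / lam\<^sup>2 * gsq N x)"

text \<open>Momentum and velocity are split into the values belonging to an exact solution at
  \<open>(smom, conf)\<close> and deviations \<eta> and \<zeta>. The integrand changes by terms
  linear and quadratic in these, all controlled in the mean by \<open>gsq\<close> and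
  \<open>defect\<close>.\<close>

lemma act_lagr:
  assumes N: "N > 0" and e0: "avg N (snd (snd x)) = 0"
  shows "\<bar>act N x - avg N (\<lambda>j. lagr (smom N x j, conf N x j))\<bar> \<le> act_err N x"
proof -
  define \<eta> where "\<eta> j = mom x j - smom N x j" for j
  define \<zeta> where "\<zeta> j = gr_e N x j + fst (defect N x j)" for j
  define X where "X j = lam *\<^sub>R smom N x j + fst (G (smom N x j, conf N x j))" for j
  have act_const: "act_const \<ge> 0" "mom_bound \<le> act_const" "lam * mom_bound + B + lam * mom_bound + B \<le> act_const" "lam / 2 + 1 \<le> act_const"
    using mom_bound_nonneg lam B_pos by (auto simp: act_const_def)
  have pw: "\<bar>mom x j \<bullet> (w + lam *\<^sub>R snd (snd x) j) - lam / 2 * (norm (mom x j))\<^sup>2 - F (node N x j) - lagr (smom N x j, conf N x j)\<bar>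
     \<le> act_const * (norm (\<zeta> j) + norm (\<eta> j) + (norm (\<zeta> j))\<^sup>2 + (norm (\<eta> j))\<^sup>2)" if j: "j < N" for j
  proof -
    have m: "mom x j = smom N x j + \<eta> j" by (simp add: \<eta>_def)
    have vel: "w + lam *\<^sub>R snd (snd x) j = X j + \<zeta> j"
      by (simp add: X_def \<zeta>_def defect_def velocity[of x j N])
    have P: "norm (smom N x j) \<le> mom_bound" using norm_smom_le[of j N x] j by simp
    have X: "norm (X j) \<le> lam * mom_bound + B"
      unfolding X_def using P lam norm_fst_G_le
      by (intro order_trans[OF norm_triangle_ineq] add_mono) auto
    have ptj: "node N x j = (smom N x j, conf N x j) + (\<eta> j, 0)" by (simp add: node_def m)
    have Fj: "\<bar>F (node N x j) - F (smom N x j, conf N x j)\<bar> \<le> B * norm (\<eta> j)"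
      using F_lipschitz[of "(smom N x j, conf N x j)" "(\<eta> j, 0)"] unfolding ptj by (simp add: norm_Pair)
    have eq: "mom x j \<bullet> (w + lam *\<^sub>R snd (snd x) j) - lam / 2 * (norm (mom x j))\<^sup>2 - F (node N x j) - lagr (smom N x j, conf N x j)
      = smom N x j \<bullet> \<zeta> j + \<eta> j \<bullet> X j + \<eta> j \<bullet> \<zeta> j - lam * (smom N x j \<bullet> \<eta> j) - lam / 2 * (norm (\<eta> j))\<^sup>2
        - (F (node N x j) - F (smom N x j, conf N x j))"
      unfolding vel m lagr_def X_def power2_norm_eq_inner
      by (simp add: inner_add_left inner_add_right inner_commute algebra_simps)
    have c1: "\<bar>smom N x j \<bullet> \<zeta> j\<bar> \<le> mom_bound * norm (\<zeta> j)"
      by (rule order_trans[OF Cauchy_Schwarz_ineq2 mult_right_mono[OF P]]) simp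
    have c2: "\<bar>\<eta> j \<bullet> X j\<bar> \<le> (lam * mom_bound + B) * norm (\<eta> j)"
      using order_trans[OF Cauchy_Schwarz_ineq2 mult_left_mono[OF X]] by (simp add: mult.commute)
    have c3: "\<bar>\<eta> j \<bullet> \<zeta> j\<bar> \<le> (norm (\<eta> j))\<^sup>2 + (norm (\<zeta> j))\<^sup>2"
    proof -
      have "2 * (norm (\<eta> j) * norm (\<zeta> j)) \<le> (norm (\<eta> j))\<^sup>2 + (norm (\<zeta> j))\<^sup>2"
        using sum_squares_bound[of "norm (\<eta> j)" "norm (\<zeta> j)"] by (simp add: mult.assoc)
      moreover have "0 \<le> norm (\<eta> j) * norm (\<zeta> j)" by simp
      ultimately show ?thesis using Cauchy_Schwarz_ineq2[of "\<eta> j" "\<zeta> j"] by linarith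
    qed
    have c4: "\<bar>lam * (smom N x j \<bullet> \<eta> j)\<bar> \<le> lam * mom_bound * norm (\<eta> j)"
    proof -
      have "\<bar>smom N x j \<bullet> \<eta> j\<bar> \<le> mom_bound * norm (\<eta> j)"
        by (rule order_trans[OF Cauchy_Schwarz_ineq2 mult_right_mono[OF P]]) simp
      then show ?thesis using lam by (simp add: abs_mult mult.assoc)
    qed
    have "\<bar>mom x j \<bullet> (w + lam *\<^sub>R snd (snd x) j) - lam / 2 * (norm (mom x j))\<^sup>2 - F (node N x j) - lagr (smom N x j, conf N x j)\<bar>
      \<le> mom_bound * norm (\<zeta> j) + (lam * mom_bound + B + lam * mom_bound + B) * norm (\<eta> j) + (norm (\<zeta> j))\<^sup>2 + (lam / 2 + 1) * (norm (\<eta> j))\<^sup>2"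
    proof -
      have "0 \<le> lam / 2 * (norm (\<eta> j))\<^sup>2" using lam by simp
      then show ?thesis
        unfolding eq abs_le_iff using c1 c2 c3 c4 Fj
        by (simp only: abs_le_iff ring_distribs) linarith
    qed
    also have "\<dots> \<le> act_const * norm (\<zeta> j) + act_const * norm (\<eta> j) + act_const * (norm (\<zeta> j))\<^sup>2 + act_const * (norm (\<eta> j))\<^sup>2"
    proof -
      have "1 * (norm (\<zeta> j))\<^sup>2 \<le> act_const * (norm (\<zeta> j))\<^sup>2"
        using act_const(4) lam by (intro mult_right_mono) auto
      then show ?thesis using act_const by (intro add_mono mult_right_mono) auto
    qed
    finally show ?thesis by (simp add: algebra_simps)
  qed
  define Y where "Y j = mom x j \<bullet> (w + lam *\<^sub>R snd (snd x) j) - lam / 2 * (norm (mom x j))\<^sup>2 - F (node N x j)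
      - lagr (smom N x j, conf N x j)" for j
  have "act N x - avg N (\<lambda>j. lagr (smom N x j, conf N x j)) = avg N Y"
    unfolding act_eq_avg[OF assms] Y_def[abs_def] by (simp only: avg_diff)
  moreover have "norm (avg N Y) \<le> avg_norm N Y" by (rule norm_avg_le)
  moreover have "avg_norm N Y \<le> avg N (\<lambda>j. act_const * (norm (\<zeta> j) + norm (\<eta> j) + (norm (\<zeta> j))\<^sup>2 + (norm (\<eta> j))\<^sup>2))"
    by (rule avg_mono) (use pw in \<open>simp add: Y_def\<close>)
  ultimately have 1: "\<bar>act N x - avg N (\<lambda>j. lagr (smom N x j, conf N x j))\<bar>
      \<le> avg N (\<lambda>j. act_const * (norm (\<zeta> j) + norm (\<eta> j) + (norm (\<zeta> j))\<^sup>2 + (norm (\<eta> j))\<^sup>2))"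
    by (simp only: real_norm_def)
  have 2: "avg N (\<lambda>j. act_const * (norm (\<zeta> j) + norm (\<eta> j) + (norm (\<zeta> j))\<^sup>2 + (norm (\<eta> j))\<^sup>2))
      = act_const * (avg N (\<lambda>j. norm (\<zeta> j)) + avg N (\<lambda>j. norm (\<eta> j)) + avg N (\<lambda>j. (norm (\<zeta> j))\<^sup>2) + avg N (\<lambda>j. (norm (\<eta> j))\<^sup>2))"
    by (simp only: avg_mult avg_add)
  have 3: "act_const * (avg N (\<lambda>j. norm (\<zeta> j)) + avg N (\<lambda>j. norm (\<eta> j)) + avg N (\<lambda>j. (norm (\<zeta> j))\<^sup>2) + avg N (\<lambda>j. (norm (\<eta> j))\<^sup>2))
      \<le> act_const * ((sqrt (gsq N x) + avg_norm N (defect N x)) + 2 / lam * sqrt (gsq N x)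
         + (2 * gsq N x + 4 * B * avg_norm N (defect N x)) + 4 / lam\<^sup>2 * gsq N x)"
  proof (intro mult_left_mono add_mono act_const(1))
    have "avg N (\<lambda>j. norm (\<zeta> j)) \<le> avg N (\<lambda>j. norm (gr_e N x j) + norm (defect N x j))"
      unfolding \<zeta>_def by (intro avg_mono order_trans[OF norm_triangle_ineq] add_mono order_refl norm_fst_le')
    then show "avg N (\<lambda>j. norm (\<zeta> j)) \<le> sqrt (gsq N x) + avg_norm N (defect N x)"
      using avg_norm_gr_e[of N x] by (simp add: avg_add)
    show eta2: "avg N (\<lambda>j. (norm (\<eta> j))\<^sup>2) \<le> 4 / lam\<^sup>2 * gsq N x"
      unfolding \<eta>_def by (rule avg_mom_defect_sq)
    have "avg N (\<lambda>j. norm (\<eta> j)) \<le> sqrt (4 / lam\<^sup>2 * gsq N x)"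
      using avg_le_sqrt[of N "\<lambda>j. norm (\<eta> j)"] real_sqrt_le_mono[OF eta2] by linarith
    also have "\<dots> = 2 / lam * sqrt (gsq N x)"
      using lam by (simp add: real_sqrt_mult real_sqrt_divide)
    finally show "avg N (\<lambda>j. norm (\<eta> j)) \<le> 2 / lam * sqrt (gsq N x)" .
    have "avg N (\<lambda>j. (norm (\<zeta> j))\<^sup>2) \<le> avg N (\<lambda>j. 2 * (norm (gr_e N x j))\<^sup>2 + 4 * B * norm (defect N x j))"
    proof (rule avg_mono)
      fix j
      have "(norm (\<zeta> j))\<^sup>2 \<le> 2 * (norm (gr_e N x j))\<^sup>2 + 2 * (norm (fst (defect N x j)))\<^sup>2"
        unfolding \<zeta>_def by (rule norm_add_sq_le)
      \<comment> \<open>One factor is bounded by 2B, so smallness of \<open>defect\<close> in the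
        mean suffices also for the quadratic term.\<close>
      also have "(norm (fst (defect N x j)))\<^sup>2 \<le> (2 * B) * norm (defect N x j)"
      proof -
        have "norm (defect N x j) \<le> 2 * B"
          unfolding defect_def using norm_triangle_ineq4 norm_G_le by (smt (verit))
        then have "norm (fst (defect N x j)) * norm (fst (defect N x j)) \<le> (2 * B) * norm (defect N x j)"
          using norm_fst_le'[of "defect N x j"] B_pos by (intro mult_mono) auto
        then show ?thesis by (simp add: power2_eq_square)
      qed
      finally show "(norm (\<zeta> j))\<^sup>2 \<le> 2 * (norm (gr_e N x j))\<^sup>2 + 4 * B * norm (defect N x j)"
        by simp
    qed
    then show "avg N (\<lambda>j. (norm (\<zeta> j))\<^sup>2) \<le> 2 * gsq N x + 4 * B * avg_norm N (defect N x)"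
      using grad_parts_sq_le(2)[of N x] by (simp add: avg_add avg_mult)
  qed
  show ?thesis using order_trans[OF 1[unfolded 2] 3] by (simp only: act_err_def add.assoc)
qed

text \<open>After integer translations the points \<open>(smom, conf)\<close> stay bounded and form
  Euler schemes with residual tending to 0, so a subsequence converges uniformly to a solution. The
  translations \<open>m\<close> remain visible in the conclusion because the mean, unlike the
  action, is not invariant under them.\<close>

lemma palais_smale:
  assumes N: "filterlim N at_top sequentially" "\<And>k. N k > (0::nat)"
    and e0: "\<And>k. avg (N k) (snd (snd (x k))) = 0"
    and gn1: "\<And>k. gsq (N k) (x k) \<le> 1" and gn0: "(\<lambda>k. gsq (N k) (x k)) \<longlonglongrightarrow> 0"
  obtains \<phi> :: "nat \<Rightarrow> nat" and m z where "strict_mono \<phi>" "solution z"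
    "(\<lambda>k. fst (x (\<phi> k)) - int_vec (m k)) \<longlonglongrightarrow> qbar z"
    "(\<lambda>k. act (N (\<phi> k)) (x (\<phi> k))) \<longlonglongrightarrow> action z"
proof -
  have "\<forall>k. \<exists>m :: int ^ 'n. norm (fst (x k) - int_vec m) \<le> real CARD('n)"
    by (blast intro: ex_int_translate)
  then obtain \<mu> where \<mu>: "\<And>k. norm (fst (x k) - int_vec (\<mu> k)) \<le> real CARD('n)"
    by metis
  define Z where "Z k j = (smom (N k) (x k) j, conf (N k) (x k) j - int_vec (\<mu> k))" for k j
  have Zeq: "Z k j = (smom (N k) (x k) j, conf (N k) (x k) j) - (0, int_vec (\<mu> k))" for k j
    by (simp add: Z_def)
  have VZ: "V (Z k j) = V (smom (N k) (x k) j, conf (N k) (x k) j)" and LZ: "lagr (Z k j) = lagr (smom (N k) (x k) j, conf (N k) (x k) j)" for k j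
    using V_per[of "Z k j" "\<mu> k"] lagr_per[of "Z k j" "\<mu> k"] by (simp_all add: Z_def)
  define R' where "R' = mom_bound + (norm w + (1 + lam * mom_bound + B + norm w) + real CARD('n))"
  have Zbd: "norm (Z k j) \<le> R'" if "j \<le> N k" for k j
  proof -
    have "conf (N k) (x k) j - int_vec (\<mu> k) = (conf (N k) (x k) j - fst (x k)) + (fst (x k) - int_vec (\<mu> k))"
      by simp
    then have "norm (conf (N k) (x k) j - int_vec (\<mu> k)) \<le> (norm w + (1 + lam * mom_bound + B + norm w)) + real CARD('n)"
      using norm_conf_le[OF that N(2) gn1] \<mu>[of k] norm_triangle_mono by metis
    then show ?thesis
      using norm_Pair_le[of "smom (N k) (x k) j" "conf (N k) (x k) j - int_vec (\<mu> k)"] norm_smom_le[OF that N(2), of "x k"]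
      unfolding Z_def R'_def by linarith
  qed
  define \<epsilon> where "\<epsilon> k = 2 * B / real (N k) + 2 * sqrt (gsq (N k) (x k)) + 2 * avg_norm (N k) (defect (N k) (x k))" for k
  have Nreal: "filterlim (\<lambda>k. real (N k)) at_top sequentially"
    by (rule filterlim_compose[OF filterlim_real_sequentially N(1)])
  have sq0: "(\<lambda>k. sqrt (gsq (N k) (x k))) \<longlonglongrightarrow> 0"
    using tendsto_real_sqrt[OF gn0] by simp
  have BN: "(\<lambda>k. 2 * B / real (N k)) \<longlonglongrightarrow> 0"
    by (rule tendsto_divide_0[OF tendsto_const]) (rule filterlim_at_top_imp_at_infinity[OF Nreal])
  have "\<epsilon> \<longlonglongrightarrow> 0 + 2 * 0 + 2 * 0"
    unfolding \<epsilon>_def by (intro tendsto_intros BN sq0 avg_defect_tendsto gn0)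
  then have \<epsilon>0: "\<epsilon> \<longlonglongrightarrow> 0" by simp
  have res: "norm (Z k j - Z k 0 - (1 / real (N k)) *\<^sub>R (\<Sum>i<j. V (Z k i))) \<le> \<epsilon> k" if "j \<le> N k" for k j
    using euler_residual[OF that N(2), of "x k"] unfolding \<epsilon>_def VZ by (simp add: Zeq)
  obtain z \<phi> where \<phi>: "strict_mono (\<phi> :: nat \<Rightarrow> nat)"
    and dz: "\<And>t. t \<in> {0..1} \<Longrightarrow> (z has_vector_derivative V (z t)) (at t within {0..1})"
    and unif: "\<And>e. e > 0 \<Longrightarrow> \<forall>\<^sub>F k in sequentially. \<forall>j\<le>N (\<phi> k). norm (Z (\<phi> k) j - z (real j / real (N (\<phi> k)))) < e"
    by (rule euler_limit[OF V_cont N Zbd \<epsilon>0 res]) (assumption | rule that | assumption)+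
  let ?M = "\<lambda>k. N (\<phi> k)" and ?t = "\<lambda>k j. real j / real (N (\<phi> k))"
  have sub: "(\<lambda>k. f (\<phi> k)) \<longlonglongrightarrow> l" if "f \<longlonglongrightarrow> l" for f :: "nat \<Rightarrow> real" and l
    using LIMSEQ_subseq_LIMSEQ[OF that \<phi>] by (simp add: o_def)
  have Z0: "(\<lambda>k. Z (\<phi> k) 0) \<longlonglongrightarrow> z 0"
    by (rule tendstoI) (use unif in \<open>force elim: eventually_mono simp: dist_norm\<close>)
  have Z1: "(\<lambda>k. Z (\<phi> k) (?M k)) \<longlonglongrightarrow> z 1"
  proof (rule tendstoI)
    fix e :: real assume "e > 0"
    from unif[OF this] show "\<forall>\<^sub>F k in sequentially. dist (Z (\<phi> k) (?M k)) (z 1) < e"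
    proof eventually_elim
      case (elim k)
      then show ?case
        using elim[rule_format, of "?M k"] N(2)[of "\<phi> k"] by (simp add: dist_norm)
    qed
  qed
  \<comment> \<open>The positions close up exactly since \<open>e\<close> has mean 0; the momenta
    close up to 2B/N and twice the norm of \<open>gr_c\<close>.\<close>
  have "(\<lambda>k. Z (\<phi> k) (?M k) - Z (\<phi> k) 0) \<longlonglongrightarrow> (0, w)"
  proof -
    have "norm ((Z k (N k) - Z k 0) - (0, w)) \<le> 2 * B / real (N k) + 2 * sqrt (gsq (N k) (x k))" for k
    proof -
      have "(Z k (N k) - Z k 0) - (0, w) = (smom (N k) (x k) (N k) - smom (N k) (x k) 0, 0)"
        using conf_end[OF N(2) e0, of k] by (simp add: Z_def)
      moreover have "(1 / real (N k)) *\<^sub>R (\<Sum>i<N k. snd (G (node (N k) (x k) i))) = - gr_c (N k) (x k)"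
        by (simp add: gr_c_def avg_def)
      then have "norm (smom (N k) (x k) (N k) - smom (N k) (x k) 0 - gr_c (N k) (x k)) \<le> 2 * B / real (N k) + norm (gr_c (N k) (x k))"
        using smom_diff[OF order_refl N(2), of k "x k"] by simp
      then have "norm (smom (N k) (x k) (N k) - smom (N k) (x k) 0) \<le> 2 * B / real (N k) + norm (gr_c (N k) (x k)) + norm (gr_c (N k) (x k))"
        using norm_triangle_ineq[of "smom (N k) (x k) (N k) - smom (N k) (x k) 0 - gr_c (N k) (x k)" "gr_c (N k) (x k)"] by simp
      ultimately show ?thesis using norm_gr_c_le[of "N k" "x k"] by (simp add: norm_Pair)
    qed
    then have bound: "\<forall>k. norm ((Z k (N k) - Z k 0) - (0, w)) \<le> 2 * B / real (N k) + 2 * sqrt (gsq (N k) (x k))"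
      by blast
    have "(\<lambda>k. 2 * B / real (N k) + 2 * sqrt (gsq (N k) (x k))) \<longlonglongrightarrow> 0"
      using tendsto_add[OF BN tendsto_mult_left[OF sq0, of 2]] by simp
    from Lim_null_comparison[OF always_eventually[OF bound] this]
    have "(\<lambda>k. (Z k (N k) - Z k 0) - (0, w)) \<longlonglongrightarrow> 0" .
    then have "(\<lambda>k. Z k (N k) - Z k 0) \<longlonglongrightarrow> (0, w)"
      by (rule LIM_zero_cancel)
    from LIMSEQ_subseq_LIMSEQ[OF this \<phi>] show ?thesis by (simp add: o_def)
  qed
  from LIMSEQ_unique[OF this tendsto_diff[OF Z1 Z0]] have z1: "z 1 = z 0 + (0, w)"
    by (simp add: algebra_simps)
  obtain u where u: "\<And>t. t \<in> {0..1} \<Longrightarrow> u t = z t" "\<And>t. u (t + 1) = u t + (0, w)"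
    "\<And>t. (u has_vector_derivative V (u t)) (at t)"
    using quasi_periodic_extension[OF dz z1 V_per] by blast
  have sol: "solution u" using u by (simp add: solution_def)
  have zc: "continuous_on {0..1} z"
    unfolding continuous_on_eq_continuous_within using has_vector_derivative_continuous[OF dz] by blast
  have N\<phi>: "filterlim (\<lambda>k. ?M k) at_top sequentially"
    by (rule filterlim_compose[OF N(1) filterlim_subseq[OF \<phi>]])
  have grid: "real j / real (N k) \<in> {0..1}" if "j < N k" for j k using that by auto
  \<comment> \<open>By \<open>avg_conf\<close> the mean \<open>fst x\<close> is itself a grid
    average of the positions, so it can be compared with a Riemann sum of the limit.\<close>
  have c_lim: "(\<lambda>k. fst (x (\<phi> k)) - int_vec (\<mu> (\<phi> k))) \<longlonglongrightarrow> qbar u"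
  proof -
    have "qbar u = integral {0..1} (\<lambda>t. snd (z t) - t *\<^sub>R w)"
      unfolding mean_conf_def by (rule integral_cong) (use u in simp)
    moreover have "(\<lambda>k. avg (?M k) (\<lambda>j. snd (z (?t k j)) - (?t k j) *\<^sub>R w))
        \<longlonglongrightarrow> integral {0..1} (\<lambda>t. snd (z t) - t *\<^sub>R w)"
      unfolding avg_def by (rule riemann_sum_tendsto[OF _ N\<phi> N(2)]) (intro continuous_intros zc)
    moreover have "(\<lambda>k. (fst (x (\<phi> k)) - int_vec (\<mu> (\<phi> k)))
       - avg (?M k) (\<lambda>j. snd (z (?t k j)) - (?t k j) *\<^sub>R w)) \<longlonglongrightarrow> 0"
    proof (rule tendstoI)
      fix e :: real assume e: "e > 0"
      from unif[OF half_gt_zero[OF e]]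
      show "\<forall>\<^sub>F k in sequentially. dist ((fst (x (\<phi> k)) - int_vec (\<mu> (\<phi> k)))
       - avg (?M k) (\<lambda>j. snd (z (?t k j)) - (?t k j) *\<^sub>R w)) 0 < e"
      proof eventually_elim
        case (elim k)
        let ?N = "N (\<phi> k)" and ?x = "x (\<phi> k)" and ?m = "int_vec (\<mu> (\<phi> k))"
        have "fst ?x - ?m = avg ?N (\<lambda>j. (conf ?N ?x j - (real j / real ?N) *\<^sub>R w) - ?m)"
          unfolding avg_diff[of _ "\<lambda>j. conf ?N ?x j - (real j / real ?N) *\<^sub>R w"] avg_conf[OF N(2)] avg_const[OF N(2)] ..
        then have "(fst ?x - ?m) - avg ?N (\<lambda>j. snd (z (real j / real ?N)) - (real j / real ?N) *\<^sub>R w)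
           = avg ?N (\<lambda>j. ((conf ?N ?x j - (real j / real ?N) *\<^sub>R w) - ?m) - (snd (z (real j / real ?N)) - (real j / real ?N) *\<^sub>R w))"
          by (simp only: avg_diff)
        also have "norm \<dots> \<le> e / 2"
        proof (rule norm_avg_le_const)
          fix j assume j: "j < ?N"
          have eq: "((conf ?N ?x j - (real j / real ?N) *\<^sub>R w) - ?m) - (snd (z (real j / real ?N)) - (real j / real ?N) *\<^sub>R w)
             = snd (Z (\<phi> k) j - z (real j / real ?N))" by (simp add: Z_def)
          show "norm (((conf ?N ?x j - (real j / real ?N) *\<^sub>R w) - ?m) - (snd (z (real j / real ?N)) - (real j / real ?N) *\<^sub>R w)) \<le> e / 2"
            unfolding eq using norm_snd_le'[of "Z (\<phi> k) j - z (real j / real ?N)"] elim[rule_format, of j] j by linarith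
        qed (use e in simp)
        finally show ?case using e by simp
      qed
    qed
    ultimately show ?thesis
      using tendsto_add[of "\<lambda>k. (fst (x (\<phi> k)) - int_vec (\<mu> (\<phi> k)))
       - avg (?M k) (\<lambda>j. snd (z (?t k j)) - (?t k j) *\<^sub>R w)" 0] by force
  qed
  have a_lim: "(\<lambda>k. act (?M k) (x (\<phi> k))) \<longlonglongrightarrow> action u"
  proof -
    have act1: "(\<lambda>k. act (N k) (x k) - avg (N k) (\<lambda>j. lagr (Z k j))) \<longlonglongrightarrow> 0"
    proof (rule Lim_null_comparison[OF always_eventually])
      show "\<forall>k. norm (act (N k) (x k) - avg (N k) (\<lambda>j. lagr (Z k j))) \<le> act_err (N k) (x k)"
        using act_lagr[OF N(2) e0] unfolding LZ by simp
      have "(\<lambda>k. act_err (N k) (x k)) \<longlonglongrightarrow> act_const * (0 + 0 + 2 / lam * 0 + 2 * 0 + 4 * B * 0 + 4 / lam\<^sup>2 * 0)"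
        unfolding act_err_def by (intro tendsto_intros sq0 gn0 avg_defect_tendsto)
      then show "(\<lambda>k. act_err (N k) (x k)) \<longlonglongrightarrow> 0" by simp
    qed
    have act2: "(\<lambda>k. avg (?M k) (\<lambda>j. lagr (Z (\<phi> k) j)) - avg (?M k) (\<lambda>j. lagr (z (?t k j)))) \<longlonglongrightarrow> 0"
    proof (rule tendstoI)
      fix e :: real assume e: "e > 0"
      have "uniformly_continuous_on (cball 0 (R' + 1)) lagr"
        by (intro compact_uniformly_continuous continuous_on_subset[OF lagr_cont]) auto
      then obtain d where d: "d > 0"
        "\<And>a b. \<lbrakk>norm a \<le> R' + 1; norm b \<le> R' + 1; norm (b - a) < d\<rbrakk> \<Longrightarrow> norm (lagr b - lagr a) < e / 2"
        using half_gt_zero[OF e] unfolding uniformly_continuous_on_def dist_norm Ball_def mem_cball_0 by meson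
      have "min d 1 > 0" using d by simp
      from unif[OF this]
      show "\<forall>\<^sub>F k in sequentially. dist (avg (?M k) (\<lambda>j. lagr (Z (\<phi> k) j)) - avg (?M k) (\<lambda>j. lagr (z (?t k j)))) 0 < e"
      proof eventually_elim
        case (elim k)
        let ?N = "N (\<phi> k)"
        have "norm (avg ?N (\<lambda>j. lagr (Z (\<phi> k) j) - lagr (z (real j / real ?N)))) \<le> e / 2"
        proof (rule norm_avg_le_const)
          fix j assume j: "j < ?N"
          have 1: "norm (Z (\<phi> k) j - z (real j / real ?N)) < min d 1" using elim j by simp
          have 2: "norm (Z (\<phi> k) j) \<le> R'" using Zbd[of j "\<phi> k"] j by simp
          have "norm (z (real j / real ?N)) \<le> norm (Z (\<phi> k) j) + norm (Z (\<phi> k) j - z (real j / real ?N))"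
            by (metis norm_minus_commute norm_triangle_sub)
          then have "norm (z (real j / real ?N)) \<le> R' + 1" using 1 2 by simp
          then show "norm (lagr (Z (\<phi> k) j) - lagr (z (real j / real ?N))) \<le> e / 2"
            using d(2)[of "z (real j / real ?N)" "Z (\<phi> k) j"] 1 2 by simp
        qed (use e in simp)
        then show ?case using e by (simp add: avg_diff)
      qed
    qed
    have "action u = integral {0..1} (\<lambda>t. lagr (z t))"
      unfolding action_def by (rule integral_cong) (use u in simp)
    moreover have act3: "(\<lambda>k. avg (?M k) (\<lambda>j. lagr (z (?t k j)))) \<longlonglongrightarrow> integral {0..1} (\<lambda>t. lagr (z t))"
      unfolding avg_def by (rule riemann_sum_tendsto[OF _ N\<phi> N(2)])
        (rule continuous_on_compose2[OF lagr_cont zc], simp)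
    ultimately show ?thesis using tendsto_add[OF tendsto_add[OF sub[OF act1] act2] act3] by simp
  qed
  show thesis by (rule that[OF \<phi> sol c_lim a_lim])
qed

end

section \<open>Descent trajectories\<close>

definition transverse :: "int ^ 'n::finite \<Rightarrow> 'n \<Rightarrow> 'n \<Rightarrow> real ^ 'n \<Rightarrow> real"
  where "transverse v i m c = c $ m - real_of_int (v $ m) / real_of_int (v $ i) * c $ i"

lemma transverse_add: "transverse v i m (c + d) = transverse v i m c + transverse v i m d"
  and transverse_diff: "transverse v i m (c - d) = transverse v i m c - transverse v i m d"
  by (simp_all add: transverse_def algebra_simps add_divide_distrib diff_divide_distrib)

lemma transverse_scaled_self: "v $ i \<noteq> 0 \<Longrightarrow> transverse v i m (t *\<^sub>R int_vec v) = 0"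
  by (simp add: transverse_def)

context discretisation
begin

definition "traj N s x t = (step N s ^^ t) x"

lemma traj_0 [simp]: "traj N s x 0 = x" and traj_Suc: "traj N s x (Suc t) = step N s (traj N s x t)"
  by (simp_all add: traj_def)

lemma avg_traj: "N > 0 \<Longrightarrow> avg N (snd (snd x)) = 0 \<Longrightarrow> avg N (snd (snd (traj N s x t))) = 0"
  by (induction t) (simp_all add: traj_Suc avg_step)

lemma norm_gr_c_le_B: "norm (gr_c N x) \<le> B"
  unfolding gr_c_def norm_minus_cancel by (rule norm_avg_le_const[OF norm_snd_G_le]) (use B_pos in simp)

lemma traj_drift: "s \<ge> 0 \<Longrightarrow> norm (fst (traj N s x t) - fst x) \<le> real t * (s * B)"
proof (induction t)
  case (Suc t)
  have "fst (traj N s x (Suc t)) - fst x = (fst (traj N s x t) - fst x) - s *\<^sub>R gr_c N (traj N s x t)"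
    by (simp add: traj_Suc step_def)
  also have "norm \<dots> \<le> real t * (s * B) + s * B"
  proof (rule order_trans[OF norm_triangle_ineq4 add_mono])
    show "norm (s *\<^sub>R gr_c N (traj N s x t)) \<le> s * B"
      using Suc.prems norm_gr_c_le_B by (simp add: mult_left_mono)
  qed (use Suc in simp)
  finally show ?case by (simp add: algebra_simps)
qed simp

lemma traj_unstable_eq:
  "fst (snd (traj N s x (Suc t))) j = (1 + s * lam) *\<^sub>R fst (snd (traj N s x t)) j + s *\<^sub>R fst (G (node N (traj N s x t) j))"
  by (simp add: traj_Suc step_def gr_y_def algebra_simps)

text \<open>Beyond \<open>B / lam\<close> the linear expansion of \<open>y\<close> dominates the
  bounded force, so a component that starts there never returns. The sign \<epsilon> treats opposite
  faces of the cube together.\<close>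

lemma traj_unstable_ge:
  assumes s: "s \<ge> 0" and \<rho>: "lam * \<rho> \<ge> B" and \<epsilon>: "\<bar>\<epsilon>\<bar> = 1" and x: "\<epsilon> * fst (snd x) j $ i \<ge> \<rho>"
  shows "\<epsilon> * fst (snd (traj N s x t)) j $ i \<ge> \<rho>"
proof (induction t)
  case (Suc t)
  let ?y = "fst (snd (traj N s x t)) j $ i" and ?f = "fst (G (node N (traj N s x t) j)) $ i"
  have "\<bar>?f\<bar> \<le> B" using component_le_norm_cart norm_fst_G_le order_trans by blast
  then have "\<bar>\<epsilon> * ?f\<bar> \<le> B" using \<epsilon> by (simp add: abs_mult)
  moreover have "lam * (\<epsilon> * ?y) \<ge> lam * \<rho>" using Suc lam by simp
  ultimately have "s * (lam * (\<epsilon> * ?y) + \<epsilon> * ?f) \<ge> 0"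
    using \<rho> s by (intro mult_nonneg_nonneg) auto
  then show ?case using Suc by (simp add: traj_unstable_eq algebra_simps)
qed (use x in simp)

lemma mom_alt: "mom x j = fst (snd x) j + (1 / lam) *\<^sub>R w + snd (snd x) j"
  by (cases x) simp

lemma conf_alt: "conf N x j = fst x + (real j / real N) *\<^sub>R w + lam *\<^sub>R avg N (\<lambda>i. ker N j i *\<^sub>R snd (snd x) i)"
  by (cases x) simp

lemma continuous_on_state_coords:
  "continuous_on UNIV (\<lambda>x :: 'n state. fst (snd x) j)" "continuous_on UNIV (\<lambda>x :: 'n state. snd (snd x) j)"
  by (rule continuous_on_product_then_coordinatewise, intro continuous_intros)+

lemma continuous_on_G_node: "continuous_on UNIV (\<lambda>x. G (node N x j))"
  by (rule continuous_on_compose2[OF G_cont])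
    (auto simp: node_def mom_alt conf_alt avg_def intro!: continuous_intros continuous_on_state_coords)

lemma continuous_on_step: "continuous_on UNIV (step N s)"
proof -
  note G = continuous_on_fst[OF continuous_on_G_node] continuous_on_snd[OF continuous_on_G_node]
  have 1: "continuous_on UNIV (gr_c N)"
    unfolding gr_c_def[abs_def] avg_def by (intro continuous_intros G)
  have 2: "continuous_on UNIV (\<lambda>x. gr_y N x j)" for j
    unfolding gr_y_def by (intro continuous_intros G continuous_on_state_coords)
  have raw: "continuous_on UNIV (\<lambda>x. raw N x j)" for j
    unfolding raw_def avg_def by (intro continuous_intros G)
  have 3: "continuous_on UNIV (\<lambda>x. gr_e N x j)" for j
    unfolding gr_e_def avg_def by (intro continuous_intros raw continuous_on_state_coords)
  show ?thesis
    unfolding step_def[abs_def]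
    by (intro continuous_on_Pair continuous_on_coordinatewise_then_product continuous_intros 1 2 3 continuous_on_state_coords)
qed

lemma continuous_on_traj: "continuous_on UNIV (\<lambda>x. traj N s x t)"
proof (induction t)
  case (Suc t)
  show ?case
    unfolding traj_Suc by (rule continuous_on_compose2[OF continuous_on_step Suc]) auto
qed (simp add: continuous_on_id)

abbreviation "ell \<equiv> transverse v"

definition "ellC i = 1 + (\<Sum>m\<in>UNIV. \<bar>real_of_int (v $ m) / real_of_int (v $ i)\<bar>)"

lemma ellC_pos: "ellC i > 0"
  by (simp add: ellC_def add_pos_nonneg sum_nonneg)

lemma abs_ell_le: "\<bar>ell i m c\<bar> \<le> ellC i * norm c"
proof -
  let ?q = "\<bar>real_of_int (v $ m) / real_of_int (v $ i)\<bar>"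
  have "\<bar>ell i m c\<bar> \<le> \<bar>c $ m\<bar> + ?q * \<bar>c $ i\<bar>"
    unfolding transverse_def abs_mult[symmetric] by (rule abs_triangle_ineq4)
  also have "\<dots> \<le> norm c + ?q * norm c"
    by (intro add_mono mult_left_mono component_le_norm_cart) auto
  also have "\<dots> = (1 + ?q) * norm c" by (simp add: algebra_simps)
  also have "\<dots> \<le> ellC i * norm c"
    unfolding ellC_def
    by (intro mult_right_mono add_left_mono member_le_sum[of m UNIV "\<lambda>m. \<bar>real_of_int (v $ m) / real_of_int (v $ i)\<bar>"]) auto
  finally show ?thesis .
qed

lemma continuous_on_ell: "continuous_on S (ell i m)"
  unfolding transverse_def[abs_def] by (intro continuous_intros)

text \<open>
  The unknowns are \<open>y\<close> and the components of \<open>c\<close> other than \<open>i0\<close>. Under the descent \<open>y\<close> expands, and \<open>c\<close> moves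
  by at most \<open>M s B\<close>, so that all equations have the right signs on the faces of a large cube.
\<close>

lemma ex_trajectory:
  assumes N: "N > 0" and s: "s > 0" and i0: "v $ i0 \<noteq> 0" and \<tau>: "\<And>m. \<tau> m \<le> M"
  obtains x0 where "snd (snd x0) = (\<lambda>_. 0)" "\<And>j. j < N \<Longrightarrow> fst (snd (traj N s x0 M)) j = 0"
    "\<And>m. m \<noteq> i0 \<Longrightarrow> ell i0 m (fst (traj N s x0 (\<tau> m))) = \<beta> m"
proof -
  \<comment> \<open>With \<open>e = 0\<close> and the \<open>i0\<close> component of
    \<open>c\<close> equal to 0 there remain as many unknowns as equations, and
    \<open>ell i0 m\<close> of the initial mean is exactly the unknown with index m.\<close>
  define init :: "((nat \<times> 'n) + 'n \<Rightarrow> real) \<Rightarrow> 'n state"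
    where "init x = ((\<chi> m. if m = i0 then 0 else x (Inr m)), (\<lambda>j. \<chi> i. x (Inl (j, i))), (\<lambda>_. 0))" for x
  define f :: "((nat \<times> 'n) + 'n \<Rightarrow> real) \<Rightarrow> (nat \<times> 'n) + 'n \<Rightarrow> real"
    where "f x a = (case a of Inl (j, i) \<Rightarrow> fst (snd (traj N s (init x) M)) j $ i
       | Inr m \<Rightarrow> ell i0 m (fst (traj N s (init x) (\<tau> m))) - \<beta> m)" for x a
  define I :: "((nat \<times> 'n) + 'n) set" where "I = ({..<N} \<times> UNIV) <+> (UNIV - {i0})"
  define D where "D = ellC i0 * (real M * (s * B)) + (\<Sum>m\<in>UNIV. \<bar>\<beta> m\<bar>)"
  \<comment> \<open>Larger than \<open>B / lam\<close>, as required on the faces for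
    \<open>y\<close>, and than \<open>D\<close>, the bound for drift plus target value on the faces
    for the mean.\<close>
  define \<rho> where "\<rho> = B / lam + 1 + D"
  have D: "D \<ge> 0"
    using ellC_pos[of i0] s B_pos by (auto simp: D_def intro!: add_nonneg_nonneg sum_nonneg mult_nonneg_nonneg)
  have Bl: "B / lam \<ge> 0" using B_pos lam by simp
  have "lam * (B / lam) \<le> lam * \<rho>"
    using lam D unfolding \<rho>_def by (intro mult_left_mono) auto
  then have \<rho>: "\<rho> > 0" "lam * \<rho> \<ge> B" "\<rho> \<ge> D"
    using Bl D lam by (auto simp: \<rho>_def)
  have cx: "continuous_on UNIV (\<lambda>x. x a :: real)" for a :: "(nat \<times> 'n) + 'n" by simp
  have cif: "continuous_on UNIV (\<lambda>x :: (nat \<times> 'n) + 'n \<Rightarrow> real. if m = i0 then 0 else x (Inr m))" for m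
    by (cases "m = i0") simp_all
  have init_cont: "continuous_on UNIV init"
    unfolding init_def[abs_def]
    by (intro continuous_on_Pair continuous_on_coordinatewise_then_product continuous_on_vec_lambda continuous_on_const cx cif)
  have tc: "continuous_on UNIV (\<lambda>x. traj N s (init x) t)" for t
    by (rule continuous_on_compose2[OF continuous_on_traj init_cont]) auto
  have drift: "\<bar>ell i0 m (fst (traj N s (init x) (\<tau> m))) - x (Inr m) - \<beta> m\<bar> \<le> D" if m: "m \<noteq> i0" for x m
  proof -
    let ?c = "fst (traj N s (init x) (\<tau> m))"
    have "ell i0 m (fst (init x)) = x (Inr m)" using m by (simp add: init_def transverse_def)
    then have "ell i0 m ?c - x (Inr m) = ell i0 m (?c - fst (init x))"
      by (simp add: transverse_diff)
    also have "\<bar>\<dots>\<bar> \<le> ellC i0 * norm (?c - fst (init x))" by (rule abs_ell_le)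
    also have "\<dots> \<le> ellC i0 * (real M * (s * B))"
    proof (intro mult_left_mono)
      have "norm (?c - fst (init x)) \<le> real (\<tau> m) * (s * B)"
        by (rule traj_drift) (use s in simp)
      also have "\<dots> \<le> real M * (s * B)"
        using \<tau>[of m] s B_pos by (intro mult_right_mono) auto
      finally show "norm (?c - fst (init x)) \<le> real M * (s * B)" .
    qed (use ellC_pos[of i0] in simp)
    finally have "\<bar>ell i0 m ?c - x (Inr m)\<bar> \<le> ellC i0 * (real M * (s * B))" .
    moreover have "\<bar>\<beta> m\<bar> \<le> (\<Sum>m\<in>UNIV. \<bar>\<beta> m\<bar>)"
      by (rule member_le_sum) auto
    ultimately show ?thesis
      unfolding D_def by linarith
  qed
  obtain x where x: "\<And>a. a \<in> I \<Longrightarrow> f x a = 0"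
  proof (rule poincare_miranda[of I \<rho> f])
    show "finite I" by (simp add: I_def)
    show "continuous_on UNIV (\<lambda>x. f x a)" if "a \<in> I" for a
    proof (cases a)
      case (Inl ji)
      obtain j i where ji: "ji = (j, i)" by (cases ji)
      have "continuous_on UNIV (\<lambda>x. fst (snd (traj N s (init x) M)) j)"
        by (rule continuous_on_compose2[OF continuous_on_state_coords(1) tc]) auto
      then show ?thesis
        unfolding f_def Inl ji by (auto intro!: continuous_intros)
    next
      case (Inr m)
      have "continuous_on UNIV (\<lambda>x. ell i0 m (fst (traj N s (init x) (\<tau> m))))"
        by (rule continuous_on_compose2[OF continuous_on_ell[of UNIV] continuous_on_fst[OF tc]]) auto
      then show ?thesis
        unfolding f_def Inr by (auto intro!: continuous_intros)
    qed
    show "f x a \<le> 0" if "a \<in> I" "x a = - \<rho>" for x a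
    proof (cases a)
      case (Inl ji)
      obtain j i where ji: "ji = (j, i)" by (cases ji)
      have "- 1 * fst (snd (traj N s (init x) M)) j $ i \<ge> \<rho>"
        by (rule traj_unstable_ge[OF _ \<rho>(2)]) (use s that(2) Inl ji in \<open>auto simp: init_def\<close>)
      then show ?thesis using \<rho>(1) by (simp add: f_def Inl ji)
    next
      case (Inr m)
      have "m \<noteq> i0" using that(1) Inr by (auto simp: I_def)
      from drift[OF this, of x] show ?thesis using that(2) \<rho>(3) unfolding f_def Inr by simp
    qed
    show "f x a \<ge> 0" if "a \<in> I" "x a = \<rho>" for x a
    proof (cases a)
      case (Inl ji)
      obtain j i where ji: "ji = (j, i)" by (cases ji)
      have "1 * fst (snd (traj N s (init x) M)) j $ i \<ge> \<rho>"
        by (rule traj_unstable_ge[OF _ \<rho>(2)]) (use s that(2) Inl ji in \<open>auto simp: init_def\<close>)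
      then show ?thesis using \<rho>(1) by (simp add: f_def Inl ji)
    next
      case (Inr m)
      have "m \<noteq> i0" using that(1) Inr by (auto simp: I_def)
      from drift[OF this, of x] show ?thesis using that(2) \<rho>(3) unfolding f_def Inr by simp
    qed
  qed (use \<rho> in auto)
  show thesis
  proof (rule that[of "init x"])
    show "snd (snd (init x)) = (\<lambda>_. 0)" by (simp add: init_def)
    show "fst (snd (traj N s (init x) M)) j = 0" if "j < N" for j
    proof -
      have "fst (snd (traj N s (init x) M)) j $ i = 0" for i
        using x[of "Inl (j, i)"] that InlI[of "(j, i)" "{..<N} \<times> UNIV" "UNIV - {i0}"] by (simp add: f_def I_def)
      then show ?thesis by (simp add: vec_eq_iff)
    qed
    show "ell i0 m (fst (traj N s (init x) (\<tau> m))) = \<beta> m" if "m \<noteq> i0" for m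
      using x[of "Inr m"] that InrI[of m "UNIV - {i0}" "{..<N} \<times> UNIV"] by (simp add: f_def I_def)
  qed
qed

section \<open>Quantitative consequences of compactness\<close>

lemma solution_translate: "solution z \<Longrightarrow> solution (\<lambda>t. z t + (0, int_vec m))"
  unfolding solution_def V_per by (auto intro!: derivative_eq_intros)

lemma action_translate: "action (\<lambda>t. z t + (0, int_vec m)) = action z"
  by (simp add: action_def lagr_per)

lemma solution_continuous: "solution z \<Longrightarrow> continuous_on S z"
  unfolding solution_def by (meson continuous_at_imp_continuous_on has_vector_derivative_continuous)

lemma qbar_translate:
  assumes "solution z"
  shows "qbar (\<lambda>t. z t + (0, int_vec m)) = qbar z + int_vec m"
proof -
  have c: "continuous_on {0..1} z" by (rule solution_continuous[OF assms])
  have "qbar (\<lambda>t. z t + (0, int_vec m)) = integral {0..1} (\<lambda>t. (snd (z t) - t *\<^sub>R w) + int_vec m)"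
    by (simp add: mean_conf_def algebra_simps)
  also have "\<dots> = integral {0..1} (\<lambda>t. snd (z t) - t *\<^sub>R w) + integral {0..1} (\<lambda>t::real. int_vec m)"
    by (intro Henstock_Kurzweil_Integration.integral_add integrable_continuous_real continuous_intros c)
  finally show ?thesis by (simp add: mean_conf_def)
qed

text \<open>In the two contradiction arguments that follow, the same k bounds the grid size from
  below and the gradient from above, so that failure for arbitrarily large k directly yields the
  hypotheses of \<open>palais_smale\<close>.\<close>

lemma near_critical_sequence:
  assumes "\<exists>\<^sub>F k in sequentially. \<exists>N x. N \<ge> Suc k \<and> avg N (snd (snd x)) = 0 \<and> P k N x \<and> gsq N x < 1 / real (Suc k)"
  obtains \<kappa> N x where "\<And>k. k \<le> \<kappa> k" "\<And>k. P (\<kappa> k) (N k) (x k)" "filterlim N at_top sequentially" "\<And>k. N k > (0::nat)"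
    "\<And>k. avg (N k) (snd (snd (x k))) = 0" "\<And>k. gsq (N k) (x k) \<le> 1" "(\<lambda>k. gsq (N k) (x k)) \<longlonglongrightarrow> 0"
proof -
  have "\<forall>k. \<exists>p N x. p \<ge> k \<and> N \<ge> Suc p \<and> avg N (snd (snd x)) = 0 \<and> P p N x \<and> gsq N x < 1 / real (Suc p)"
    using assms unfolding frequently_sequentially by meson
  then obtain \<kappa> N x where *: "\<And>k. k \<le> \<kappa> k" "\<And>k. Suc (\<kappa> k) \<le> N k" "\<And>k. avg (N k) (snd (snd (x k))) = 0"
    "\<And>k. P (\<kappa> k) (N k) (x k)" "\<And>k. gsq (N k) (x k) < 1 / real (Suc (\<kappa> k))"
    by metis
  have g: "gsq (N k) (x k) \<le> inverse (real (Suc k))" for k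
  proof -
    have "1 / real (Suc (\<kappa> k)) \<le> inverse (real (Suc k))"
      using *(1)[of k] by (simp add: inverse_eq_divide frac_le)
    then show ?thesis using *(5)[of k] by linarith
  qed
  have N: "k < N k" for k using *(1,2)[of k] by simp
  show thesis
  proof (rule that[of \<kappa> N x])
    show "filterlim N at_top sequentially"
      by (rule filterlim_at_top_mono[OF filterlim_ident]) (use N in \<open>auto intro!: always_eventually less_imp_le\<close>)
    show "N k > 0" for k using N[of k] by simp
    show "gsq (N k) (x k) \<le> 1" for k using g[of k] by (rule order_trans) (simp add: field_simps)
    show "(\<lambda>k. gsq (N k) (x k)) \<longlonglongrightarrow> 0"
      by (rule tendsto_sandwich[OF _ _ tendsto_const LIMSEQ_inverse_real_of_nat])
        (use g gsq_nonneg in auto)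
  qed (use * in auto)
qed

text \<open>From a sequence of counterexamples \<open>palais_smale\<close> would extract a solution
  whose action is the limit of theirs.\<close>

lemma critical_values_near:
  assumes \<epsilon>: "\<epsilon> > 0"
  shows "\<forall>\<^sub>F k in sequentially. \<forall>N x. N \<ge> Suc k \<longrightarrow> avg N (snd (snd x)) = 0 \<longrightarrow> act N x \<le> C0 + 1 / 2 \<longrightarrow>
     gsq N x < 1 / real (Suc k) \<longrightarrow> (\<exists>z. solution z \<and> action z \<le> C0 + 1 \<and> \<bar>act N x - action z\<bar> < \<epsilon>)"
proof (rule ccontr)
  assume "\<not> ?thesis"
  then have "\<exists>\<^sub>F k in sequentially. \<exists>N x. N \<ge> Suc k \<and> avg N (snd (snd x)) = 0 \<and>
     (act N x \<le> C0 + 1 / 2 \<and> \<not> (\<exists>z. solution z \<and> action z \<le> C0 + 1 \<and> \<bar>act N x - action z\<bar> < \<epsilon>)) \<and> gsq N x < 1 / real (Suc k)"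
    unfolding not_eventually by (rule frequently_elim1) blast
  then obtain \<kappa> N x where *: "\<And>k. act (N k) (x k) \<le> C0 + 1 / 2 \<and>
      \<not> (\<exists>z. solution z \<and> action z \<le> C0 + 1 \<and> \<bar>act (N k) (x k) - action z\<bar> < \<epsilon>)"
    and ps: "filterlim N at_top sequentially" "\<And>k. N k > (0::nat)"
    "\<And>k. avg (N k) (snd (snd (x k))) = 0" "\<And>k. gsq (N k) (x k) \<le> 1" "(\<lambda>k. gsq (N k) (x k)) \<longlonglongrightarrow> 0"
    by (rule near_critical_sequence) blast
  obtain \<phi> m z where z: "strict_mono (\<phi> :: nat \<Rightarrow> nat)" "solution z"
    "(\<lambda>k. fst (x (\<phi> k)) - int_vec (m k)) \<longlonglongrightarrow> qbar z" "(\<lambda>k. act (N (\<phi> k)) (x (\<phi> k))) \<longlonglongrightarrow> action z"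
    by (rule palais_smale[OF ps]) blast
  have "action z \<le> C0 + 1 / 2" by (rule LIMSEQ_le_const2[OF z(4)]) (use * in blast)
  moreover obtain k where "\<bar>act (N (\<phi> k)) (x (\<phi> k)) - action z\<bar> < \<epsilon>"
    using LIMSEQ_D[OF z(4) \<epsilon>] by auto
  ultimately show False using *[of "\<phi> k"] z(2) by force
qed

text \<open>Compactness holds only up to integer translations \<open>p k\<close>, so the limit
  solution need not lie on the level \<beta> itself. But \<open>v $ i0\<close> times the form takes
  integer values on integer vectors, so the limit of these values is attained by some vector q, and
  translating the limit solution by q puts it on the forbidden level.\<close>

lemma gradient_bounded_below_near_level:
  assumes i0: "v $ i0 \<noteq> 0"
    and \<beta>: "\<And>z. solution z \<Longrightarrow> action z \<le> C0 + 1 \<Longrightarrow> ell i0 m (qbar z) \<noteq> \<beta>"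
  shows "\<forall>\<^sub>F k in sequentially. \<forall>N x. N \<ge> Suc k \<longrightarrow> avg N (snd (snd x)) = 0 \<longrightarrow> act N x \<le> C0 + 1 / 2 \<longrightarrow>
     \<bar>ell i0 m (fst x) - \<beta>\<bar> \<le> 1 / real (Suc k) \<longrightarrow> gsq N x \<ge> 1 / real (Suc k)"
proof (rule ccontr)
  assume "\<not> ?thesis"
  then have "\<exists>\<^sub>F k in sequentially. \<exists>N x. N \<ge> Suc k \<and> avg N (snd (snd x)) = 0 \<and>
     (act N x \<le> C0 + 1 / 2 \<and> \<bar>ell i0 m (fst x) - \<beta>\<bar> \<le> 1 / real (Suc k)) \<and> gsq N x < 1 / real (Suc k)"
    unfolding not_eventually by (rule frequently_elim1) (meson not_le)
  then obtain \<kappa> N x where \<kappa>: "\<And>k. k \<le> \<kappa> k"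
    and *: "\<And>k. act (N k) (x k) \<le> C0 + 1 / 2 \<and> \<bar>ell i0 m (fst (x k)) - \<beta>\<bar> \<le> 1 / real (Suc (\<kappa> k))"
    and ps: "filterlim N at_top sequentially" "\<And>k. N k > (0::nat)"
    "\<And>k. avg (N k) (snd (snd (x k))) = 0" "\<And>k. gsq (N k) (x k) \<le> 1" "(\<lambda>k. gsq (N k) (x k)) \<longlonglongrightarrow> 0"
    by (rule near_critical_sequence) blast
  obtain \<phi> p z where z: "strict_mono (\<phi> :: nat \<Rightarrow> nat)" "solution z"
    "(\<lambda>k. fst (x (\<phi> k)) - int_vec (p k)) \<longlonglongrightarrow> qbar z" "(\<lambda>k. act (N (\<phi> k)) (x (\<phi> k))) \<longlonglongrightarrow> action z"
    by (rule palais_smale[OF ps]) blast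
  have az: "action z \<le> C0 + 1 / 2" by (rule LIMSEQ_le_const2[OF z(4)]) (use * in blast)
  have "(\<lambda>k. ell i0 m (fst (x k)) - \<beta>) \<longlonglongrightarrow> 0"
  proof (rule Lim_null_comparison[OF always_eventually LIMSEQ_inverse_real_of_nat], rule allI)
    fix k
    have "1 / real (Suc (\<kappa> k)) \<le> inverse (real (Suc k))"
      using \<kappa>[of k] by (simp add: inverse_eq_divide frac_le)
    then show "norm (ell i0 m (fst (x k)) - \<beta>) \<le> inverse (real (Suc k))"
      unfolding real_norm_def using *[of k] by linarith
  qed
  from LIMSEQ_subseq_LIMSEQ[OF this z(1)]
  have 1: "(\<lambda>k. ell i0 m (fst (x (\<phi> k))) - \<beta>) \<longlonglongrightarrow> 0"
    by (simp add: o_def)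
  have 2: "(\<lambda>k. ell i0 m (fst (x (\<phi> k)) - int_vec (p k))) \<longlonglongrightarrow> ell i0 m (qbar z)"
    by (rule continuous_on_tendsto_compose[OF continuous_on_ell[of UNIV] z(3)]) auto
  have "(\<lambda>k. ell i0 m (int_vec (p k))) \<longlonglongrightarrow> \<beta> - ell i0 m (qbar z)"
    using tendsto_diff[OF tendsto_add[OF 1 tendsto_const[of \<beta>]] 2] by (simp add: transverse_diff)
  from tendsto_mult_left[OF this, of "real_of_int (v $ i0)"]
  have lim: "(\<lambda>k. real_of_int (v $ i0) * ell i0 m (int_vec (p k))) \<longlonglongrightarrow> real_of_int (v $ i0) * (\<beta> - ell i0 m (qbar z))" .
  let ?S = "range (\<lambda>q :: int ^ 'n. v $ i0 * q $ m - v $ m * q $ i0)"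
  have S: "real_of_int (v $ i0) * ell i0 m (int_vec q) = of_int (v $ i0 * q $ m - v $ m * q $ i0)" for q
    using i0 by (simp add: transverse_def field_simps)
  have "\<forall>k. real_of_int (v $ i0) * ell i0 m (int_vec (p k)) \<in> of_int ` ?S"
    unfolding S by blast
  then have "real_of_int (v $ i0) * (\<beta> - ell i0 m (qbar z)) \<in> of_int ` ?S"
    by (intro Lim_in_closed_set[OF closed_of_int_image always_eventually _ lim]) auto
  then obtain q where "real_of_int (v $ i0) * (\<beta> - ell i0 m (qbar z)) = of_int (v $ i0 * q $ m - v $ m * q $ i0)"
    by auto
  then have "real_of_int (v $ i0) * (\<beta> - ell i0 m (qbar z)) = real_of_int (v $ i0) * ell i0 m (int_vec q)"
    unfolding S .
  then have "ell i0 m (qbar z + int_vec q) = \<beta>" using i0 by (simp add: transverse_add)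
  then show False
    using \<beta>[OF solution_translate[OF z(2), of q]] az by (simp add: action_translate qbar_translate[OF z(2)])
qed

text \<open>With \<open>e = 0\<close> the velocity is constantly \<open>w\<close>, hence the
  integrand is \<open>p \<bullet> w - H\<close>, bounded by \<open>C0\<close> however large
  \<open>y\<close> is.\<close>

lemma act_start_le:
  assumes N: "N > 0" and e: "snd (snd x) = (\<lambda>_. 0)"
    and C0: "\<And>z. fst z \<bullet> w - (lam / 2 * (norm (fst z))\<^sup>2 + F z) \<le> C0"
  shows "act N x \<le> C0"
proof -
  have e0: "avg N (snd (snd x)) = 0" using e by (simp add: avg_def)
  have "act N x = avg N (\<lambda>j. mom x j \<bullet> w - lam / 2 * (norm (mom x j))\<^sup>2 - F (node N x j))"
    unfolding act_eq_avg[OF N e0] e by simp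
  also have "\<dots> \<le> avg N (\<lambda>j. C0)"
  proof (rule avg_mono)
    fix j
    show "mom x j \<bullet> w - lam / 2 * (norm (mom x j))\<^sup>2 - F (node N x j) \<le> C0"
      using C0[of "node N x j"] by (simp add: node_def)
  qed
  finally show ?thesis using N by (simp add: avg_const)
qed

text \<open>With \<open>y = 0\<close> no negative quadratic term is left.\<close>

lemma act_end_ge:
  assumes "\<And>j. j < N \<Longrightarrow> fst (snd x) j = 0"
  shows "act N x \<ge> - B"
proof -
  obtain c y e where x: "x = (c, y, e)" by (cases x) auto
  have "avg_sq N y = avg N (\<lambda>j. 0)"
    by (rule avg_cong) (use assms in \<open>simp add: x\<close>)
  then have y: "avg_sq N y = 0" by (simp add: avg_def)
  have "avg N (\<lambda>j. F (node N x j)) \<le> B"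
    by (rule avg_le_const) (use abs_F_le B_pos in \<open>auto simp: abs_le_iff\<close>)
  moreover have "0 \<le> lam / 2 * avg_sq N e + (norm w)\<^sup>2 / (2 * lam)"
    using lam by (intro add_nonneg_nonneg mult_nonneg_nonneg avg_nonneg) auto
  ultimately show ?thesis by (simp add: x y)
qed


theorem distinct_critical_values:
  assumes i0: "v $ i0 \<noteq> 0"
    and C0: "\<And>z. fst z \<bullet> w - (lam / 2 * (norm (fst z))\<^sup>2 + F z) \<le> C0"
    and \<beta>: "\<And>m z. m \<noteq> i0 \<Longrightarrow> solution z \<Longrightarrow> action z \<le> C0 + 1 \<Longrightarrow> ell i0 m (qbar z) \<noteq> \<beta> m"
  obtains Z where "\<And>i. i < CARD('n) \<Longrightarrow> solution (Z i) \<and> action (Z i) \<le> C0 + 1"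
    "inj_on (\<lambda>i. action (Z i)) {..<CARD('n)}"
proof -
  define n where "n = CARD('n)"
  have n: "n > 0" by (simp add: n_def)
  define safe where "safe k m \<longleftrightarrow> (m \<noteq> i0 \<longrightarrow> (\<forall>N x. N \<ge> Suc k \<longrightarrow> avg N (snd (snd x)) = 0 \<longrightarrow> act N x \<le> C0 + 1 / 2 \<longrightarrow>
     \<bar>ell i0 m (fst x) - \<beta> m\<bar> \<le> 1 / real (Suc k) \<longrightarrow> gsq N x \<ge> 1 / real (Suc k)))" for k m
  have "\<forall>\<^sub>F k in sequentially. safe k m" for m
    using gradient_bounded_below_near_level[OF i0 \<beta>] unfolding safe_def by (cases "m = i0") auto
  then have "\<forall>\<^sub>F k in sequentially. \<forall>m. safe k m"
    by (rule eventually_all_finite)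
  then obtain ka where ka: "\<And>m N x. \<lbrakk>m \<noteq> i0; N \<ge> Suc ka; avg N (snd (snd x)) = 0; act N x \<le> C0 + 1 / 2;
      \<bar>ell i0 m (fst x) - \<beta> m\<bar> \<le> 1 / real (Suc ka)\<rbrakk> \<Longrightarrow> gsq N x \<ge> 1 / real (Suc ka)"
    unfolding eventually_sequentially safe_def by blast
  define \<delta>a where "\<delta>a = 1 / real (Suc ka)"
  define L where "L = ellC i0"
  \<comment> \<open>The price of moving the form by \<open>\<delta>a\<close> where the gradient
    squared g is at least \<open>\<delta>a\<close>: the form moves at speed at most
    \<open>L * sqrt g\<close>, hence at most \<open>L / sqrt \<delta>a * g\<close>, while the action
    is spent at rate g/2.\<close>
  define \<kappa> where "\<kappa> = sqrt \<delta>a * \<delta>a / (2 * L)"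
  have \<delta>a: "\<delta>a > 0" by (simp add: \<delta>a_def)
  have L: "L > 0" by (simp add: L_def ellC_pos)
  have \<kappa>: "\<kappa> > 0" using \<delta>a L by (simp add: \<kappa>_def)
  obtain kb where kb: "\<And>N x. \<lbrakk>N \<ge> Suc kb; avg N (snd (snd x)) = 0; act N x \<le> C0 + 1 / 2; gsq N x < 1 / real (Suc kb)\<rbrakk>
      \<Longrightarrow> \<exists>z. solution z \<and> action z \<le> C0 + 1 \<and> \<bar>act N x - action z\<bar> < \<kappa> / 4"
    using critical_values_near[of "\<kappa> / 4" C0] \<kappa> unfolding eventually_sequentially by fastforce
  \<comment> \<open>The grid is fixed from here on; both compactness statements hold on it.\<close>
  define N where "N = Suc (max ka kb)"
  have N: "N > 0" "N \<ge> Suc ka" "N \<ge> Suc kb" by (auto simp: N_def)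
  define \<delta> where "\<delta> = min \<delta>a (1 / real (Suc kb))"
  have \<delta>: "\<delta> > 0" "\<delta> \<le> \<delta>a" "\<delta> \<le> 1 / real (Suc kb)"
    using \<delta>a by (auto simp: \<delta>_def)
  define Ct where "Ct = \<bar>C0\<bar> + B + 1"
  have Ct: "Ct > 0" "C0 + B + 1 \<le> Ct" using B_pos by (auto simp: Ct_def)
  \<comment> \<open>Duration of a window. If the gradient squared stayed above \<delta> throughout,
    the action would fall at rate at least \<open>\<delta> / 2 - eps\<close>, hence \<delta>/4, and
    lose more than \<open>Ct\<close>, which bounds the total variation available.\<close>
  define \<tau>0 where "\<tau>0 = 4 * Ct / \<delta> + 1"
  have \<tau>0: "\<tau>0 > 0" using Ct \<delta> by (simp add: \<tau>0_def add_pos_pos)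
  \<comment> \<open>Bound for the accumulated error. The part 1/2 keeps the action below
    \<open>C0 + 1 / 2\<close>; the part \<kappa>/8 is used up three times in
    \<open>big_drop\<close>, leaving 5/8 of \<kappa>.\<close>
  define sm where "sm = min (1 / 2) (\<kappa> / 8)"
  have sm: "sm > 0" "sm \<le> 1 / 2" "sm \<le> \<kappa> / 8" using \<kappa> by (auto simp: sm_def)
  \<comment> \<open>The total elapsed time will be at most \<open>n * (\<tau>0 + 1)\<close>,
    whatever the step size. This breaks the circle that \<open>s\<close> depends on
    \<open>eps\<close>.\<close>
  define eps where "eps = min (\<delta> / 4) (sm / (real n * (\<tau>0 + 1)))"
  have "eps \<le> \<delta> / 4" "eps \<le> sm / (real n * (\<tau>0 + 1))"
    unfolding eps_def by (rule min.cobounded1, rule min.cobounded2)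
  moreover have "eps > 0" using \<delta> sm n \<tau>0 by (simp add: eps_def)
  ultimately have eps: "eps > 0" "eps \<le> \<delta> / 4" "eps \<le> sm / (real n * (\<tau>0 + 1))"
    by blast+
  obtain s0 where s0: "s0 > 0" "\<And>N s x. \<lbrakk>N > 0; 0 < s; s \<le> s0; avg N (snd (snd x)) = 0\<rbrakk> \<Longrightarrow>
      act N (step N s x) \<le> act N x - s / 2 * gsq N x + s * eps"
    using descent[OF eps(1)] by blast
  define s where "s = min s0 1"
  have s: "s > 0" "s \<le> s0" "s \<le> 1" using s0(1) by (auto simp: s_def)
  define len where "len = nat \<lceil>\<tau>0 / s\<rceil>"
  have "\<tau>0 / s > 0" using \<tau>0 s by simp
  then have "\<tau>0 / s \<le> real len" "real len \<le> \<tau>0 / s + 1"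
    unfolding len_def by linarith+
  then have len: "\<tau>0 \<le> real len * s" "real len * s \<le> \<tau>0 + 1"
    using s by (auto simp: field_simps)
  define M where "M = n * len"
  have "card (UNIV - {i0}) = card {1..<n}" by (simp add: n_def card_Diff_singleton)
  then obtain idx where idx: "bij_betw idx (UNIV - {i0}) {1..<n}"
    using finite_same_card_bij[of "UNIV - {i0}" "{1..<n}"] by auto
  \<comment> \<open>Window i runs from \<open>i * len\<close> to \<open>Suc i * len\<close>. Each
    form other than that of \<open>i0\<close> is prescribed at one of the n - 1 interior boundaries;
    the value at \<open>i0\<close> is a placeholder.\<close>
  define \<tau> where "\<tau> m = (if m = i0 then 0 else idx m * len)" for m
  have \<tau>: "\<tau> m \<le> M" for m using bij_betwE[OF idx] by (force simp: \<tau>_def M_def)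
  obtain x0 where x0: "snd (snd x0) = (\<lambda>_. 0)" "\<And>j. j < N \<Longrightarrow> fst (snd (traj N s x0 M)) j = 0"
    "\<And>m. m \<noteq> i0 \<Longrightarrow> ell i0 m (fst (traj N s x0 (\<tau> m))) = \<beta> m"
    using ex_trajectory[where \<tau> = \<tau> and M = M and \<beta> = \<beta>, OF N(1) s(1) i0 \<tau>] by blast
  define X where "X t = traj N s x0 t" for t
  define a where "a t = act N (X t)" for t
  define g where "g t = gsq N (X t)" for t
  have g0: "g t \<ge> 0" for t by (simp add: g_def gsq_nonneg)
  have avX: "avg N (snd (snd (X t))) = 0" for t
    unfolding X_def by (rule avg_traj[OF N(1)]) (simp add: x0(1) avg_def)
  have step1: "a (Suc t) \<le> a t - s / 2 * g t + s * eps" for t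
    using s0(2)[OF N(1) s(1,2) avX[of t]] by (simp add: a_def g_def X_def traj_Suc)
  have steps: "a (p + d) \<le> a p - s / 2 * (\<Sum>t\<in>{p..<p + d}. g t) + real d * (s * eps)" for p d
  proof (induction d)
    case (Suc d)
    then show ?case using step1[of "p + d"] by (simp add: algebra_simps)
  qed simp
  have err: "real d * (s * eps) \<le> sm" if "d \<le> M" for d
  proof -
    have "real d * (s * eps) \<le> real M * (s * eps)"
      using that s eps by (intro mult_right_mono) auto
    also have "\<dots> = real n * (real len * s) * eps" by (simp add: M_def)
    also have "\<dots> \<le> real n * (\<tau>0 + 1) * (sm / (real n * (\<tau>0 + 1)))"
      using len eps \<tau>0 n by (intro mult_mono) auto
    also have "\<dots> = sm" using n \<tau>0 by simp
    finally show ?thesis .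
  qed
  have drop: "a q \<le> a p - s / 2 * (\<Sum>t\<in>{p..<q}. g t) + sm" if "p \<le> q" "q \<le> M" for p q
  proof -
    have "p + (q - p) = q" "q - p \<le> M" using that by auto
    then show ?thesis using steps[of p "q - p"] err[of "q - p"] by simp
  qed
  have mono: "a q \<le> a p + sm" if "p \<le> q" "q \<le> M" for p q
  proof -
    have "0 \<le> s / 2 * (\<Sum>t\<in>{p..<q}. g t)"
      using s g0 by (intro mult_nonneg_nonneg sum_nonneg) auto
    then show ?thesis using drop[OF that] by linarith
  qed
  have aup: "a t \<le> C0 + 1 / 2" if "t \<le> M" for t
  proof -
    have "a 0 \<le> C0"
      unfolding a_def X_def traj_0 by (rule act_start_le[OF N(1) x0(1) C0])
    then show ?thesis using mono[of 0 t] that sm by simp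
  qed
  have alow: "a t \<ge> - B - 1 / 2" if "t \<le> M" for t
  proof -
    have "a M \<ge> - B"
      unfolding a_def X_def by (rule act_end_ge[OF x0(2)])
    then show ?thesis using mono[of t M] that sm by simp
  qed
  have win: "\<exists>t. i * len \<le> t \<and> t < Suc i * len \<and> g t < \<delta>" if i: "i < n" for i
  proof (rule ccontr)
    assume neg: "\<not> ?thesis"
    have iM: "Suc i * len \<le> M"
      unfolding M_def using i by (intro mult_right_mono) auto
    have "real len * \<delta> = (\<Sum>t\<in>{i * len..<i * len + len}. \<delta>)" by simp
    also have "\<dots> \<le> (\<Sum>t\<in>{i * len..<i * len + len}. g t)"
      using neg by (intro sum_mono) (force simp: not_less)
    finally have "s / 2 * (real len * \<delta>) \<le> s / 2 * (\<Sum>t\<in>{i * len..<i * len + len}. g t)"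
      using s by (intro mult_left_mono) auto
    then have "a (i * len + len) \<le> a (i * len) - s / 2 * (real len * \<delta>) + real len * (s * eps)"
      using steps[of "i * len" len] by linarith
    moreover have "real len * (s * eps) \<le> real len * (s * (\<delta> / 4))"
      using eps s by (intro mult_left_mono) auto
    moreover have "a (i * len) \<le> C0 + 1 / 2" "- B - 1 / 2 \<le> a (i * len + len)"
      using aup[of "i * len"] alow[of "i * len + len"] iM by auto
    ultimately have "(real len * s) * (\<delta> / 4) \<le> Ct"
      using Ct(2) by (simp add: algebra_simps)
    moreover have "\<tau>0 * (\<delta> / 4) \<le> (real len * s) * (\<delta> / 4)"
      using len \<delta> by (intro mult_right_mono) auto
    moreover have "\<tau>0 * (\<delta> / 4) = Ct + \<delta> / 4"
      using \<delta> by (simp add: \<tau>0_def field_simps)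
    ultimately show False using \<delta> by linarith
  qed
  then obtain \<sigma> where \<sigma>: "\<And>i. i < n \<Longrightarrow> i * len \<le> \<sigma> i \<and> \<sigma> i < Suc i * len \<and> g (\<sigma> i) < \<delta>"
    by metis
  have \<sigma>M: "\<sigma> i \<le> M" if "i < n" for i
  proof -
    have "\<sigma> i < Suc i * len" using \<sigma>[OF that] by blast
    also have "\<dots> \<le> M"
      unfolding M_def using that by (intro mult_right_mono) auto
    finally show ?thesis by simp
  qed
  \<comment> \<open>At the boundary the form equals \<open>\<beta> m\<close>, while at
    \<open>\<sigma> i\<close> the gradient is too small for the form to be within
    \<open>\<delta>a\<close> of it. Up to the first exit time \<open>u\<close> the gradient squared
    is at least \<open>\<delta>a\<close>, so the distance travelled is paid for with action.\<close>
  have big_drop: "a (\<sigma> i) \<le> a (\<sigma> (i - 1)) - 5 / 8 * \<kappa>" if i: "1 \<le> i" "i < n" for i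
  proof -
    have "i \<in> idx ` (UNIV - {i0})" using idx i by (simp add: bij_betw_def)
    then obtain m where m: "m \<noteq> i0" "idx m = i" by auto
    let ?p = "i * len"
    let ?dev = "\<lambda>t. \<bar>ell i0 m (fst (X t)) - \<beta> m\<bar>"
    have at_p: "ell i0 m (fst (X ?p)) = \<beta> m"
      using x0(3)[OF m(1)] m by (simp add: \<tau>_def X_def)
    have prev: "\<sigma> (i - 1) \<le> ?p"
      using \<sigma>[of "i - 1"] i by (simp add: less_imp_diff_less)
    have near: "g t \<ge> \<delta>a" if "t \<le> M" "?dev t \<le> \<delta>a" for t
      using ka[OF m(1) N(2) avX, of t] aup[OF that(1)] that(2) by (simp add: a_def g_def \<delta>a_def)
    have dev\<sigma>: "?dev (\<sigma> i) > \<delta>a"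
      using near[OF \<sigma>M[OF i(2)]] \<sigma>[OF i(2)] \<delta>(2) by force
    define u where "u = (LEAST t. ?p \<le> t \<and> ?dev t > \<delta>a)"
    have u: "?p \<le> u \<and> ?dev u > \<delta>a"
      unfolding u_def by (rule LeastI[of _ "\<sigma> i"]) (use \<sigma>[OF i(2)] dev\<sigma> in blast)
    have u\<sigma>: "u \<le> \<sigma> i"
      unfolding u_def by (rule Least_le) (use \<sigma>[OF i(2)] dev\<sigma> in blast)
    have before: "?dev t \<le> \<delta>a" if "?p \<le> t" "t < u" for t
      using not_less_Least[of t "\<lambda>t. ?p \<le> t \<and> ?dev t > \<delta>a"] that unfolding u_def by force
    have uM: "u \<le> M" using u\<sigma> \<sigma>M[OF i(2)] by simp
    have travel: "\<bar>ell i0 m (fst (X (?p + d))) - ell i0 m (fst (X ?p))\<bar> \<le> (\<Sum>t\<in>{?p..<?p + d}. L / sqrt \<delta>a * (s * g t))"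
      if "?p + d \<le> u" for d
      using that
    proof (induction d)
      case (Suc d)
      let ?t = "?p + d"
      have gt: "g ?t \<ge> \<delta>a" using near[of ?t] before[of ?t] Suc.prems uM by simp
      have "ell i0 m (fst (X (Suc ?t))) - ell i0 m (fst (X ?t)) = ell i0 m (- (s *\<^sub>R gr_c N (X ?t)))"
        by (simp add: X_def traj_Suc step_def transverse_diff[symmetric])
      also have "\<bar>\<dots>\<bar> \<le> L * norm (- (s *\<^sub>R gr_c N (X ?t)))"
        unfolding L_def by (rule abs_ell_le)
      also have "\<dots> \<le> L * (s * sqrt (g ?t))"
        using norm_gr_c_le[of N "X ?t"] s L by (simp add: g_def)
      also have "\<dots> \<le> L / sqrt \<delta>a * (s * g ?t)"
      proof -
        have "sqrt \<delta>a * sqrt (g ?t) \<le> sqrt (g ?t) * sqrt (g ?t)"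
          using gt g0[of ?t] by (intro mult_right_mono) auto
        then have "sqrt (g ?t) \<le> g ?t / sqrt \<delta>a"
          using \<delta>a g0[of ?t] by (simp add: field_simps)
        then have "L * s * sqrt (g ?t) \<le> L * s * (g ?t / sqrt \<delta>a)"
          using L s by (intro mult_left_mono) auto
        then show ?thesis by (simp add: mult.assoc mult.commute)
      qed
      finally have "\<bar>ell i0 m (fst (X (Suc ?t))) - ell i0 m (fst (X ?t))\<bar> \<le> L / sqrt \<delta>a * (s * g ?t)" .
      then show ?case using Suc by simp
    qed simp
    have "\<delta>a < (\<Sum>t\<in>{?p..<u}. L / sqrt \<delta>a * (s * g t))"
      using travel[of "u - ?p"] u at_p by simp
    also have "\<dots> = 2 * L / sqrt \<delta>a * (s / 2 * (\<Sum>t\<in>{?p..<u}. g t))"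
      by (simp add: sum_distrib_left mult.assoc)
    finally have "\<kappa> < s / 2 * (\<Sum>t\<in>{?p..<u}. g t)"
      using L \<delta>a by (simp add: \<kappa>_def field_simps)
    then have "a u \<le> a ?p - \<kappa> + sm" using drop[of ?p u] u uM by linarith
    moreover have "a (\<sigma> i) \<le> a u + sm" by (rule mono[OF u\<sigma> \<sigma>M[OF i(2)]])
    moreover have "a ?p \<le> a (\<sigma> (i - 1)) + sm" by (rule mono[OF prev]) (use u uM in simp)
    ultimately show ?thesis using sm by linarith
  qed
  have "\<exists>z. solution z \<and> action z \<le> C0 + 1 \<and> \<bar>a (\<sigma> i) - action z\<bar> < \<kappa> / 4" if "i < n" for i
    unfolding a_def
    by (rule kb[OF N(3) avX]) (use aup[OF \<sigma>M[OF that]] \<sigma>[OF that] \<delta>(3) in \<open>auto simp: a_def g_def\<close>)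
  then obtain Z where Z: "\<And>i. i < n \<Longrightarrow> solution (Z i) \<and> action (Z i) \<le> C0 + 1 \<and> \<bar>a (\<sigma> i) - action (Z i)\<bar> < \<kappa> / 4"
    by metis
  \<comment> \<open>The two approximations consume at most half of \<kappa> out of the drop by
    5/8.\<close>
  have dec1: "action (Z (Suc i)) < action (Z i)" if "Suc i < n" for i
  proof -
    have "a (\<sigma> (Suc i)) \<le> a (\<sigma> i) - 5 / 8 * \<kappa>"
      using big_drop[of "Suc i"] that by simp
    moreover have "\<bar>a (\<sigma> i) - action (Z i)\<bar> < \<kappa> / 4" "\<bar>a (\<sigma> (Suc i)) - action (Z (Suc i))\<bar> < \<kappa> / 4"
      using Z[of i] Z[of "Suc i"] that by auto
    ultimately show ?thesis using \<kappa> by linarith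
  qed
  have dec: "action (Z (i + Suc d)) < action (Z i)" if "i + Suc d < n" for i d using that
  proof (induction d)
    case 0
    then show ?case using dec1[of i] by simp
  next
    case (Suc d)
    then show ?case using dec1[of "i + Suc d"] by simp
  qed
  show thesis
  proof (rule that[of Z])
    show "inj_on (\<lambda>i. action (Z i)) {..<CARD('n)}"
    proof (rule linorder_inj_onI)
      fix i j assume ij: "i < j" "i \<in> {..<CARD('n)}" "j \<in> {..<CARD('n)}"
      then obtain d where "j = i + Suc d" using less_imp_Suc_add by auto
      then show "action (Z i) \<noteq> action (Z j)" using dec[of i d] ij by (simp add: n_def)
    qed auto
  qed (use Z in \<open>auto simp: n_def\<close>)
qed

end

section \<open>Truncation of the Hamiltonian\<close>

lemma periodic_integral_shift:
  fixes f :: "real \<Rightarrow> 'a::euclidean_space"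
  assumes cont: "continuous_on UNIV f" and per: "\<And>t. f (t + 1) = f t"
  shows "integral {0..1} (\<lambda>t. f (t + \<theta>)) = integral {0..1} f"
proof -
  have int: "f integrable_on {a..b}" for a b
    by (rule integrable_continuous_real, rule continuous_on_subset[OF cont]) simp
  have per': "f (t + of_int m) = f t" for t m
    using periodic_int_multiple[of f 1, OF per, of t m] by simp
  define c where "c = frac \<theta>"
  have c: "0 \<le> c" "c \<le> 1" by (auto simp: c_def frac_lt_1 less_imp_le)
  have shift: "integral {a..b} (\<lambda>t. f (d + t)) = integral {a + d..b + d} f" for a b d
    using integral_shift_Icc_real[of a b f d] by (simp add: o_def)
  have "f (t + \<theta>) = f (c + t)" for t
    using per'[of "c + t" "\<lfloor>\<theta>\<rfloor>"] by (simp add: c_def frac_def algebra_simps)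
  then have "integral {0..1} (\<lambda>t. f (t + \<theta>)) = integral {c..1 + c} f"
    using shift[of 0 1 c] by simp
  also have "\<dots> = integral {c..1} f + integral {1..1 + c} f"
    using c int by (intro Henstock_Kurzweil_Integration.integral_combine[symmetric]) auto
  also have "integral {1..1 + c} f = integral {0..c} f"
    using shift[of 0 c 1] per by (simp add: add.commute)
  also have "integral {c..1} f + integral {0..c} f = integral {0..1} f"
    using Henstock_Kurzweil_Integration.integral_combine[OF c int] by (simp add: add.commute)
  finally show ?thesis .
qed

text \<open>Equal to 1 up to a and to 0 from b on. Squares of positive parts are continuously
  differentiable, and for a < b the denominator never vanishes. It is applied to the square of the
  norm of the momentum.\<close>

definition cutoff :: "real \<Rightarrow> real \<Rightarrow> real \<Rightarrow> real"
  where "cutoff a b s = (max 0 (b - s))\<^sup>2 / ((max 0 (b - s))\<^sup>2 + (max 0 (s - a))\<^sup>2)"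

definition cutoff' :: "real \<Rightarrow> real \<Rightarrow> real \<Rightarrow> real"
  where "cutoff' a b s = - 2 * (max 0 (b - s) * (max 0 (s - a))\<^sup>2 + (max 0 (b - s))\<^sup>2 * max 0 (s - a))
     / ((max 0 (b - s))\<^sup>2 + (max 0 (s - a))\<^sup>2)\<^sup>2"

lemma DERIV_max_0_sq: "((\<lambda>x. (max 0 x)\<^sup>2) has_real_derivative 2 * max 0 x) (at x)"
proof (cases "x = 0")
  case True
  have "((\<lambda>h. (max 0 h)\<^sup>2 / h) \<longlongrightarrow> 0) (at (0::real))"
  proof (rule Lim_null_comparison[of _ "\<lambda>h. \<bar>h\<bar>"])
    have "norm ((max 0 h)\<^sup>2 / h) \<le> \<bar>h\<bar>" for h :: real
      by (cases "h > 0") (auto simp: power2_eq_square max_def)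
    then show "\<forall>\<^sub>F h in at 0. norm ((max 0 h)\<^sup>2 / h) \<le> \<bar>h :: real\<bar>"
      by simp
    show "((\<lambda>h. \<bar>h :: real\<bar>) \<longlongrightarrow> 0) (at 0)"
      using tendsto_rabs[OF tendsto_ident_at, of 0 UNIV] by simp
  qed
  then show ?thesis using True by (simp add: DERIV_def)
next
  case False
  then consider "x > 0" | "x < 0" by linarith
  then show ?thesis
  proof cases
    case 1
    have "((\<lambda>x. x\<^sup>2) has_real_derivative 2 * max 0 x) (at x)"
      using 1 by (auto intro!: derivative_eq_intros)
    then show ?thesis
      by (rule has_field_derivative_transform_within_open[of _ _ _ "{0<..}"]) (use 1 in auto)
  next
    case 2
    have "((\<lambda>x. 0) has_real_derivative 2 * max 0 x) (at x)" using 2 by simp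
    then show ?thesis
      by (rule has_field_derivative_transform_within_open[of _ _ _ "{..<0}"]) (use 2 in auto)
  qed
qed

lemma cutoff_denominator_pos: "a < b \<Longrightarrow> (max 0 (b - s))\<^sup>2 + (max 0 (s - a))\<^sup>2 > (0::real)"
  by (smt (verit) max_def zero_le_power2 zero_less_power2)

lemma DERIV_cutoff:
  assumes "a < b"
  shows "(cutoff a b has_real_derivative cutoff' a b s) (at s)"
proof -
  have "((\<lambda>s. b - s) has_real_derivative - 1) (at s)" "((\<lambda>s. s - a) has_real_derivative 1) (at s)"
    by (auto intro!: derivative_eq_intros)
  note chain = this[THEN DERIV_chain'[OF _ DERIV_max_0_sq]]
  have 1: "((\<lambda>s. (max 0 (b - s))\<^sup>2) has_real_derivative - 2 * max 0 (b - s)) (at s)"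
    using chain(1) by simp
  have 2: "((\<lambda>s. (max 0 (s - a))\<^sup>2) has_real_derivative 2 * max 0 (s - a)) (at s)"
    using chain(2) by simp
  have "(cutoff a b has_real_derivative
     ((- 2 * max 0 (b - s)) * ((max 0 (b - s))\<^sup>2 + (max 0 (s - a))\<^sup>2)
      - (max 0 (b - s))\<^sup>2 * (- 2 * max 0 (b - s) + 2 * max 0 (s - a)))
     / (((max 0 (b - s))\<^sup>2 + (max 0 (s - a))\<^sup>2) * ((max 0 (b - s))\<^sup>2 + (max 0 (s - a))\<^sup>2))) (at s)"
    unfolding cutoff_def[abs_def]
    by (rule DERIV_divide[OF 1 DERIV_add[OF 1 2]]) (rule not_sym[OF less_imp_neq[OF cutoff_denominator_pos[OF assms]]])
  moreover have "((- 2 * max 0 (b - s)) * ((max 0 (b - s))\<^sup>2 + (max 0 (s - a))\<^sup>2)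
      - (max 0 (b - s))\<^sup>2 * (- 2 * max 0 (b - s) + 2 * max 0 (s - a)))
      = - 2 * (max 0 (b - s) * (max 0 (s - a))\<^sup>2 + (max 0 (b - s))\<^sup>2 * max 0 (s - a))"
    by (simp add: algebra_simps power2_eq_square)
  ultimately show ?thesis
    unfolding cutoff'_def power2_eq_square[of "(max 0 (b - s))\<^sup>2 + (max 0 (s - a))\<^sup>2"] by simp
qed

lemma continuous_on_cutoff':
  assumes "a < b"
  shows "continuous_on UNIV (cutoff' a b)"
  unfolding cutoff'_def[abs_def]
  by (intro continuous_intros) (use cutoff_denominator_pos[OF assms] in \<open>auto simp: less_le\<close>)

lemma cutoff_eq_1: "a < b \<Longrightarrow> s \<le> a \<Longrightarrow> cutoff a b s = 1"
  by (simp add: cutoff_def)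

lemma cutoff_eq_0: "b \<le> s \<Longrightarrow> cutoff a b s = 0"
  by (simp add: cutoff_def)

lemma cutoff_bounds: "0 \<le> cutoff a b s" "cutoff a b s \<le> 1"
proof -
  have "x / (x + y) \<le> 1" if "0 \<le> x" "0 \<le> y" for x y :: real
    using that by (cases "x + y = 0") (auto simp: divide_le_eq_1)
  then show "cutoff a b s \<le> 1" by (simp add: cutoff_def)
qed (simp add: cutoff_def)

lemma cutoff'_eq_0: "s \<le> a \<or> b \<le> s \<Longrightarrow> cutoff' a b s = 0"
  by (auto simp: cutoff'_def)

lemma cutoff'_nonpos: "cutoff' a b s \<le> 0"
  unfolding cutoff'_def
  by (intro divide_nonpos_nonneg mult_nonpos_nonneg add_nonneg_nonneg mult_nonneg_nonneg) auto

definition unit_solution :: "('n::finite phase \<Rightarrow> 'n phase) \<Rightarrow> int ^ 'n \<Rightarrow> (real \<Rightarrow> 'n phase) \<Rightarrow> bool"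
  where "unit_solution k v z \<longleftrightarrow> (\<forall>t. (z has_vector_derivative J (k (z t))) (at t)) \<and>
     (\<forall>t. z (t + 1) = z t + (0, int_vec v))"

definition lagrangian :: "('n::finite phase \<Rightarrow> real) \<Rightarrow> ('n phase \<Rightarrow> 'n phase) \<Rightarrow> (real \<Rightarrow> 'n phase) \<Rightarrow> real"
  where "lagrangian K k z = integral {0..1} (\<lambda>t. fst (z t) \<bullet> fst (k (z t)) - K (z t))"

text \<open>Lowering \<mu> to at most 2 preserves the growth condition, because \<open>K\<close> is
  positive there, and lets the quadratic Hamiltonian \<open>Q\<close>, with
  \<open>p \<bullet> Q_p = 2 * Q\<close>, satisfy it as well.\<close>

locale superquadratic =
  fixes K :: "'n::finite phase \<Rightarrow> real" and k :: "'n phase \<Rightarrow> 'n phase" and r \<mu> :: real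
  assumes K_deriv: "\<And>z. GDERIV K z :> k z"
    and k_cont: "continuous_on UNIV k"
    and K_per: "\<And>x y m. K (x, y + int_vec m) = K (x, y)"
    and r: "r > 0" and \<mu>: "1 < \<mu>" "\<mu> \<le> 2"
    and K_pos: "\<And>z. norm (fst z) \<ge> r \<Longrightarrow> 0 < K z"
    and K_growth: "\<And>z. norm (fst z) \<ge> r \<Longrightarrow> \<mu> * K z \<le> fst z \<bullet> fst (k z)"
begin

lemma K_cont: "continuous_on S K"
  using K_deriv
  by (auto simp: gderiv_def intro!: continuous_at_imp_continuous_on has_derivative_continuous)

lemma k_per: "k (x, y + int_vec m) = k (x, y)"
proof -
  let ?s = "(0, int_vec m) :: 'n phase"
  have 1: "((\<lambda>z. z + ?s) has_derivative (\<lambda>h. h)) (at (x, y))"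
    by (auto intro!: derivative_eq_intros)
  have 2: "(K has_derivative (\<lambda>h. h \<bullet> k ((x, y) + ?s))) (at ((x, y) + ?s))"
    using K_deriv unfolding gderiv_def by blast
  have "(\<lambda>z. K (z + ?s)) = K" using K_per by (auto simp: fun_eq_iff)
  then have "GDERIV K (x, y) :> k ((x, y) + ?s)"
    using has_derivative_compose[OF 1 2] by (simp add: gderiv_def)
  from GDERIV_unique[OF this K_deriv] show ?thesis by simp
qed

lemma translate_to_box: "\<exists>q. K z = K (fst z, q) \<and> norm q \<le> real CARD('n)"
proof -
  obtain m where "norm (snd z - int_vec m) \<le> real CARD('n)"
    using ex_int_translate by blast
  then show ?thesis
    using K_per[of "fst z" "snd z - int_vec m" m] by (intro exI[of _ "snd z - int_vec m"]) simp
qed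

lemma bounded_on_tube: "\<exists>M. \<forall>z. norm (fst z) \<le> \<rho> \<longrightarrow> \<bar>K z\<bar> \<le> M"
proof -
  let ?A = "cball 0 \<rho> \<times> cball 0 (real CARD('n)) :: 'n phase set"
  have "compact (K ` ?A)" by (intro compact_continuous_image K_cont compact_Times compact_cball)
  then obtain M where M: "\<And>z. z \<in> ?A \<Longrightarrow> \<bar>K z\<bar> \<le> M"
    using bounded_iff[of "K ` ?A"] compact_imp_bounded by auto
  have "\<bar>K z\<bar> \<le> M" if "norm (fst z) \<le> \<rho>" for z
  proof -
    obtain q where q: "K z = K (fst z, q)" "norm q \<le> real CARD('n)"
      using translate_to_box by blast
    then have "(fst z, q) \<in> ?A" using that by simp
    then show ?thesis using M q(1) by metis
  qed
  then show ?thesis by blast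
qed

lemma lower_bound_on_sphere: "\<exists>a>0. \<forall>z. norm (fst z) = r \<longrightarrow> a \<le> K z"
proof -
  let ?A = "sphere 0 r \<times> cball 0 (real CARD('n)) :: 'n phase set"
  have "(r *\<^sub>R axis undefined 1, 0) \<in> ?A" using r by simp
  then have "?A \<noteq> {}" by blast
  then obtain z0 where z0: "z0 \<in> ?A" "\<And>z. z \<in> ?A \<Longrightarrow> K z0 \<le> K z"
    using continuous_attains_inf[of ?A K] K_cont by (metis compact_Times compact_cball compact_sphere)
  have "K z0 \<le> K z" if "norm (fst z) = r" for z
  proof -
    obtain q where q: "K z = K (fst z, q)" "norm q \<le> real CARD('n)"
      using translate_to_box by blast
    then have "(fst z, q) \<in> ?A" using that by simp
    then show ?thesis using z0(2) q(1) by metis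
  qed
  moreover have "K z0 > 0" using K_pos[of z0] z0(1) by (auto simp: mem_Times_iff)
  ultimately show ?thesis by blast
qed

text \<open>Along a ray \<open>K\<close> times \<open>\<sigma> powr (- \<mu>)\<close> is
  nondecreasing, by \<open>K_growth\<close>.\<close>

lemma power_growth:
  assumes p: "norm p = r" and \<sigma>: "\<sigma> \<ge> 1"
  shows "K (\<sigma> *\<^sub>R p, q) \<ge> K (p, q) * \<sigma> powr \<mu>"
proof -
  have dK: "((\<lambda>s. K (s *\<^sub>R p, q)) has_real_derivative p \<bullet> fst (k (s *\<^sub>R p, q))) (at s)" for s
  proof -
    have 1: "((\<lambda>s. (s *\<^sub>R p, q)) has_derivative (\<lambda>h. (h *\<^sub>R p, 0))) (at s)"
      by (auto intro!: derivative_eq_intros)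
    have 2: "(K has_derivative (\<lambda>h. h \<bullet> k (s *\<^sub>R p, q))) (at (s *\<^sub>R p, q))"
      using K_deriv unfolding gderiv_def by blast
    show ?thesis using has_derivative_compose[OF 1 2]
      by (simp add: has_field_derivative_def inner_prod_def mult_commute_abs)
  qed
  have "K (1 *\<^sub>R p, q) * 1 powr (- \<mu>) \<le> K (\<sigma> *\<^sub>R p, q) * \<sigma> powr (- \<mu>)"
  proof (rule DERIV_nonneg_imp_nondecreasing[OF \<sigma>])
    fix s assume s: "1 \<le> s" "s \<le> \<sigma>"
    have "((\<lambda>s. K (s *\<^sub>R p, q) * s powr (- \<mu>)) has_real_derivative
       (p \<bullet> fst (k (s *\<^sub>R p, q))) * s powr (- \<mu>) + (- \<mu> * s powr (- \<mu> - 1)) * K (s *\<^sub>R p, q)) (at s)"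
      by (rule DERIV_mult[OF dK has_real_derivative_powr]) (use s in simp)
    moreover have "(p \<bullet> fst (k (s *\<^sub>R p, q))) * s powr (- \<mu>) + (- \<mu> * s powr (- \<mu> - 1)) * K (s *\<^sub>R p, q) \<ge> 0"
    proof -
      have "norm (fst (s *\<^sub>R p, q)) \<ge> r" using p s r by (simp add: mult_le_cancel_right1)
      then have "\<mu> * K (s *\<^sub>R p, q) \<le> s * (p \<bullet> fst (k (s *\<^sub>R p, q)))"
        using K_growth[of "(s *\<^sub>R p, q)"] by simp
      then have "\<mu> * K (s *\<^sub>R p, q) * s powr (- \<mu> - 1) \<le> s * (p \<bullet> fst (k (s *\<^sub>R p, q))) * s powr (- \<mu> - 1)"
        by (rule mult_right_mono) simp
      also have "\<dots> = (p \<bullet> fst (k (s *\<^sub>R p, q))) * s powr (- \<mu>)"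
        using s by (simp add: powr_diff)
      finally show ?thesis by (simp add: mult.commute mult.left_commute)
    qed
    ultimately show "\<exists>y. ((\<lambda>s. K (s *\<^sub>R p, q) * s powr (- \<mu>)) has_real_derivative y) (at s) \<and> y \<ge> 0"
      by blast
  qed
  then have "K (p, q) * \<sigma> powr \<mu> \<le> K (\<sigma> *\<^sub>R p, q) * \<sigma> powr (- \<mu>) * \<sigma> powr \<mu>"
    by (intro mult_right_mono) auto
  also have "\<dots> = K (\<sigma> *\<^sub>R p, q)"
    using \<sigma> by (simp add: mult.assoc powr_add[symmetric])
  finally show ?thesis .
qed

text \<open>\<open>power_growth\<close> has exponent above 1; \<open>x\<close> solves
  \<open>x powr (\<mu> - 1) = A'\<close>, the factor needed to overcome the slope
  \<open>A\<close>.\<close>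

lemma superlinear: "\<exists>\<rho>\<ge>r. \<forall>z. norm (fst z) \<ge> \<rho> \<longrightarrow> A * norm (fst z) \<le> K z"
proof -
  obtain a where a: "a > 0" "\<And>z. norm (fst z) = r \<Longrightarrow> a \<le> K z"
    using lower_bound_on_sphere by blast
  define A' where "A' = max 1 (A * r / a)"
  define x where "x = A' powr (1 / (\<mu> - 1))"
  have A': "A' \<ge> 1" "A' \<ge> A * r / a" by (auto simp: A'_def)
  have x: "x \<ge> 1"
    unfolding x_def by (rule ge_one_powr_ge_zero) (use A' \<mu> in auto)
  have "A * norm (fst z) \<le> K z" if z: "norm (fst z) \<ge> r * x" for z
  proof -
    define \<sigma> where "\<sigma> = norm (fst z) / r"
    have \<sigma>x: "\<sigma> \<ge> x" using z r by (simp add: \<sigma>_def field_simps)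
    then have \<sigma>: "\<sigma> \<ge> x" "\<sigma> \<ge> 1" using x by auto
    define p where "p = (1 / \<sigma>) *\<^sub>R fst z"
    have zp: "z = (\<sigma> *\<^sub>R p, snd z)" using \<sigma> by (simp add: p_def prod_eq_iff)
    have "norm (fst z) > 0" using z r x by (smt (verit) mult_pos_pos)
    then have p: "norm p = r" using r by (simp add: p_def \<sigma>_def)
    have "A' = x powr (\<mu> - 1)" using A' \<mu> by (simp add: x_def powr_powr)
    also have "\<dots> \<le> \<sigma> powr (\<mu> - 1)"
      by (rule powr_mono2) (use \<sigma> x \<mu> in auto)
    finally have "A * r / a \<le> \<sigma> powr (\<mu> - 1)" using A' by linarith
    then have "A * r \<le> a * \<sigma> powr (\<mu> - 1)" using a by (simp add: field_simps)
    then have "A * r * \<sigma> \<le> a * \<sigma> powr (\<mu> - 1) * \<sigma>"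
      using \<sigma> by (intro mult_right_mono) auto
    also have "\<dots> = a * \<sigma> powr \<mu>" using \<sigma> by (simp add: powr_diff)
    also have "\<dots> \<le> K (p, snd z) * \<sigma> powr \<mu>"
      using a(2)[of "(p, snd z)"] p by (intro mult_right_mono) auto
    also have "\<dots> \<le> K z" using power_growth[OF p \<sigma>(2), of "snd z"] zp by simp
    finally show ?thesis using r by (simp add: \<sigma>_def)
  qed
  then show ?thesis using r x by (intro exI[of _ "r * x"]) (auto simp: mult_le_cancel_left1)
qed

text \<open>\<open>C0\<close> depends on \<open>K\<close> and \<open>v\<close> only. It determines
  the energy \<open>E\<close>, then \<open>E\<close> the radius \<open>R\<close> of the truncation,
  and \<open>R\<close> the coefficient \<open>lam\<close>.\<close>

theorem unit_solutions:
  assumes i0: "v $ i0 \<noteq> 0"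
    and \<beta>: "\<And>m z. m \<noteq> i0 \<Longrightarrow> unit_solution k v z \<Longrightarrow> transverse v i0 m (mean_conf v z) \<noteq> \<beta> m"
  obtains Z where "\<And>i. i < CARD('n) \<Longrightarrow> unit_solution k v (Z i)"
    "inj_on (\<lambda>i. lagrangian K k (Z i)) {..<CARD('n)}"
proof -
  let ?w = "int_vec v :: real ^ 'n"
  obtain Mr where Mr: "\<And>z. norm (fst z) \<le> r \<Longrightarrow> \<bar>K z\<bar> \<le> Mr"
    using bounded_on_tube[of r] by blast
  obtain \<rho>1 where \<rho>1: "\<rho>1 \<ge> r" "\<And>z. norm (fst z) \<ge> \<rho>1 \<Longrightarrow> norm ?w * norm (fst z) \<le> K z"
    using superlinear by blast
  obtain M1 where M1: "\<And>z. norm (fst z) \<le> \<rho>1 \<Longrightarrow> \<bar>K z\<bar> \<le> M1"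
    using bounded_on_tube[of \<rho>1] by blast
  \<comment> \<open>The first entry bounds \<open>p \<bullet> w - K\<close>, the second
    \<open>p \<bullet> w - Q\<close> for every \<open>lam\<close> at least 1; hence
    \<open>C0\<close> serves every convex combination of \<open>K\<close> and
    \<open>Q\<close>.\<close>
  define C0 where "C0 = max (\<rho>1 * norm ?w + \<bar>M1\<bar>) ((norm ?w)\<^sup>2)"
  have C0_nonneg: "C0 \<ge> 0" by (simp add: C0_def le_max_iff_disj)
  have C0K: "fst z \<bullet> ?w - K z \<le> C0" for z
  proof -
    have cs: "fst z \<bullet> ?w \<le> norm (fst z) * norm ?w" by (rule norm_cauchy_schwarz)
    show ?thesis
    proof (cases "norm (fst z) \<ge> \<rho>1")
      case True
      then show ?thesis using \<rho>1(2)[OF True] cs C0_nonneg by (simp add: mult.commute)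
    next
      case False
      then have "norm (fst z) * norm ?w \<le> \<rho>1 * norm ?w" "\<bar>K z\<bar> \<le> \<bar>M1\<bar>"
        using M1[of z] by (auto intro: mult_right_mono)
      then show ?thesis using cs by (simp add: C0_def)
    qed
  qed
  \<comment> \<open>An orbit of energy above \<open>E\<close> cannot meet the tube of radius r,
    where \<open>K\<close> is at most \<open>Mr\<close>, and so has action above
    \<open>C0 + 1\<close>.\<close>
  define E where "E = max Mr ((C0 + 1) / (\<mu> - 1)) + 1"
  have E: "Mr < E" "C0 + 1 < (\<mu> - 1) * E" "E > 0"
  proof -
    show "Mr < E" by (simp add: E_def)
    have "(C0 + 1) / (\<mu> - 1) < E" by (simp add: E_def)
    then show *: "C0 + 1 < (\<mu> - 1) * E" using \<mu> by (simp add: field_simps)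
    then show "E > 0" using C0_nonneg \<mu> by (smt (verit) mult_nonneg_nonpos)
  qed
  obtain \<rho>2 where \<rho>2: "\<rho>2 \<ge> r" "\<And>z. norm (fst z) \<ge> \<rho>2 \<Longrightarrow> 1 * norm (fst z) \<le> K z"
    using superlinear by blast
  define R where "R = max \<rho>2 (E + 1)"
  have R: "R \<ge> r" "R > 0" using \<rho>2 r by (auto simp: R_def)
  have KR: "K z > E" if "norm (fst z) \<ge> R" for z
    using \<rho>2(2)[of z] that by (simp add: R_def)
  obtain M2 where M2: "\<And>z. norm (fst z) \<le> R + 1 \<Longrightarrow> \<bar>K z\<bar> \<le> M2"
    using bounded_on_tube[of "R + 1"] by blast
  \<comment> \<open>The second entry makes \<open>Q\<close> exceed \<open>E\<close> outside radius
    \<open>R\<close>, the third makes \<open>Q\<close> dominate \<open>K\<close> on the shell from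
    \<open>R\<close> to \<open>R + 1\<close> where the cutoff varies.\<close>
  define lam where "lam = max 1 (max (2 * (E + 1) / R\<^sup>2) (2 * M2 / R\<^sup>2))"
  have lam: "lam \<ge> 1" "2 * (E + 1) / R\<^sup>2 \<le> lam" "2 * M2 / R\<^sup>2 \<le> lam"
    by (auto simp: lam_def)
  have R2: "R\<^sup>2 > 0" using R by simp
  have lamR: "E + 1 \<le> lam / 2 * R\<^sup>2" "M2 \<le> lam / 2 * R\<^sup>2"
    using lam(2,3) R2 by (simp_all add: pos_divide_le_eq)
  define Q where "Q z = lam / 2 * (norm (fst z))\<^sup>2" for z :: "'n phase"
  have QR: "lam / 2 * R\<^sup>2 \<le> Q z" if "norm (fst z) \<ge> R" for z
    unfolding Q_def using that R lam by (intro mult_left_mono power_mono) auto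
  define a where "a = R\<^sup>2"
  define b where "b = (R + 1)\<^sup>2"
  have ab: "a < b" using R by (simp add: a_def b_def power2_sum)
  define cut where "cut z = cutoff a b ((norm (fst z))\<^sup>2)" for z :: "'n phase"
  define cut' where "cut' z = cutoff' a b ((norm (fst z))\<^sup>2)" for z :: "'n phase"
  define F where "F z = cut z * (K z - Q z)" for z
  define G where "G z = cut z *\<^sub>R (k z - (lam *\<^sub>R fst z, 0)) + ((K z - Q z) * (2 * cut' z)) *\<^sub>R (fst z, 0)" for z
  have cut01: "0 \<le> cut z" "cut z \<le> 1" for z by (auto simp: cut_def cutoff_bounds)
  have in_R: "cut z = 1" "cut' z = 0" if "norm (fst z) \<le> R" for z
  proof -
    have "(norm (fst z))\<^sup>2 \<le> a"
      unfolding a_def using that by (intro power_mono) auto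
    then show "cut z = 1" "cut' z = 0"
      by (auto simp: cut_def cut'_def cutoff_eq_1[OF ab] cutoff'_eq_0)
  qed
  have out_R: "cut z = 0" "cut' z = 0" if "norm (fst z) \<ge> R + 1" for z
  proof -
    have "b \<le> (norm (fst z))\<^sup>2"
      unfolding b_def using that R by (intro power_mono) auto
    then show "cut z = 0" "cut' z = 0" by (auto simp: cut_def cut'_def cutoff_eq_0 cutoff'_eq_0)
  qed
  have dQ: "(Q has_derivative (\<lambda>h. h \<bullet> (lam *\<^sub>R fst z, 0))) (at z)" for z
    unfolding Q_def[abs_def] power2_norm_eq_inner
    by (auto intro!: derivative_eq_intros simp: inner_prod_def inner_commute)
  have dK: "(K has_derivative (\<lambda>h. h \<bullet> k z)) (at z)" for z
    using K_deriv unfolding gderiv_def by blast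
  have dcut: "(cut has_derivative (\<lambda>h. cut' z * (2 * (fst h \<bullet> fst z)))) (at z)" for z
  proof -
    have 1: "((\<lambda>z :: 'n phase. (norm (fst z))\<^sup>2) has_derivative (\<lambda>h. 2 * (fst h \<bullet> fst z))) (at z)"
      unfolding power2_norm_eq_inner by (auto intro!: derivative_eq_intros simp: inner_commute)
    show ?thesis
      using has_derivative_compose[OF 1 has_field_derivative_imp_has_derivative[OF DERIV_cutoff[OF ab]]]
      by (simp add: cut_def[abs_def] cut'_def)
  qed
  have F_deriv: "GDERIV F z :> G z" for z
  proof -
    have "(F has_derivative (\<lambda>h. cut z * (h \<bullet> k z - h \<bullet> (lam *\<^sub>R fst z, 0)) + cut' z * (2 * (fst h \<bullet> fst z)) * (K z - Q z))) (at z)"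
      unfolding F_def[abs_def] by (rule has_derivative_mult[OF dcut has_derivative_diff[OF dK dQ]])
    then show ?thesis
      unfolding gderiv_def by (rule back_subst[where P = "\<lambda>D. (F has_derivative D) (at z)"])
        (simp add: G_def fun_eq_iff inner_prod_def inner_add_right inner_diff_right algebra_simps)
  qed
  have cut_cont: "continuous_on UNIV cut"
    using dcut by (auto intro!: continuous_at_imp_continuous_on has_derivative_continuous)
  have cut'_cont: "continuous_on UNIV cut'"
    unfolding cut'_def by (rule continuous_on_compose2[OF continuous_on_cutoff'[OF ab]]) (auto intro!: continuous_intros)
  have Q_cont: "continuous_on UNIV Q"
    unfolding Q_def[abs_def] by (intro continuous_intros)
  interpret D: discretisation F G lam "R + 1" v
  proof
    show "GDERIV F z :> G z" for z by (rule F_deriv)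
    show "continuous_on UNIV G"
      unfolding G_def by (intro continuous_intros cut_cont cut'_cont Q_cont K_cont k_cont)
    show "F (x, y + int_vec m) = F (x, y)" for x y m by (simp add: F_def K_per cut_def Q_def)
    show "G (x, y + int_vec m) = G (x, y)" for x y m
      by (simp add: G_def K_per k_per cut_def cut'_def Q_def)
    show "F (x, y) = 0" if "norm x \<ge> R + 1" for x y
      using out_R[of "(x, y)"] that by (simp add: F_def)
    show "G (x, y) = 0" if "norm x \<ge> R + 1" for x y
      using out_R[of "(x, y)"] that by (simp add: G_def zero_prod_def)
  qed (use lam in simp)
  define Ht where "Ht z = Q z + F z" for z
  have Ht: "Ht z = cut z * K z + (1 - cut z) * Q z" for z by (simp add: Ht_def F_def algebra_simps)
  have C0H: "fst z \<bullet> ?w - (lam / 2 * (norm (fst z))\<^sup>2 + F z) \<le> C0" for z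
  proof -
    have "fst z \<bullet> ?w - Q z \<le> (norm ?w)\<^sup>2"
    proof -
      have "fst z \<bullet> ?w \<le> norm (fst z) * norm ?w" by (rule norm_cauchy_schwarz)
      moreover have "0 \<le> (norm (fst z) - norm ?w)\<^sup>2" by simp
      then have "norm (fst z) * norm ?w \<le> (norm (fst z))\<^sup>2 / 2 + (norm ?w)\<^sup>2 / 2"
        by (simp add: power2_diff)
      moreover have "1 / 2 * (norm (fst z))\<^sup>2 \<le> Q z"
        unfolding Q_def using lam by (intro mult_right_mono) auto
      moreover have "0 \<le> (norm ?w)\<^sup>2" by simp
      ultimately show ?thesis by linarith
    qed
    then have q: "fst z \<bullet> ?w - Q z \<le> C0" by (simp add: C0_def)
    have "fst z \<bullet> ?w - Ht z = cut z * (fst z \<bullet> ?w - K z) + (1 - cut z) * (fst z \<bullet> ?w - Q z)"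
      by (simp add: Ht algebra_simps)
    also have "\<dots> \<le> cut z * C0 + (1 - cut z) * C0"
      using C0K[of z] q cut01[of z] by (intro add_mono mult_left_mono) auto
    finally show ?thesis by (simp add: Ht_def Q_def algebra_simps)
  qed
  have Ht_growth: "\<mu> * Ht z \<le> fst z \<bullet> (lam *\<^sub>R fst z + fst (G z))" if z: "norm (fst z) \<ge> r" for z
  proof -
    \<comment> \<open>The cutoff decreases exactly where \<open>Q\<close> dominates
      \<open>K\<close>, so its derivative contributes to \<open>p \<bullet> H_p\<close> with the
      favourable sign.\<close>
    have sign: "(K z - Q z) * cut' z \<ge> 0"
    proof (cases "R < norm (fst z) \<and> norm (fst z) < R + 1")
      case True
      then have "K z \<le> Q z" using M2[of z] QR[of z] lamR by force
      then show ?thesis using cutoff'_nonpos[of a b] by (simp add: cut'_def mult_nonpos_nonpos)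
    next
      case False
      then have "cut' z = 0" using in_R(2)[of z] out_R(2)[of z] by force
      then show ?thesis by simp
    qed
    have eq: "fst z \<bullet> (lam *\<^sub>R fst z + fst (G z)) = cut z * (fst z \<bullet> fst (k z)) + (1 - cut z) * (2 * Q z)
        + 2 * (norm (fst z))\<^sup>2 * ((K z - Q z) * cut' z)"
      by (simp add: G_def Q_def inner_add_right inner_diff_right power2_norm_eq_inner algebra_simps)
    have "\<mu> * Q z \<le> 2 * Q z" using \<mu> lam by (intro mult_right_mono) (auto simp: Q_def)
    moreover have "0 \<le> 2 * (norm (fst z))\<^sup>2 * ((K z - Q z) * cut' z)"
      by (rule mult_nonneg_nonneg[OF _ sign]) simp
    ultimately have "cut z * (\<mu> * K z) + (1 - cut z) * (\<mu> * Q z) + 0 \<le> fst z \<bullet> (lam *\<^sub>R fst z + fst (G z))"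
      unfolding eq using K_growth[OF z] cut01[of z] by (intro add_mono mult_left_mono) auto
    then show ?thesis by (simp add: Ht algebra_simps)
  qed
  \<comment> \<open>A point outside radius \<open>R\<close> has energy above \<open>E\<close>. The
    energy is conserved, so the whole orbit avoids the tube of radius r, the growth inequality holds
    at all times, and integrating it contradicts the bound on the action.\<close>
  have in_tube: "norm (fst (z t)) \<le> R" if sol: "D.solution z" and act: "D.action z \<le> C0 + 1" for z t
  proof (rule ccontr)
    assume neg: "\<not> norm (fst (z t)) \<le> R"
    have dz: "(z has_vector_derivative D.V (z s)) (at s)" for s
      using sol unfolding D.solution_def by blast
    have "((\<lambda>s. Ht (z s)) has_real_derivative 0) (at s)" for s
    proof -
      have dH: "(Ht has_derivative (\<lambda>h. h \<bullet> (lam *\<^sub>R fst (z s), 0) + h \<bullet> G (z s))) (at (z s))"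
        unfolding Ht_def[abs_def] using F_deriv unfolding gderiv_def by (intro has_derivative_add dQ) blast
      have "((\<lambda>s. Ht (z s)) has_derivative (\<lambda>h. (h *\<^sub>R D.V (z s)) \<bullet> (lam *\<^sub>R fst (z s), 0) + (h *\<^sub>R D.V (z s)) \<bullet> G (z s))) (at s)"
        by (rule has_derivative_compose[OF dz[of s, unfolded has_vector_derivative_def] dH])
      moreover have "(\<lambda>h. (h *\<^sub>R D.V (z s)) \<bullet> (lam *\<^sub>R fst (z s), 0) + (h *\<^sub>R D.V (z s)) \<bullet> G (z s)) = (*) 0"
        by (rule ext) (simp add: D.V_def inner_prod_def inner_add_left inner_commute algebra_simps)
      ultimately show ?thesis by (simp only: has_field_derivative_def)
    qed
    then have const: "Ht (z s) = Ht (z t)" for s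
      using DERIV_isconst_all[of "\<lambda>s. Ht (z s)" s t] by blast
    have large: "Ht (z t) > E"
    proof -
      have "K (z t) > E" "Q (z t) > E" using KR[of "z t"] QR[of "z t"] lamR neg by auto
      then have "cut (z t) * E + (1 - cut (z t)) * E < cut (z t) * K (z t) + (1 - cut (z t)) * Q (z t)"
        using cut01[of "z t"]
        by (cases "cut (z t) = 0") (auto intro!: add_less_le_mono mult_left_mono mult_strict_left_mono)
      then show ?thesis by (simp add: Ht algebra_simps)
    qed
    have "D.lagr (z s) \<ge> (\<mu> - 1) * E" for s
    proof -
      have "norm (fst (z s)) \<ge> r"
      proof (rule ccontr)
        assume n: "\<not> norm (fst (z s)) \<ge> r"
        then have "Ht (z s) = K (z s)" using in_R[of "z s"] R by (simp add: Ht)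
        then show False using Mr[of "z s"] n E large const[of s] by simp
      qed
      note growth = Ht_growth[OF this]
      have "D.lagr (z s) = fst (z s) \<bullet> (lam *\<^sub>R fst (z s) + fst (G (z s))) - Ht (z s)"
        by (simp add: D.lagr_def Ht_def Q_def)
      with growth have "(\<mu> - 1) * Ht (z s) \<le> D.lagr (z s)" by (simp add: left_diff_distrib)
      moreover have "(\<mu> - 1) * E \<le> (\<mu> - 1) * Ht (z s)"
        using large const[of s] \<mu> by (intro mult_left_mono) auto
      ultimately show ?thesis by linarith
    qed
    moreover have "continuous_on {0..1} (\<lambda>s. D.lagr (z s))"
      by (rule continuous_on_compose2[OF D.lagr_cont D.solution_continuous[OF sol]]) simp
    ultimately have "integral {0..1} (\<lambda>s :: real. (\<mu> - 1) * E) \<le> D.action z"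
      unfolding D.action_def by (intro integral_le integrable_continuous_real continuous_intros) auto
    then show False using act E(2) by simp
  qed
  have G_in: "G z = k z - (lam *\<^sub>R fst z, 0)" "F z = K z - Q z" if "norm (fst z) \<le> R" for z
    using in_R[OF that] by (simp_all add: G_def F_def zero_prod_def)
  have usol: "unit_solution k v z" if sol: "D.solution z" and act: "D.action z \<le> C0 + 1" for z
  proof -
    have "D.V (z t) = J (k (z t))" for t
      using G_in(1)[OF in_tube[OF that]] by (simp add: D.V_def J_def)
    then show ?thesis using sol by (simp add: D.solution_def unit_solution_def)
  qed
  have lag: "D.action z = lagrangian K k z" if sol: "D.solution z" and act: "D.action z \<le> C0 + 1" for z
  proof -
    have "D.lagr (z t) = fst (z t) \<bullet> fst (k (z t)) - K (z t)" for t
      using G_in[OF in_tube[OF that]] by (simp add: D.lagr_def Q_def)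
    then show ?thesis by (simp add: D.action_def lagrangian_def)
  qed
  obtain Z where Z: "\<And>i. i < CARD('n) \<Longrightarrow> D.solution (Z i) \<and> D.action (Z i) \<le> C0 + 1"
    "inj_on (\<lambda>i. D.action (Z i)) {..<CARD('n)}"
    using D.distinct_critical_values[OF i0 C0H \<beta>[OF _ usol]] by blast
  show thesis
  proof (rule that[of Z])
    show "unit_solution k v (Z i)" if "i < CARD('n)" for i using usol Z(1)[OF that] by blast
    show "inj_on (\<lambda>i. lagrangian K k (Z i)) {..<CARD('n)}"
      using Z(2) by (rule inj_on_cong[THEN iffD1, rotated]) (use lag Z(1) in auto)
  qed
qed

section \<open>Behaviour under time shifts and integer translations\<close>

lemma unit_solution_continuous: "unit_solution k v z \<Longrightarrow> continuous_on S z"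
  unfolding unit_solution_def
  by (meson continuous_at_imp_continuous_on has_vector_derivative_continuous)

lemma lagrangian_shift:
  assumes z: "unit_solution k v z"
  shows "lagrangian K k (\<lambda>t. z (t + \<theta>) + (0, int_vec m)) = lagrangian K k z"
proof -
  have per: "k (z t + (0, int_vec q)) = k (z t)" "K (z t + (0, int_vec q)) = K (z t)" for t q
    using k_per[of "fst (z t)" "snd (z t)" q] K_per[of "fst (z t)" "snd (z t)" q]
    by (simp_all add: plus_prod_def)
  let ?f = "\<lambda>t. fst (z t) \<bullet> fst (k (z t)) - K (z t)"
  have "continuous_on UNIV (\<lambda>t. k (z t))" "continuous_on UNIV (\<lambda>t. K (z t))"
    by (rule continuous_on_compose2[OF k_cont unit_solution_continuous[OF z, of UNIV]]
        continuous_on_compose2[OF K_cont[of UNIV] unit_solution_continuous[OF z, of UNIV]], simp)+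
  then have "continuous_on UNIV ?f" by (intro continuous_intros unit_solution_continuous[OF z])
  moreover have "?f (t + 1) = ?f t" for t using z per[of t v] by (simp add: unit_solution_def)
  ultimately have "integral {0..1} (\<lambda>t. ?f (t + \<theta>)) = integral {0..1} ?f"
    by (rule periodic_integral_shift)
  then show ?thesis
    unfolding lagrangian_def per by simp
qed

lemma mean_conf_shift:
  assumes z: "unit_solution k v z"
  shows "mean_conf v (\<lambda>t. z (t + \<theta>) + (0, int_vec m)) = mean_conf v z + \<theta> *\<^sub>R int_vec v + int_vec m"
proof -
  let ?f = "\<lambda>t. snd (z t) - t *\<^sub>R int_vec v"
  have fc: "continuous_on UNIV ?f" by (intro continuous_intros unit_solution_continuous[OF z])
  have "?f (t + 1) = ?f t" for t using z by (simp add: unit_solution_def scaleR_left_distrib)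
  with fc have shift: "integral {0..1} (\<lambda>t. ?f (t + \<theta>)) = integral {0..1} ?f"
    by (rule periodic_integral_shift)
  have int: "(\<lambda>t. ?f (t + \<theta>)) integrable_on {0..1}"
    by (rule integrable_continuous_real, rule continuous_on_compose2[OF fc]) (auto intro!: continuous_intros)
  have "mean_conf v (\<lambda>t. z (t + \<theta>) + (0, int_vec m)) = integral {0..1} (\<lambda>t. ?f (t + \<theta>) + (\<theta> *\<^sub>R int_vec v + int_vec m))"
    unfolding mean_conf_def by (rule integral_cong) (simp add: algebra_simps)
  also have "\<dots> = integral {0..1} (\<lambda>t. ?f (t + \<theta>)) + integral {0..1} (\<lambda>t :: real. \<theta> *\<^sub>R int_vec v + int_vec m)"
    by (rule Henstock_Kurzweil_Integration.integral_add[OF int integrable_const_ivl])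
  finally show ?thesis
    unfolding shift mean_conf_def by (simp add: add.assoc)
qed

end

section \<open>The multiplicity theorem\<close>

theorem theorem1:
  fixes H :: "(real ^ 'n::finite) \<times> (real ^ 'n) \<Rightarrow> real"
    and T :: real
    and v :: "int ^ 'n"
  assumes "C1_function H"
    and "\<forall>x y. \<forall>m :: int ^ 'n. H (x, y + int_vec m) = H (x, y)"
    and "\<exists>r > 0. \<exists>\<mu> > 1. \<forall>z. norm (fst z) \<ge> r \<longrightarrow>
           0 < \<mu> * H z \<and> \<mu> * H z \<le> inner (fst z) (fst (gradient H z))"
    and "T > 0"
    and "prime_rotational v"
  shows "{..<CARD('n)} \<lesssim> distinct_solutions H T v"
proof (cases "finite (distinct_solutions H T v)")
  case False
  then show ?thesis by (rule finite_lepoll_infinite) simp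
next
  case fin: True
  define K where "K z = T * H z" for z
  define k where "k z = T *\<^sub>R gradient H z" for z
  obtain r \<mu> where r: "r > 0" and \<mu>: "\<mu> > 1"
    and growth: "\<And>z. norm (fst z) \<ge> r \<Longrightarrow> 0 < \<mu> * H z \<and> \<mu> * H z \<le> fst z \<bullet> fst (gradient H z)"
    using assms(3) by blast
  obtain i0 where i0: "v $ i0 \<noteq> 0"
    using assms(5) by (auto simp: prime_rotational_def vec_eq_iff)
  have grad: "GDERIV H z :> gradient H z" for z
    by (rule GDERIV_gradient) (use assms(1) in \<open>unfold C1_function_def, blast\<close>)
  interpret superquadratic K k r "min \<mu> 2"
  proof
    show "GDERIV K z :> k z" for z
    proof -
      have "(H has_derivative (\<lambda>h. h \<bullet> gradient H z)) (at z)"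
        using grad unfolding gderiv_def by blast
      from has_derivative_mult_right[OF this, of T] show ?thesis
        unfolding gderiv_def K_def[abs_def] k_def by simp
    qed
    show "continuous_on UNIV k"
      using assms(1) unfolding C1_function_def k_def by (intro continuous_intros) blast
    show "K (x, y + int_vec m) = K (x, y)" for x y m using assms(2) by (simp add: K_def)
    show pos: "0 < K z" if "norm (fst z) \<ge> r" for z
      using growth[OF that] \<mu> assms(4) by (simp add: K_def zero_less_mult_iff)
    show "min \<mu> 2 * K z \<le> fst z \<bullet> fst (k z)" if "norm (fst z) \<ge> r" for z
    proof -
      have "min \<mu> 2 * K z \<le> \<mu> * K z" using pos[OF that] by (intro mult_right_mono) auto
      also have "\<dots> = T * (\<mu> * H z)" by (simp add: K_def)
      also have "\<dots> \<le> T * (fst z \<bullet> fst (gradient H z))"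
        using growth[OF that] assms(4) by (intro mult_left_mono) auto
      finally show ?thesis by (simp add: k_def)
    qed
  qed (use r \<mu> in auto)
  let ?S = "bvp_solutions H T v"
  let ?rel = "{(z, u). z \<in> ?S \<and> u \<in> ?S \<and> same_solution z u}"
  let ?res = "\<lambda>(z :: real \<Rightarrow> 'n phase) t. z (T * t)"
  have J_scale: "J (k z) = T *\<^sub>R J (gradient H z)" for z by (simp add: J_def k_def)
  have to_unit: "unit_solution k v (?res z)" if z: "z \<in> ?S" for z
  proof -
    have "((\<lambda>t. z (T * t)) has_vector_derivative T *\<^sub>R J (gradient H (z (T * t)))) (at t)" for t
    proof (rule vector_diff_chain_at[unfolded o_def])
      show "((*) T has_vector_derivative T) (at t)" by (auto intro!: derivative_eq_intros)
      show "(z has_vector_derivative J (gradient H (z (T * t)))) (at (T * t))"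
        using z by (simp add: bvp_solutions_def)
    qed
    moreover have "z (T * (t + 1)) = z (T * t) + (0, int_vec v)" for t
      using z by (simp add: bvp_solutions_def distrib_left)
    ultimately show ?thesis by (simp add: unit_solution_def J_scale)
  qed
  have from_unit: "(\<lambda>t. \<zeta> (t / T)) \<in> ?S" if \<zeta>: "unit_solution k v \<zeta>" for \<zeta>
  proof -
    have d: "((\<lambda>t. \<zeta> (t / T)) has_vector_derivative J (gradient H (\<zeta> (t / T)))) (at t)" for t
    proof -
      have 1: "((\<lambda>t. t / T) has_vector_derivative (1 / T)) (at t)"
        by (auto intro!: derivative_eq_intros)
      have 2: "(\<zeta> has_vector_derivative J (k (\<zeta> (t / T)))) (at (t / T))"
        using \<zeta> by (simp add: unit_solution_def)
      show ?thesis using vector_diff_chain_at[OF 1 2] assms(4) by (simp add: o_def J_scale)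
    qed
    have "continuous_on UNIV (\<lambda>t. gradient H (\<zeta> (t / T)))"
    proof (rule continuous_on_compose2[of UNIV "gradient H"])
      show "continuous_on UNIV (gradient H)" using assms(1) by (simp add: C1_function_def)
      show "continuous_on UNIV (\<lambda>t. \<zeta> (t / T))"
        by (rule continuous_on_compose2[OF unit_solution_continuous[OF \<zeta>]]) (use assms(4) in \<open>auto intro!: continuous_intros\<close>)
    qed simp
    then have "continuous_on UNIV (\<lambda>t. J (gradient H (\<zeta> (t / T))))"
      unfolding J_def by (intro continuous_intros)
    then have "(\<lambda>t. \<zeta> (t / T)) C1_differentiable_on UNIV"
      unfolding C1_differentiable_on_def
      by (intro exI[of _ "\<lambda>t. J (gradient H (\<zeta> (t / T)))"] conjI ballI d)
    moreover have "\<zeta> ((t + T) / T) = \<zeta> (t / T) + (0, int_vec v)" for t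
      using \<zeta> assms(4) by (simp add: unit_solution_def add_divide_distrib)
    ultimately show ?thesis using d by (simp add: bvp_solutions_def)
  qed
  have same_unit: "\<exists>\<theta> m. ?res u = (\<lambda>t. ?res z (t + \<theta>) + (0, int_vec m))" if same: "same_solution z u" for z u
  proof -
    obtain \<theta> m where "\<And>t. u t = z (t + \<theta>) + (0, int_vec m)"
      using same unfolding same_solution_def by blast
    then have "?res u = (\<lambda>t. ?res z (t + \<theta> / T) + (0, int_vec m))"
      using assms(4) by (simp add: distrib_left)
    then show ?thesis by blast
  qed
  have equiv: "equiv ?S ?rel" by (rule equiv_same_solution)
  have "\<exists>\<beta>. \<forall>\<zeta>. unit_solution k v \<zeta> \<longrightarrow> transverse v i0 m (mean_conf v \<zeta>) \<noteq> \<beta>" for m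
  proof -
    define rep where "rep C = (SOME z. z \<in> C)" for C :: "(real \<Rightarrow> 'n phase) set"
    \<comment> \<open>Members of a class differ by a time shift, which the form does not see, and by
      an integer translation; so each of the finitely many classes contributes countably many
      values.\<close>
    define L where "L = (\<Union>C\<in>distinct_solutions H T v.
       range (\<lambda>q. transverse v i0 m (mean_conf v (?res (rep C))) + transverse v i0 m (int_vec q)))"
    have in_L: "transverse v i0 m (mean_conf v \<zeta>) \<in> L" if \<zeta>: "unit_solution k v \<zeta>" for \<zeta>
    proof -
      let ?z = "\<lambda>t. \<zeta> (t / T)"
      let ?C = "?rel `` {?z}"
      have zS: "?z \<in> ?S" by (rule from_unit[OF \<zeta>])
      have C: "?C \<in> distinct_solutions H T v"
        unfolding distinct_solutions_def by (rule quotientI[OF zS])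
      have "?z \<in> ?C" by (rule equiv_class_self[OF equiv zS])
      then have "rep ?C \<in> ?C"
        unfolding rep_def by (rule someI[of "\<lambda>z. z \<in> ?C"])
      then have "(rep ?C, ?z) \<in> ?rel" using equiv by (meson Image_singleton_iff equivE symD)
      then have rS: "rep ?C \<in> ?S" and "same_solution (rep ?C) ?z" by auto
      then obtain \<theta> q where "?res ?z = (\<lambda>t. ?res (rep ?C) (t + \<theta>) + (0, int_vec q))"
        using same_unit by blast
      moreover have "?res ?z = \<zeta>" using assms(4) by simp
      ultimately have "mean_conf v \<zeta> = mean_conf v (?res (rep ?C)) + \<theta> *\<^sub>R int_vec v + int_vec q"
        using mean_conf_shift[OF to_unit[OF rS], of \<theta> q] by simp
      then have "transverse v i0 m (mean_conf v \<zeta>) = transverse v i0 m (mean_conf v (?res (rep ?C))) + transverse v i0 m (int_vec q)"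
        by (simp add: transverse_add transverse_scaled_self[OF i0])
      then show ?thesis
        unfolding L_def using C by blast
    qed
    have "countable L"
      unfolding L_def by (intro countable_UN countable_finite[OF fin] countable_image) simp
    then have "L \<noteq> UNIV" using uncountable_UNIV_real by (metis (no_types))
    then obtain \<beta> where "\<beta> \<notin> L" by auto
    then have "\<forall>\<zeta>. unit_solution k v \<zeta> \<longrightarrow> transverse v i0 m (mean_conf v \<zeta>) \<noteq> \<beta>"
      using in_L by metis
    then show ?thesis ..
  qed
  then obtain \<beta> where \<beta>: "\<And>m \<zeta>. unit_solution k v \<zeta> \<Longrightarrow> transverse v i0 m (mean_conf v \<zeta>) \<noteq> \<beta> m"
    by metis
  obtain Z where Z: "\<And>i. i < CARD('n) \<Longrightarrow> unit_solution k v (Z i)"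
    "inj_on (\<lambda>i. lagrangian K k (Z i)) {..<CARD('n)}"
    using unit_solutions[OF i0, of \<beta>] \<beta> by blast
  define cls where "cls i = ?rel `` {\<lambda>t. Z i (t / T)}" for i
  \<comment> \<open>The integrated Lagrangian is constant on classes, so different values separate
    them.\<close>
  have "inj_on cls {..<CARD('n)}"
  proof (rule inj_onI)
    fix i j assume ij: "i \<in> {..<CARD('n)}" "j \<in> {..<CARD('n)}" "cls i = cls j"
    have "(\<lambda>t. Z i (t / T)) \<in> ?S" "(\<lambda>t. Z j (t / T)) \<in> ?S"
      using from_unit Z(1) ij by auto
    then have "((\<lambda>t. Z i (t / T)), (\<lambda>t. Z j (t / T))) \<in> ?rel"
      using eq_equiv_class_iff[OF equiv] ij(3) unfolding cls_def by blast
    then have "same_solution (\<lambda>t. Z i (t / T)) (\<lambda>t. Z j (t / T))" by simp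
    then obtain \<theta> m where "?res (\<lambda>t. Z j (t / T)) = (\<lambda>t. ?res (\<lambda>t. Z i (t / T)) (t + \<theta>) + (0, int_vec m))"
      using same_unit by blast
    then have "Z j = (\<lambda>t. Z i (t + \<theta>) + (0, int_vec m))" using assms(4) by simp
    then have "lagrangian K k (Z j) = lagrangian K k (Z i)"
      using lagrangian_shift[OF Z(1), of i \<theta> m] ij by simp
    then show "i = j" using Z(2) ij by (auto dest: inj_onD)
  qed
  moreover have "cls ` {..<CARD('n)} \<subseteq> distinct_solutions H T v"
    unfolding distinct_solutions_def cls_def by (intro image_subsetI quotientI from_unit Z(1)) simp
  ultimately show ?thesis
    unfolding lepoll_def by blast
qed

end
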